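(* Let $k$ be a field, $H$ a Hopf algebra over $k$ with bijective antipode, and $X$ a stable anti-Yetter-Drinfeld module over $H$. Then the composite $$\mathbb{CM}^a_*(H,X)\hookrightarrow\mathbb{T}^a_*(H,X)\xrightarrow{\ \alpha_*\ }\mathbb{T}^c_*(H,X)^\vee\xrightarrow{\ q_*\ }\mathbb{CM}^c_*(H,X)^\vee$$ is an isomorphism of cyclic modules $q_*\alpha_*:\mathbb{CM}^a_*(H,X)\to\mathbb{CM}^c_*(H,X)^\vee$.
   Context: $S$ is the antipode, $\epsilon$ the counit; Sweedler notation $h_{(1)}\otimes h_{(2)}$ for $\Delta(h)$. $X$ is a left $H$-module and left $H$-comodule with coaction $x\mapsto x_{(-1)}\otimes x_{(0)}$. It is anti-Yetter-Drinfeld if $(hx)_{(-1)}\otimes(hx)_{(0)}=h_{(1)}x_{(-1)}S^{-1}(h_{(3)})\otimes h_{(2)}x_{(0)}$ for all $h,x$, and stable if $x_{(-1)}x_{(0)}=x$ and $S(x_{(-1)})x_{(0)}=x$ for all $x$. Para-cyclic modules here have degeneracies: a simplicial $k$-module $(Z_n,\partial_j,\sigma_j)$ with invertible $\tau_n$ satisfying $\partial_j\tau_n=\tau_{n-1}\partial_{j-1}$ and $\sigma_j\tau_n=\tau_{n+1}\sigma_{j-1}$ for $1\le j\le n$, $\partial_0\tau_n=\partial_n$, $\sigma_0\tau_n=\tau_{n+1}^2\sigma_n$. It is cyclic if $\tau_n^{n+1}=\mathrm{id}$. $\mathbb{T}^a_n(H,X)=H^{\otimes n+1}\otimes X$ is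 para-cyclic with $\partial_j(h^0\otimes\cdots\otimes h^n\otimes x)=\cdots\otimes h^jh^{j+1}\otimes\cdots\otimes x$ ($0\le j<n$), $\partial_n(h^0\otimes\cdots\otimes h^n\otimes x)=h^n_{(1)}h^0\otimes h^1\otimes\cdots\otimes h^{n-1}\otimes h^n_{(2)}x$, $\tau_n(h^0\otimes\cdots\otimes h^n\otimes x)=h^n_{(1)}\otimes h^0\otimes\cdots\otimes h^{n-1}\otimes h^n_{(2)}x$, $\sigma_0(h^0\otimes\cdots\otimes h^n\otimes x)=h^0\otimes 1\otimes h^1\otimes\cdots\otimes h^n\otimes x$, $\sigma_j=\tau_{n+1}^j\sigma_0\tau_n^{-j}$. It has the right $H$-coaction $\rho_R(h^0\otimes\cdots\otimes h^n\otimes x)=(h^0_{(1)}\otimes\cdots\otimes h^n_{(1)}\otimes x_{(0)})\otimes h^0_{(2)}\cdots h^n_{(2)}S(x_{(-1)})$. $\mathbb{CM}^a_*(H,X)$ denotes (under the identification valid for stable anti-Yetter-Drinfeld $X$) the coinvariants $\mathbb{T}^a_*(H,X)^H=\{v:\rho_R(v)=v\otimes 1\}$, with the restricted structure maps. $\mathbb{T}^c_n(H,X)=H^{\otimes n+1}\otimes X$ is para-cocyclic with $\tau_{c,n}(h^0\otimes\cdots\otimes h^n\otimes x)=h^1\otimes\cdots\otimes h^n\otimes x_{(-1)}h^0\otimes x_{(0)}$, $\partial^c_0(h^0\otimes\cdots\otimes h^n\otimes x)=h^0_{(1)}\otimes h^0_{(2)}\otimes h^1\otimes\cdots\otimes h^n\otimes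 x$, $\partial^c_j=\tau_{c,n+1}^{-j}\partial^c_0\tau_{c,n}^{j}$ ($0\le j\le n+1$), $\sigma^c_0(h^0\otimes\cdots\otimes h^n\otimes x)=\epsilon(h^1)\,h^0\otimes h^2\otimes\cdots\otimes h^n\otimes x$, $\sigma^c_j=\tau_{c,n-1}^{-j}\sigma^c_0\tau_{c,n}^{j}$ ($0\le j\le n-1$). For a para-cocyclic module $A_*$ with cofaces $\partial_j$, codegeneracies $\sigma_j$ and operators $\tau_n$, its cyclic dual $A_*^\vee$ is the para-cyclic module with the same underlying spaces and $\partial^\vee_0=\sigma_{n-1}\tau_n$, $\partial^\vee_{i+1}=\sigma_i$ ($0\le i\le n-1$), $\sigma^\vee_j=\partial_j$ ($0\le j\le n$), $\tau_{n,\vee}=\tau_n^{-1}$. $H$ acts on $\mathbb{T}^c_n(H,X)$ diagonally: $h\cdot(h^0\otimes\cdots\otimes h^n\otimes x)=h_{(1)}h^0\otimes\cdots\otimes h_{(n+1)}h^n\otimes h_{(n+2)}x$. $\mathbb{CM}^c_*(H,X)^\vee$ is the quotient of $\mathbb{T}^c_*(H,X)^\vee$ by the span of all $h\cdot v-\epsilon(h)v$, with the induced structure maps, and $q_*$ is the quotient map. $\alpha_n(h^0\otimes\cdots\otimes h^n\otimes x)=h^0_{(1)}\otimes h^0_{(2)}h^1_{(1)}\otimes\cdots\otimes h^0_{(n+1)}h^1_{(n)}\cdots h^n_{(1)}\otimes h^0_{(n+2)}h^1_{(n+1)}\cdots h^n_{(2)}x$. *)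

theory Defs
  imports
    "HOL-Library.Function_Algebras"
    "HOL-Algebra.Algebraic_Closure_Type"
begin

section \<open>Tensor products of vector spaces over a field\<close>

text \<open>
  A pure tensor \<open>a \<otimes> b\<close> is represented by the functional that evaluates bilinear forms at
  \<open>(a, b)\<close>; the tensor product is the linear span of the pure tensors.  Over a field this is the
  tensor product, because bilinear forms separate its points: the universal property is proved below
  (\<open>tens_sum_eq\<close>, \<open>tensor_sum_eq\<close>, \<open>lin_ext_pure\<close>, \<open>lin_ext_add\<close>, \<open>lin_ext_scale\<close>).
  Scalar multiplications are explicit parameters, as in the locale \<open>vector_space\<close>.
\<close>

definition fscale :: "'k::field \<Rightarrow> ('i \<Rightarrow> 'k) \<Rightarrow> 'i \<Rightarrow> 'k" where
  "fscale c t = (\<lambda>i. c * t i)"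

definition bilin ::
  "('k::field \<Rightarrow> 'a::ab_group_add \<Rightarrow> 'a) \<Rightarrow> ('k \<Rightarrow> 'b::ab_group_add \<Rightarrow> 'b) \<Rightarrow>
   ('k \<Rightarrow> 'v::ab_group_add \<Rightarrow> 'v) \<Rightarrow> ('a \<Rightarrow> 'b \<Rightarrow> 'v) \<Rightarrow> bool" where
  "bilin sA sB s F \<longleftrightarrow>
     (\<forall>a. Vector_Spaces.linear sB s (F a)) \<and> (\<forall>b. Vector_Spaces.linear sA s (\<lambda>a. F a b))"

type_synonym ('k, 'a, 'b) tensor2 = "('a \<Rightarrow> 'b \<Rightarrow> 'k) \<Rightarrow> 'k"

definition tens ::
  "('k::field \<Rightarrow> 'a::ab_group_add \<Rightarrow> 'a) \<Rightarrow> ('k \<Rightarrow> 'b::ab_group_add \<Rightarrow> 'b) \<Rightarrow>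
   'a \<Rightarrow> 'b \<Rightarrow> ('k, 'a, 'b) tensor2" where
  "tens sA sB a b = (\<lambda>\<beta>. if bilin sA sB (*) \<beta> then \<beta> a b else 0)"

definition tens_space ::
  "('k::field \<Rightarrow> 'a::ab_group_add \<Rightarrow> 'a) \<Rightarrow> ('k \<Rightarrow> 'b::ab_group_add \<Rightarrow> 'b) \<Rightarrow>
   ('k, 'a, 'b) tensor2 set" where
  "tens_space sA sB = Modules.module.span fscale {tens sA sB a b | a b. True}"

text \<open>
  A chosen expression of a tensor as a finite sum of pure tensors.  Sums over \<open>tens_rep\<close> of
  expressions bilinear in the two components do not depend on the choice (\<open>tens_sum_eq\<close>).
\<close>

definition tens_rep ::
  "('k::field \<Rightarrow> 'a::ab_group_add \<Rightarrow> 'a) \<Rightarrow> ('k \<Rightarrow> 'b::ab_group_add \<Rightarrow> 'b) \<Rightarrow>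
   ('k, 'a, 'b) tensor2 \<Rightarrow> ('a \<times> 'b) list" where
  "tens_rep sA sB t = (SOME ps. t = (\<Sum>(a, b)\<leftarrow>ps. tens sA sB a b))"

text \<open>
  The same for \<open>H\<^sup>\<otimes>\<^sup>m \<otimes> M\<close>, where \<open>m\<close> varies: the first \<open>m\<close> factors form a list.
\<close>

definition multilin ::
  "('k::field \<Rightarrow> 'h::ab_group_add \<Rightarrow> 'h) \<Rightarrow> ('k \<Rightarrow> 'x::ab_group_add \<Rightarrow> 'x) \<Rightarrow>
   ('k \<Rightarrow> 'v::ab_group_add \<Rightarrow> 'v) \<Rightarrow> nat \<Rightarrow> ('h list \<Rightarrow> 'x \<Rightarrow> 'v) \<Rightarrow> bool" where
  "multilin sH sX s m F \<longleftrightarrow>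
     (\<forall>hs x. length hs = m \<longrightarrow>
        Vector_Spaces.linear sX s (F hs) \<and>
        (\<forall>i<m. Vector_Spaces.linear sH s (\<lambda>h. F (hs[i := h]) x)))"

type_synonym ('k, 'h, 'x) tensor = "('h list \<Rightarrow> 'x \<Rightarrow> 'k) \<Rightarrow> 'k"

definition pure_tensor ::
  "('k::field \<Rightarrow> 'h::ab_group_add \<Rightarrow> 'h) \<Rightarrow> ('k \<Rightarrow> 'x::ab_group_add \<Rightarrow> 'x) \<Rightarrow>
   'h list \<Rightarrow> 'x \<Rightarrow> ('k, 'h, 'x) tensor" where
  "pure_tensor sH sX hs x = (\<lambda>\<phi>. if multilin sH sX (*) (length hs) \<phi> then \<phi> hs x else 0)"

definition tensor_space ::
  "('k::field \<Rightarrow> 'h::ab_group_add \<Rightarrow> 'h) \<Rightarrow> ('k \<Rightarrow> 'x::ab_group_add \<Rightarrow> 'x) \<Rightarrow>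
   nat \<Rightarrow> ('k, 'h, 'x) tensor set" where
  "tensor_space sH sX m =
     Modules.module.span fscale {pure_tensor sH sX hs x | hs x. length hs = m}"

definition tensor_rep ::
  "('k::field \<Rightarrow> 'h::ab_group_add \<Rightarrow> 'h) \<Rightarrow> ('k \<Rightarrow> 'x::ab_group_add \<Rightarrow> 'x) \<Rightarrow>
   nat \<Rightarrow> ('k, 'h, 'x) tensor \<Rightarrow> ('h list \<times> 'x) list" where
  "tensor_rep sH sX m t =
     (SOME ps. (\<forall>(hs, x)\<in>set ps. length hs = m) \<and> t = (\<Sum>(hs, x)\<leftarrow>ps. pure_tensor sH sX hs x))"

text \<open>
  The linear map on \<open>H\<^sup>\<otimes>\<^sup>m \<otimes> M\<close> with value \<open>F hs x\<close> on pure tensors.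
\<close>

definition lin_ext ::
  "('k::field \<Rightarrow> 'h::ab_group_add \<Rightarrow> 'h) \<Rightarrow> ('k \<Rightarrow> 'x::ab_group_add \<Rightarrow> 'x) \<Rightarrow>
   nat \<Rightarrow> ('h list \<Rightarrow> 'x \<Rightarrow> 'v::ab_group_add) \<Rightarrow> ('k, 'h, 'x) tensor \<Rightarrow> 'v" where
  "lin_ext sH sX m F t = (\<Sum>(hs, x)\<leftarrow>tensor_rep sH sX m t. F hs x)"


subsection \<open>The universal property\<close>

lemma vector_space_fscale: "vector_space (fscale :: 'k::field \<Rightarrow> ('i \<Rightarrow> 'k) \<Rightarrow> 'i \<Rightarrow> 'k)"
  by unfold_locales (auto simp: fscale_def fun_eq_iff algebra_simps)

lemma vector_space_mult: "vector_space ((*) :: 'k::field \<Rightarrow> 'k \<Rightarrow> 'k)"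
  by unfold_locales (auto simp: algebra_simps)

lemma sum_list_fun_apply:
  fixes f :: "'a \<Rightarrow> 'i \<Rightarrow> 'b::ab_group_add"
  shows "(\<Sum>p\<leftarrow>ps. f p) i = (\<Sum>p\<leftarrow>ps. f p i)"
  by (induction ps) auto

lemma linear_sum_list:
  assumes "Vector_Spaces.linear s1 s2 g"
  shows "g (\<Sum>p\<leftarrow>ps. f p) = (\<Sum>p\<leftarrow>ps. g (f p))"
proof -
  interpret Vector_Spaces.linear s1 s2 g by fact
  show ?thesis by (induction ps) (auto simp: add zero)
qed

lemma linear_compose':
  assumes "Vector_Spaces.linear s1 s2 f" "Vector_Spaces.linear s2 s3 g"
  shows "Vector_Spaces.linear s1 s3 (\<lambda>x. g (f x))"
  using Vector_Spaces.linear_compose[OF assms] by (simp add: o_def)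

lemma separating_form:
  assumes "vector_space s" and "v \<noteq> w"
  obtains g where "Vector_Spaces.linear s ((*) :: 'k::field \<Rightarrow> 'k \<Rightarrow> 'k) g" "g v \<noteq> g w"
proof -
  interpret vs: vector_space s by fact
  interpret vector_space_pair s "(*) :: 'k \<Rightarrow> 'k \<Rightarrow> 'k"
    using assms(1) vector_space_mult by (rule vector_space_pair.intro)
  have "vs.independent {v - w}"
    using assms(2) by simp
  then obtain g where g: "Vector_Spaces.linear s (*) g" "\<forall>x\<in>{v - w}. g x = (1::'k)"
    using linear_independent_extend[of "{v - w}" "\<lambda>_. 1"] by auto
  have "g (v - w) = g v - g w"
    using g(1) by (rule linear_diff)
  with g show ?thesis by (intro that[of g]) auto
qed

lemma tens_sum_eq:
  assumes F: "bilin sA sB s F" and s: "vector_space s"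
    and eq: "(\<Sum>(a, b)\<leftarrow>ps. tens sA sB a b) = (\<Sum>(a, b)\<leftarrow>qs. tens sA sB a b)"
  shows "(\<Sum>(a, b)\<leftarrow>ps. F a b) = (\<Sum>(a, b)\<leftarrow>qs. F a b)"
proof (rule ccontr)
  assume "\<not> ?thesis"
  then obtain g where g: "Vector_Spaces.linear s (*) g"
    and ne: "g (\<Sum>(a, b)\<leftarrow>ps. F a b) \<noteq> g (\<Sum>(a, b)\<leftarrow>qs. F a b)"
    using separating_form[OF s] by metis
  have b: "bilin sA sB (*) (\<lambda>a b. g (F a b))"
    using F g unfolding bilin_def by (auto intro: linear_compose')
  have "(\<Sum>p\<leftarrow>rs. case p of (a, b) \<Rightarrow> tens sA sB a b) (\<lambda>a b. g (F a b))
      = g (\<Sum>(a, b)\<leftarrow>rs. F a b)" for rs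
    using b by (simp add: sum_list_fun_apply linear_sum_list[OF g] case_prod_unfold tens_def)
  with eq ne show False by metis
qed

lemma tensor_sum_eq:
  assumes F: "multilin sH sX s m F" and s: "vector_space s"
    and ps: "\<forall>(hs, x)\<in>set ps. length hs = m" and qs: "\<forall>(hs, x)\<in>set qs. length hs = m"
    and eq: "(\<Sum>(hs, x)\<leftarrow>ps. pure_tensor sH sX hs x) = (\<Sum>(hs, x)\<leftarrow>qs. pure_tensor sH sX hs x)"
  shows "(\<Sum>(hs, x)\<leftarrow>ps. F hs x) = (\<Sum>(hs, x)\<leftarrow>qs. F hs x)"
proof (rule ccontr)
  assume "\<not> ?thesis"
  then obtain g where g: "Vector_Spaces.linear s (*) g"
    and ne: "g (\<Sum>(hs, x)\<leftarrow>ps. F hs x) \<noteq> g (\<Sum>(hs, x)\<leftarrow>qs. F hs x)"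
    using separating_form[OF s] by metis
  have b: "multilin sH sX (*) m (\<lambda>hs x. g (F hs x))"
    using F unfolding multilin_def by (auto intro!: linear_compose'[OF _ g])
  have "(\<Sum>p\<leftarrow>rs. case p of (hs, x) \<Rightarrow> pure_tensor sH sX hs x) (\<lambda>hs x. g (F hs x))
      = g (\<Sum>(hs, x)\<leftarrow>rs. F hs x)" if "\<forall>(hs, x)\<in>set rs. length hs = m" for rs
    unfolding sum_list_fun_apply linear_sum_list[OF g]
    by (rule arg_cong[of _ _ sum_list], rule map_cong[OF refl])
       (use b that in \<open>auto simp: pure_tensor_def\<close>)
  with eq ne ps qs show False by metis
qed

lemma bilin_tens:
  assumes "vector_space sA" "vector_space sB"
  shows "bilin sA sB fscale (tens sA sB)"
  using assms vector_space_fscale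
  by (auto simp: bilin_def Vector_Spaces.linear_iff tens_def fscale_def fun_eq_iff)

lemma multilin_pure_tensor:
  assumes "vector_space sH" "vector_space sX"
  shows "multilin sH sX fscale m (pure_tensor sH sX)"
  using assms vector_space_fscale
  by (auto simp: multilin_def Vector_Spaces.linear_iff pure_tensor_def fscale_def fun_eq_iff)

lemma ex_tens_rep:
  assumes "vector_space sA" "vector_space sB" "t \<in> tens_space sA sB"
  shows "\<exists>ps. t = (\<Sum>(a, b)\<leftarrow>ps. tens sA sB a b)"
proof -
  interpret fs: vector_space "fscale :: 'a \<Rightarrow> (('b \<Rightarrow> 'c \<Rightarrow> 'a) \<Rightarrow> 'a) \<Rightarrow> _"
    by (rule vector_space_fscale)
  have sc: "fscale c (tens sA sB a b) = tens sA sB (sA c a) b" for c a b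
    using bilin_tens[OF assms(1,2)] unfolding bilin_def Vector_Spaces.linear_iff by auto
  show ?thesis using assms(3) unfolding tens_space_def
  proof (induction rule: fs.span_induct_alt)
    case base
    show ?case by (rule exI[of _ "[]"]) simp
  next
    case (step c x y)
    then obtain a b ps where "x = tens sA sB a b" "y = (\<Sum>(a, b)\<leftarrow>ps. tens sA sB a b)"
      by auto
    then show ?case
      by (intro exI[of _ "(sA c a, b) # ps"]) (simp add: sc)
  qed
qed

lemma sum_tens_rep:
  assumes "vector_space sA" "vector_space sB" "t \<in> tens_space sA sB"
  shows "(\<Sum>(a, b)\<leftarrow>tens_rep sA sB t. tens sA sB a b) = t"
  using someI_ex[OF ex_tens_rep[OF assms]] unfolding tens_rep_def by simp

lemma tens_rep_sum_eq:
  assumes "vector_space sA" "vector_space sB" "vector_space s" "bilin sA sB s F"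
  shows "(\<Sum>(a, b)\<leftarrow>tens_rep sA sB (\<Sum>(a, b)\<leftarrow>ps. tens sA sB a b). F a b) = (\<Sum>(a, b)\<leftarrow>ps. F a b)"
  unfolding tens_rep_def
  by (rule someI2[where a = ps]) (auto intro!: tens_sum_eq[OF assms(4,3)])

lemma ex_tensor_rep:
  assumes "vector_space sH" "vector_space sX" "t \<in> tensor_space sH sX m"
  shows "\<exists>ps. (\<forall>(hs, x)\<in>set ps. length hs = m) \<and> t = (\<Sum>(hs, x)\<leftarrow>ps. pure_tensor sH sX hs x)"
proof -
  interpret fs: vector_space "fscale :: 'a \<Rightarrow> (('b list \<Rightarrow> 'c \<Rightarrow> 'a) \<Rightarrow> 'a) \<Rightarrow> _"
    by (rule vector_space_fscale)
  have sc: "fscale c (pure_tensor sH sX hs x) = pure_tensor sH sX hs (sX c x)" for c hs x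
    using multilin_pure_tensor[OF assms(1,2), of "length hs"]
    unfolding multilin_def Vector_Spaces.linear_iff by auto
  show ?thesis using assms(3) unfolding tensor_space_def
  proof (induction rule: fs.span_induct_alt)
    case base
    show ?case by (rule exI[of _ "[]"]) simp
  next
    case (step c x y)
    then obtain hs z ps where "x = pure_tensor sH sX hs z" "length hs = m"
      "\<forall>(hs, x)\<in>set ps. length hs = m" "y = (\<Sum>(hs, x)\<leftarrow>ps. pure_tensor sH sX hs x)"
      by auto
    then show ?case
      by (intro exI[of _ "(hs, sX c z) # ps"]) (simp add: sc)
  qed
qed

lemma tensor_rep:
  assumes "vector_space sH" "vector_space sX" "t \<in> tensor_space sH sX m"
  shows "\<forall>(hs, x)\<in>set (tensor_rep sH sX m t). length hs = m"
    and "(\<Sum>(hs, x)\<leftarrow>tensor_rep sH sX m t. pure_tensor sH sX hs x) = t"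
  using someI_ex[OF ex_tensor_rep[OF assms]] unfolding tensor_rep_def by simp_all

lemma lin_ext_sum:
  assumes "vector_space s" "multilin sH sX s m F" "\<forall>(hs, x)\<in>set ps. length hs = m"
  shows "lin_ext sH sX m F (\<Sum>(hs, x)\<leftarrow>ps. pure_tensor sH sX hs x) = (\<Sum>(hs, x)\<leftarrow>ps. F hs x)"
  unfolding lin_ext_def tensor_rep_def
  by (rule someI2[where a = ps]) (use assms in \<open>auto intro!: tensor_sum_eq[OF assms(2,1)]\<close>)

lemma lin_ext_pure:
  assumes "vector_space s" "multilin sH sX s m F" "length hs = m"
  shows "lin_ext sH sX m F (pure_tensor sH sX hs x) = F hs x"
  using lin_ext_sum[OF assms(1,2), of "[(hs, x)]"] assms(3) by simp

lemma lin_ext_add: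
  assumes "vector_space sH" "vector_space sX" "vector_space s" "multilin sH sX s m F"
    and "t \<in> tensor_space sH sX m" "u \<in> tensor_space sH sX m"
  shows "lin_ext sH sX m F (t + u) = lin_ext sH sX m F t + lin_ext sH sX m F u"
  using lin_ext_sum[OF assms(3,4), of "tensor_rep sH sX m t @ tensor_rep sH sX m u"]
    tensor_rep[OF assms(1,2,5)] tensor_rep[OF assms(1,2,6)]
  by (auto simp: lin_ext_def)

lemma lin_ext_scale:
  assumes "vector_space sH" "vector_space sX" "vector_space s" "multilin sH sX s m F"
    and "t \<in> tensor_space sH sX m"
  shows "lin_ext sH sX m F (fscale c t) = s c (lin_ext sH sX m F t)"
proof -
  let ?ps = "tensor_rep sH sX m t"
  let ?qs = "map (\<lambda>(hs, x). (hs, sX c x)) ?ps"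
  note len = tensor_rep(1)[OF assms(1,2,5)]
  have lin: "Vector_Spaces.linear fscale fscale (fscale c :: _ \<Rightarrow> ('a, 'b, 'c) tensor)"
    "Vector_Spaces.linear s s (s c)"
    using vector_space_fscale assms(3)
    by (auto simp: Vector_Spaces.linear_iff vector_space_def mult.commute)
  have *: "multilin sH sX s' m G \<Longrightarrow> length hs = m \<Longrightarrow> G hs (sX c x) = s' c (G hs x)"
    for s' :: "'a \<Rightarrow> 'v::ab_group_add \<Rightarrow> 'v" and G hs x
    unfolding multilin_def Vector_Spaces.linear_iff by auto
  have **: "multilin sH sX s m G \<Longrightarrow> length hs = m \<Longrightarrow> G hs (sX c x) = s c (G hs x)" for G hs x
    unfolding multilin_def Vector_Spaces.linear_iff by auto
  have "fscale c t = (\<Sum>(hs, x)\<leftarrow>?qs. pure_tensor sH sX hs x)"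
    apply (subst tensor_rep(2)[OF assms(1,2,5), symmetric])
    apply (subst linear_sum_list[OF lin(1)])
    unfolding map_map
    by (rule arg_cong[of _ _ sum_list], rule map_cong[OF refl])
       (use len in \<open>auto simp: *[OF multilin_pure_tensor[OF assms(1,2)]]\<close>)
  moreover have "lin_ext sH sX m F (\<Sum>(hs, x)\<leftarrow>?qs. pure_tensor sH sX hs x) = (\<Sum>(hs, x)\<leftarrow>?qs. F hs x)"
    by (rule lin_ext_sum[OF assms(3,4)]) (use len in auto)
  moreover have "(\<Sum>(hs, x)\<leftarrow>?qs. F hs x) = s c (lin_ext sH sX m F t)"
    unfolding lin_ext_def linear_sum_list[OF lin(2)] map_map
    by (rule arg_cong[of _ _ sum_list], rule map_cong[OF refl])
       (use len in \<open>auto simp: **[OF assms(4)]\<close>)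
  ultimately show ?thesis by simp
qed


section \<open>Hopf algebras and anti-Yetter-Drinfeld modules\<close>

text \<open>
  The underlying ring of the Hopf algebra is the ring structure of the type \<open>'h\<close>; the record
  carries the remaining structure.  The field \<open>k\<close> is the type \<open>'k\<close>.
\<close>

record ('k, 'h) hopf_data =
  hscale :: "'k \<Rightarrow> 'h \<Rightarrow> 'h"
  comult :: "'h \<Rightarrow> ('k, 'h, 'h) tensor2"
  counit :: "'h \<Rightarrow> 'k"
  antipode :: "'h \<Rightarrow> 'h"

abbreviation htens ::
  "('k::field, 'h::ring_1) hopf_data \<Rightarrow> 'h \<Rightarrow> 'h \<Rightarrow> ('k, 'h, 'h) tensor2" where
  "htens H \<equiv> tens (hscale H) (hscale H)"

text \<open>
  Sweedler notation: an expression in \<open>h\<^sub>(\<^sub>1\<^sub>)\<close>, \<open>h\<^sub>(\<^sub>2\<^sub>)\<close> is a sum over \<open>(h1, h2)\<close> in \<open>sw H h\<close>.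
  An expression in \<open>h\<^sub>(\<^sub>1\<^sub>)\<close>, \<dots>, \<open>h\<^sub>(\<^sub>m\<^sub>+\<^sub>1\<^sub>)\<close> is a sum over \<open>s\<close> in \<open>sws H m h\<close>, where \<open>s ! i\<close> is
  \<open>h\<^sub>(\<^sub>i\<^sub>+\<^sub>1\<^sub>)\<close>.
\<close>

definition sw :: "('k::field, 'h::ring_1) hopf_data \<Rightarrow> 'h \<Rightarrow> ('h \<times> 'h) list" where
  "sw H h = tens_rep (hscale H) (hscale H) (comult H h)"

primrec sws :: "('k::field, 'h::ring_1) hopf_data \<Rightarrow> nat \<Rightarrow> 'h \<Rightarrow> 'h list list" where
  "sws H 0 h = [[h]]"
| "sws H (Suc m) h = concat (map (\<lambda>(a, b). map ((#) a) (sws H m b)) (sw H h))"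

definition hopf_algebra :: "('k::field, 'h::ring_1) hopf_data \<Rightarrow> bool" where
  "hopf_algebra H \<longleftrightarrow>
     vector_space (hscale H) \<and>
     bilin (hscale H) (hscale H) (hscale H) (*) \<and>
     Vector_Spaces.linear (hscale H) fscale (comult H) \<and>
     (\<forall>h. comult H h \<in> tens_space (hscale H) (hscale H)) \<and>
     Vector_Spaces.linear (hscale H) (*) (counit H) \<and>
     Vector_Spaces.linear (hscale H) (hscale H) (antipode H) \<and>
     (\<forall>h. (\<Sum>(a, b)\<leftarrow>sw H h. \<Sum>(a1, a2)\<leftarrow>sw H a. tens (hscale H) fscale a1 (htens H a2 b)) =
          (\<Sum>(a, b)\<leftarrow>sw H h. \<Sum>(b1, b2)\<leftarrow>sw H b. tens (hscale H) fscale a (htens H b1 b2))) \<and>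
     (\<forall>h. (\<Sum>(a, b)\<leftarrow>sw H h. hscale H (counit H a) b) = h) \<and>
     (\<forall>h. (\<Sum>(a, b)\<leftarrow>sw H h. hscale H (counit H b) a) = h) \<and>
     (\<forall>g h. comult H (g * h) = (\<Sum>(a, b)\<leftarrow>sw H g. \<Sum>(c, d)\<leftarrow>sw H h. htens H (a * c) (b * d))) \<and>
     comult H 1 = htens H 1 1 \<and>
     (\<forall>g h. counit H (g * h) = counit H g * counit H h) \<and>
     counit H 1 = 1 \<and>
     (\<forall>h. (\<Sum>(a, b)\<leftarrow>sw H h. antipode H a * b) = hscale H (counit H h) 1) \<and>
     (\<forall>h. (\<Sum>(a, b)\<leftarrow>sw H h. a * antipode H b) = hscale H (counit H h) 1)"

text \<open>
  The infix notation for group inverses from \<open>HOL-Algebra\<close> clashes with \<open>inv\<close> on functions, so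
  inverse functions are written with \<open>inv_into\<close>.
\<close>

abbreviation antipode_inv :: "('k::field, 'h::ring_1) hopf_data \<Rightarrow> 'h \<Rightarrow> 'h" where
  "antipode_inv H \<equiv> inv_into UNIV (antipode H)"

record ('k, 'h, 'x) hmod_data =
  xscale :: "'k \<Rightarrow> 'x \<Rightarrow> 'x"
  act :: "'h \<Rightarrow> 'x \<Rightarrow> 'x"
  coact :: "'x \<Rightarrow> ('k, 'h, 'x) tensor2"

definition left_hmodule ::
  "('k::field, 'h::ring_1) hopf_data \<Rightarrow> ('k, 'h, 'x::ab_group_add) hmod_data \<Rightarrow> bool" where
  "left_hmodule H M \<longleftrightarrow>
     bilin (hscale H) (xscale M) (xscale M) (act M) \<and>
     (\<forall>g h x. act M (g * h) x = act M g (act M h x)) \<and>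
     (\<forall>x. act M 1 x = x)"

text \<open>An expression in \<open>x\<^sub>(\<^sub>-\<^sub>1\<^sub>)\<close>, \<open>x\<^sub>(\<^sub>0\<^sub>)\<close> is a sum over \<open>(y, x0)\<close> in \<open>csw H M x\<close>.\<close>

definition csw ::
  "('k::field, 'h::ring_1) hopf_data \<Rightarrow> ('k, 'h, 'x::ab_group_add) hmod_data \<Rightarrow> 'x \<Rightarrow> ('h \<times> 'x) list" where
  "csw H M x = tens_rep (hscale H) (xscale M) (coact M x)"

abbreviation xtens ::
  "('k::field, 'h::ring_1) hopf_data \<Rightarrow> ('k, 'h, 'x::ab_group_add) hmod_data \<Rightarrow>
   'h \<Rightarrow> 'x \<Rightarrow> ('k, 'h, 'x) tensor2" where
  "xtens H M \<equiv> tens (hscale H) (xscale M)"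

definition left_hcomodule ::
  "('k::field, 'h::ring_1) hopf_data \<Rightarrow> ('k, 'h, 'x::ab_group_add) hmod_data \<Rightarrow> bool" where
  "left_hcomodule H M \<longleftrightarrow>
     Vector_Spaces.linear (xscale M) fscale (coact M) \<and>
     (\<forall>x. coact M x \<in> tens_space (hscale H) (xscale M)) \<and>
     (\<forall>x. (\<Sum>(y, x0)\<leftarrow>csw H M x. \<Sum>(a, b)\<leftarrow>sw H y. tens (hscale H) fscale a (xtens H M b x0)) =
          (\<Sum>(y, x0)\<leftarrow>csw H M x. \<Sum>(z, x1)\<leftarrow>csw H M x0. tens (hscale H) fscale y (xtens H M z x1))) \<and>
     (\<forall>x. (\<Sum>(y, x0)\<leftarrow>csw H M x. xscale M (counit H y) x0) = x)"

definition anti_yetter_drinfeld ::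
  "('k::field, 'h::ring_1) hopf_data \<Rightarrow> ('k, 'h, 'x::ab_group_add) hmod_data \<Rightarrow> bool" where
  "anti_yetter_drinfeld H M \<longleftrightarrow>
     left_hmodule H M \<and> left_hcomodule H M \<and>
     (\<forall>h x. coact M (act M h x) =
        (\<Sum>s\<leftarrow>sws H 2 h. \<Sum>(y, x0)\<leftarrow>csw H M x.
           xtens H M (s ! 0 * y * antipode_inv H (s ! 2)) (act M (s ! 1) x0)))"

definition stable_hmodule ::
  "('k::field, 'h::ring_1) hopf_data \<Rightarrow> ('k, 'h, 'x::ab_group_add) hmod_data \<Rightarrow> bool" where
  "stable_hmodule H M \<longleftrightarrow>
     (\<forall>x. (\<Sum>(y, x0)\<leftarrow>csw H M x. act M y x0) = x) \<and>
     (\<forall>x. (\<Sum>(y, x0)\<leftarrow>csw H M x. act M (antipode H y) x0) = x)"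


section \<open>Cyclic modules\<close>

definition mod_hom :: "('k, 'm) ring_scheme \<Rightarrow> ('k, 'v, 'p) module_scheme \<Rightarrow>
    ('k, 'w, 'q) module_scheme \<Rightarrow> ('v \<Rightarrow> 'w) set" where
  "mod_hom R M N =
     {f \<in> carrier M \<rightarrow> carrier N.
        (\<forall>u\<in>carrier M. \<forall>v\<in>carrier M. f (u \<oplus>\<^bsub>M\<^esub> v) = f u \<oplus>\<^bsub>N\<^esub> f v) \<and>
        (\<forall>c\<in>carrier R. \<forall>v\<in>carrier M. f (c \<odot>\<^bsub>M\<^esub> v) = c \<odot>\<^bsub>N\<^esub> f v)}"

text \<open>
  \<open>face Z n j : Z\<^sub>n \<rightarrow> Z\<^sub>n\<^sub>-\<^sub>1\<close> is used for \<open>1 \<le> n\<close>, \<open>j \<le> n\<close> and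
  \<open>degen Z n j : Z\<^sub>n \<rightarrow> Z\<^sub>n\<^sub>+\<^sub>1\<close> for \<open>j \<le> n\<close>.
\<close>

record ('k, 'v) cyclic_data =
  obj :: "nat \<Rightarrow> ('k, 'v) module"
  face :: "nat \<Rightarrow> nat \<Rightarrow> 'v \<Rightarrow> 'v"
  degen :: "nat \<Rightarrow> nat \<Rightarrow> 'v \<Rightarrow> 'v"
  tau :: "nat \<Rightarrow> 'v \<Rightarrow> 'v"

definition simplicial_module :: "'k ring \<Rightarrow> ('k, 'v) cyclic_data \<Rightarrow> bool" where
  "simplicial_module R Z \<longleftrightarrow>
     (\<forall>n. Module.module R (obj Z n)) \<and>
     (\<forall>n j. 1 \<le> n \<and> j \<le> n \<longrightarrow> face Z n j \<in> mod_hom R (obj Z n) (obj Z (n - 1))) \<and>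
     (\<forall>n j. j \<le> n \<longrightarrow> degen Z n j \<in> mod_hom R (obj Z n) (obj Z (n + 1))) \<and>
     (\<forall>n i j. \<forall>v\<in>carrier (obj Z n). 2 \<le> n \<and> i < j \<and> j \<le> n \<longrightarrow>
        face Z (n - 1) i (face Z n j v) = face Z (n - 1) (j - 1) (face Z n i v)) \<and>
     (\<forall>n i j. \<forall>v\<in>carrier (obj Z n). i \<le> j \<and> j \<le> n \<longrightarrow>
        degen Z (n + 1) i (degen Z n j v) = degen Z (n + 1) (j + 1) (degen Z n i v)) \<and>
     (\<forall>n i j. \<forall>v\<in>carrier (obj Z n). i < j \<and> j \<le> n \<longrightarrow>
        face Z (n + 1) i (degen Z n j v) = degen Z (n - 1) (j - 1) (face Z n i v)) \<and>
     (\<forall>n j. \<forall>v\<in>carrier (obj Z n). j \<le> n \<longrightarrow>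
        face Z (n + 1) j (degen Z n j v) = v \<and> face Z (n + 1) (j + 1) (degen Z n j v) = v) \<and>
     (\<forall>n i j. \<forall>v\<in>carrier (obj Z n). j + 1 < i \<and> i \<le> n + 1 \<longrightarrow>
        face Z (n + 1) i (degen Z n j v) = degen Z (n - 1) j (face Z n (i - 1) v))"

definition para_cyclic_module :: "'k ring \<Rightarrow> ('k, 'v) cyclic_data \<Rightarrow> bool" where
  "para_cyclic_module R Z \<longleftrightarrow>
     simplicial_module R Z \<and>
     (\<forall>n. tau Z n \<in> mod_hom R (obj Z n) (obj Z n) \<and>
          bij_betw (tau Z n) (carrier (obj Z n)) (carrier (obj Z n))) \<and>
     (\<forall>n j. \<forall>v\<in>carrier (obj Z n). 1 \<le> j \<and> j \<le> n \<longrightarrow>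
        face Z n j (tau Z n v) = tau Z (n - 1) (face Z n (j - 1) v)) \<and>
     (\<forall>n j. \<forall>v\<in>carrier (obj Z n). 1 \<le> j \<and> j \<le> n \<longrightarrow>
        degen Z n j (tau Z n v) = tau Z (n + 1) (degen Z n (j - 1) v)) \<and>
     (\<forall>n. \<forall>v\<in>carrier (obj Z n). 1 \<le> n \<longrightarrow> face Z n 0 (tau Z n v) = face Z n n v) \<and>
     (\<forall>n. \<forall>v\<in>carrier (obj Z n).
        degen Z n 0 (tau Z n v) = tau Z (n + 1) (tau Z (n + 1) (degen Z n n v)))"

definition cyclic_module :: "'k ring \<Rightarrow> ('k, 'v) cyclic_data \<Rightarrow> bool" where
  "cyclic_module R Z \<longleftrightarrow>
     para_cyclic_module R Z \<and>
     (\<forall>n. \<forall>v\<in>carrier (obj Z n). (tau Z n ^^ (n + 1)) v = v)"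

definition cyclic_module_iso ::
  "'k ring \<Rightarrow> ('k, 'v) cyclic_data \<Rightarrow> ('k, 'w) cyclic_data \<Rightarrow> (nat \<Rightarrow> 'v \<Rightarrow> 'w) \<Rightarrow> bool" where
  "cyclic_module_iso R Z Z' f \<longleftrightarrow>
     cyclic_module R Z \<and> cyclic_module R Z' \<and>
     (\<forall>n. f n \<in> mod_hom R (obj Z n) (obj Z' n) \<and>
          bij_betw (f n) (carrier (obj Z n)) (carrier (obj Z' n))) \<and>
     (\<forall>n j. \<forall>v\<in>carrier (obj Z n). 1 \<le> n \<and> j \<le> n \<longrightarrow>
        f (n - 1) (face Z n j v) = face Z' n j (f n v)) \<and>
     (\<forall>n j. \<forall>v\<in>carrier (obj Z n). j \<le> n \<longrightarrow>
        f (n + 1) (degen Z n j v) = degen Z' n j (f n v)) \<and>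
     (\<forall>n. \<forall>v\<in>carrier (obj Z n). f n (tau Z n v) = tau Z' n (f n v))"

text \<open>
  \<open>coface A n j : A\<^sub>n \<rightarrow> A\<^sub>n\<^sub>+\<^sub>1\<close> is used for \<open>j \<le> n + 1\<close> and \<open>codegen A n j : A\<^sub>n \<rightarrow> A\<^sub>n\<^sub>-\<^sub>1\<close> for
  \<open>j \<le> n - 1\<close>, \<open>1 \<le> n\<close>.
\<close>

record ('k, 'v) cocyclic_data =
  cobj :: "nat \<Rightarrow> ('k, 'v) module"
  coface :: "nat \<Rightarrow> nat \<Rightarrow> 'v \<Rightarrow> 'v"
  codegen :: "nat \<Rightarrow> nat \<Rightarrow> 'v \<Rightarrow> 'v"
  cotau :: "nat \<Rightarrow> 'v \<Rightarrow> 'v"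

definition cyclic_dual :: "('k, 'v) cocyclic_data \<Rightarrow> ('k, 'v) cyclic_data" where
  "cyclic_dual A =
     \<lparr>obj = cobj A,
      face = (\<lambda>n j v. if j = 0 then codegen A n (n - 1) (cotau A n v) else codegen A n (j - 1) v),
      degen = coface A,
      tau = (\<lambda>n. inv_into (carrier (cobj A n)) (cotau A n))\<rparr>"

text \<open>Modules in \<open>HOL-Algebra\<close> extend rings; the ring multiplication and unit are not used.\<close>

definition subspace_module :: "('i \<Rightarrow> 'k::field) set \<Rightarrow> ('k, 'i \<Rightarrow> 'k) module" where
  "subspace_module V =
     \<lparr>carrier = V, monoid.mult = undefined, one = undefined, ring.zero = 0, add = (+),
      module.smult = fscale\<rparr>"

text \<open>
  The set \<open>W + c A\<close> is the product of the coset \<open>A\<close> with the scalar \<open>c\<close> (also for \<open>c = 0\<close>, where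
  \<open>c A\<close> alone is not a coset).
\<close>

definition quot_module :: "('k, 'v) module \<Rightarrow> 'v set \<Rightarrow> ('k, 'v set) module" where
  "quot_module M W =
     \<lparr>carrier = a_rcosets\<^bsub>M\<^esub> W, monoid.mult = undefined, one = undefined, ring.zero = W,
      add = set_add M, module.smult = (\<lambda>c A. W <+>\<^bsub>M\<^esub> (\<lambda>v. c \<odot>\<^bsub>M\<^esub> v) ` A)\<rparr>"

text \<open>If \<open>f\<close> descends to the quotients then \<open>W' + f(A)\<close> is the coset of \<open>f v\<close> for each \<open>v\<close> in \<open>A\<close>.\<close>

definition quot_map :: "('k, 'v) module \<Rightarrow> 'v set \<Rightarrow> ('v \<Rightarrow> 'v) \<Rightarrow> 'v set \<Rightarrow> 'v set" where
  "quot_map N W' f A = W' <+>\<^bsub>N\<^esub> f ` A"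

definition quot_cyclic ::
  "('k, 'v) cyclic_data \<Rightarrow> (nat \<Rightarrow> 'v set) \<Rightarrow> ('k, 'v set) cyclic_data" where
  "quot_cyclic Z W =
     \<lparr>obj = (\<lambda>n. quot_module (obj Z n) (W n)),
      face = (\<lambda>n j. quot_map (obj Z (n - 1)) (W (n - 1)) (face Z n j)),
      degen = (\<lambda>n j. quot_map (obj Z (n + 1)) (W (n + 1)) (degen Z n j)),
      tau = (\<lambda>n. quot_map (obj Z n) (W n) (tau Z n))\<rparr>"


section \<open>The para-(co)cyclic modules of a Hopf algebra\<close>

definition T_space ::
  "('k::field, 'h::ring_1) hopf_data \<Rightarrow> ('k, 'h, 'x::ab_group_add) hmod_data \<Rightarrow> nat \<Rightarrow>
   ('k, 'h, 'x) tensor set" where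
  "T_space H M n = tensor_space (hscale H) (xscale M) (n + 1)"

abbreviation ptens ::
  "('k::field, 'h::ring_1) hopf_data \<Rightarrow> ('k, 'h, 'x::ab_group_add) hmod_data \<Rightarrow>
   'h list \<Rightarrow> 'x \<Rightarrow> ('k, 'h, 'x) tensor" where
  "ptens H M \<equiv> pure_tensor (hscale H) (xscale M)"

abbreviation T_ext ::
  "('k::field, 'h::ring_1) hopf_data \<Rightarrow> ('k, 'h, 'x::ab_group_add) hmod_data \<Rightarrow> nat \<Rightarrow>
   ('h list \<Rightarrow> 'x \<Rightarrow> 'v::ab_group_add) \<Rightarrow> ('k, 'h, 'x) tensor \<Rightarrow> 'v" where
  "T_ext H M n \<equiv> lin_ext (hscale H) (xscale M) (n + 1)"


subsection \<open>The algebra side\<close>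

definition face_a ::
  "('k::field, 'h::ring_1) hopf_data \<Rightarrow> ('k, 'h, 'x::ab_group_add) hmod_data \<Rightarrow> nat \<Rightarrow> nat \<Rightarrow>
   ('k, 'h, 'x) tensor \<Rightarrow> ('k, 'h, 'x) tensor" where
  "face_a H M n j = T_ext H M n (\<lambda>hs x.
     if j < n then ptens H M (take j hs @ [hs ! j * hs ! (j + 1)] @ drop (j + 2) hs) x
     else (\<Sum>(a, b)\<leftarrow>sw H (last hs). ptens H M ((a * hd hs) # tl (butlast hs)) (act M b x)))"

definition tau_a ::
  "('k::field, 'h::ring_1) hopf_data \<Rightarrow> ('k, 'h, 'x::ab_group_add) hmod_data \<Rightarrow> nat \<Rightarrow>
   ('k, 'h, 'x) tensor \<Rightarrow> ('k, 'h, 'x) tensor" where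
  "tau_a H M n = T_ext H M n (\<lambda>hs x.
     \<Sum>(a, b)\<leftarrow>sw H (last hs). ptens H M (a # butlast hs) (act M b x))"

definition degen0_a ::
  "('k::field, 'h::ring_1) hopf_data \<Rightarrow> ('k, 'h, 'x::ab_group_add) hmod_data \<Rightarrow> nat \<Rightarrow>
   ('k, 'h, 'x) tensor \<Rightarrow> ('k, 'h, 'x) tensor" where
  "degen0_a H M n = T_ext H M n (\<lambda>hs x. ptens H M (hd hs # 1 # tl hs) x)"

definition degen_a ::
  "('k::field, 'h::ring_1) hopf_data \<Rightarrow> ('k, 'h, 'x::ab_group_add) hmod_data \<Rightarrow> nat \<Rightarrow> nat \<Rightarrow>
   ('k, 'h, 'x) tensor \<Rightarrow> ('k, 'h, 'x) tensor" where
  "degen_a H M n j v =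
     (tau_a H M (n + 1) ^^ j) (degen0_a H M n ((inv_into (T_space H M n) (tau_a H M n) ^^ j) v))"

text \<open>The right coaction, with values in \<open>T\<^sub>n \<otimes> H\<close>.\<close>

definition rho ::
  "('k::field, 'h::ring_1) hopf_data \<Rightarrow> ('k, 'h, 'x::ab_group_add) hmod_data \<Rightarrow> nat \<Rightarrow>
   ('k, 'h, 'x) tensor \<Rightarrow> ('k, ('k, 'h, 'x) tensor, 'h) tensor2" where
  "rho H M n = T_ext H M n (\<lambda>hs x.
     \<Sum>ps\<leftarrow>product_lists (map (sw H) hs). \<Sum>(y, x0)\<leftarrow>csw H M x.
       tens fscale (hscale H) (ptens H M (map fst ps) x0)
         (prod_list (map snd ps) * antipode H y))"

definition coinvariants ::
  "('k::field, 'h::ring_1) hopf_data \<Rightarrow> ('k, 'h, 'x::ab_group_add) hmod_data \<Rightarrow> nat \<Rightarrow>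
   ('k, 'h, 'x) tensor set" where
  "coinvariants H M n = {v \<in> T_space H M n. rho H M n v = tens fscale (hscale H) v 1}"

definition Ta ::
  "('k::field, 'h::ring_1) hopf_data \<Rightarrow> ('k, 'h, 'x::ab_group_add) hmod_data \<Rightarrow>
   ('k, ('k, 'h, 'x) tensor) cyclic_data" where
  "Ta H M =
     \<lparr>obj = (\<lambda>n. subspace_module (T_space H M n)), face = face_a H M, degen = degen_a H M,
      tau = tau_a H M\<rparr>"

definition CMa ::
  "('k::field, 'h::ring_1) hopf_data \<Rightarrow> ('k, 'h, 'x::ab_group_add) hmod_data \<Rightarrow>
   ('k, ('k, 'h, 'x) tensor) cyclic_data" where
  "CMa H M = Ta H M \<lparr>obj := (\<lambda>n. subspace_module (coinvariants H M n))\<rparr>"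


subsection \<open>The coalgebra side\<close>

definition tau_c ::
  "('k::field, 'h::ring_1) hopf_data \<Rightarrow> ('k, 'h, 'x::ab_group_add) hmod_data \<Rightarrow> nat \<Rightarrow>
   ('k, 'h, 'x) tensor \<Rightarrow> ('k, 'h, 'x) tensor" where
  "tau_c H M n = T_ext H M n (\<lambda>hs x.
     \<Sum>(y, x0)\<leftarrow>csw H M x. ptens H M (tl hs @ [y * hd hs]) x0)"

definition coface0 ::
  "('k::field, 'h::ring_1) hopf_data \<Rightarrow> ('k, 'h, 'x::ab_group_add) hmod_data \<Rightarrow> nat \<Rightarrow>
   ('k, 'h, 'x) tensor \<Rightarrow> ('k, 'h, 'x) tensor" where
  "coface0 H M n = T_ext H M n (\<lambda>hs x.
     \<Sum>(a, b)\<leftarrow>sw H (hd hs). ptens H M (a # b # tl hs) x)"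

definition coface_c ::
  "('k::field, 'h::ring_1) hopf_data \<Rightarrow> ('k, 'h, 'x::ab_group_add) hmod_data \<Rightarrow> nat \<Rightarrow> nat \<Rightarrow>
   ('k, 'h, 'x) tensor \<Rightarrow> ('k, 'h, 'x) tensor" where
  "coface_c H M n j v =
     (inv_into (T_space H M (n + 1)) (tau_c H M (n + 1)) ^^ j) (coface0 H M n ((tau_c H M n ^^ j) v))"

definition codegen0 ::
  "('k::field, 'h::ring_1) hopf_data \<Rightarrow> ('k, 'h, 'x::ab_group_add) hmod_data \<Rightarrow> nat \<Rightarrow>
   ('k, 'h, 'x) tensor \<Rightarrow> ('k, 'h, 'x) tensor" where
  "codegen0 H M n = T_ext H M n (\<lambda>hs x.
     fscale (counit H (hs ! 1)) (ptens H M (hd hs # drop 2 hs) x))"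

definition codegen_c ::
  "('k::field, 'h::ring_1) hopf_data \<Rightarrow> ('k, 'h, 'x::ab_group_add) hmod_data \<Rightarrow> nat \<Rightarrow> nat \<Rightarrow>
   ('k, 'h, 'x) tensor \<Rightarrow> ('k, 'h, 'x) tensor" where
  "codegen_c H M n j v =
     (inv_into (T_space H M (n - 1)) (tau_c H M (n - 1)) ^^ j) (codegen0 H M n ((tau_c H M n ^^ j) v))"

definition Tc ::
  "('k::field, 'h::ring_1) hopf_data \<Rightarrow> ('k, 'h, 'x::ab_group_add) hmod_data \<Rightarrow>
   ('k, ('k, 'h, 'x) tensor) cocyclic_data" where
  "Tc H M =
     \<lparr>cobj = (\<lambda>n. subspace_module (T_space H M n)), coface = coface_c H M, codegen = codegen_c H M,
      cotau = tau_c H M\<rparr>"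

definition diag_act ::
  "('k::field, 'h::ring_1) hopf_data \<Rightarrow> ('k, 'h, 'x::ab_group_add) hmod_data \<Rightarrow> nat \<Rightarrow> 'h \<Rightarrow>
   ('k, 'h, 'x) tensor \<Rightarrow> ('k, 'h, 'x) tensor" where
  "diag_act H M n h = T_ext H M n (\<lambda>hs x.
     \<Sum>s\<leftarrow>sws H (n + 1) h.
       ptens H M (map (\<lambda>i. s ! i * hs ! i) [0..<n + 1]) (act M (s ! (n + 1)) x))"

definition coinvariant_relations ::
  "('k::field, 'h::ring_1) hopf_data \<Rightarrow> ('k, 'h, 'x::ab_group_add) hmod_data \<Rightarrow> nat \<Rightarrow>
   ('k, 'h, 'x) tensor set" where
  "coinvariant_relations H M n =
     Modules.module.span fscale
       {diag_act H M n h v - fscale (counit H h) v | h v. v \<in> T_space H M n}"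

definition CMc_dual ::
  "('k::field, 'h::ring_1) hopf_data \<Rightarrow> ('k, 'h, 'x::ab_group_add) hmod_data \<Rightarrow>
   ('k, ('k, 'h, 'x) tensor set) cyclic_data" where
  "CMc_dual H M = quot_cyclic (cyclic_dual (Tc H M)) (coinvariant_relations H M)"

definition quot_proj ::
  "('k::field, 'h::ring_1) hopf_data \<Rightarrow> ('k, 'h, 'x::ab_group_add) hmod_data \<Rightarrow> nat \<Rightarrow>
   ('k, 'h, 'x) tensor \<Rightarrow> ('k, 'h, 'x) tensor set" where
  "quot_proj H M n v = coinvariant_relations H M n +>\<^bsub>cobj (Tc H M) n\<^esub> v"


subsection \<open>The comparison map\<close>

text \<open>
  With \<open>ss ! j ! i\<close> standing for \<open>h\<^sup>j\<^sub>(\<^sub>i\<^sub>+\<^sub>1\<^sub>)\<close>, factor \<open>i \<le> n\<close> is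
  \<open>h\<^sup>0\<^sub>(\<^sub>i\<^sub>+\<^sub>1\<^sub>) h\<^sup>1\<^sub>(\<^sub>i\<^sub>) \<dots> h\<^sup>i\<^sub>(\<^sub>1\<^sub>)\<close>, and \<open>h\<^sup>0\<^sub>(\<^sub>n\<^sub>+\<^sub>2\<^sub>) h\<^sup>1\<^sub>(\<^sub>n\<^sub>+\<^sub>1\<^sub>) \<dots> h\<^sup>n\<^sub>(\<^sub>2\<^sub>)\<close> acts on \<open>x\<close>;
  so \<open>h\<^sup>j\<close> is split into \<open>n + 2 - j\<close> components.
\<close>

definition alpha ::
  "('k::field, 'h::ring_1) hopf_data \<Rightarrow> ('k, 'h, 'x::ab_group_add) hmod_data \<Rightarrow> nat \<Rightarrow>
   ('k, 'h, 'x) tensor \<Rightarrow> ('k, 'h, 'x) tensor" where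
  "alpha H M n = T_ext H M n (\<lambda>hs x.
     \<Sum>ss\<leftarrow>product_lists (map (\<lambda>j. sws H (n + 1 - j) (hs ! j)) [0..<n + 1]).
       ptens H M
         (map (\<lambda>i. prod_list (map (\<lambda>j. ss ! j ! (i - j)) [0..<i + 1])) [0..<n + 1])
         (act M (prod_list (map (\<lambda>j. ss ! j ! (n + 1 - j)) [0..<n + 1])) x))"

end

theory Submission
  imports Defs
begin

text \<open>
  Counitality on the first factor maps the coinvariants of \<open>T\<^sup>a\<^sub>n\<close> bijectively to \<open>H\<^sup>\<otimes>\<^sup>n \<otimes> X\<close>; the inverse is
  \<open>w \<mapsto> S\<^sup>-\<^sup>1(w\<^sub>(\<^sub>1\<^sub>)) \<otimes> w\<^sub>(\<^sub>0\<^sub>)\<close> for the right coaction \<open>w \<mapsto> w\<^sub>(\<^sub>0\<^sub>) \<otimes> w\<^sub>(\<^sub>1\<^sub>)\<close>.  The quotient of \<open>T\<^sup>c\<^sub>n\<close> by the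
  relations is identified with \<open>H\<^sup>\<otimes>\<^sup>n \<otimes> X\<close> by \<open>g \<otimes> u \<mapsto> S(g) u\<close>, with inverse \<open>u \<mapsto> 1 \<otimes> u\<close>.  Since
  \<open>\<alpha>(g \<otimes> w) = g\<^sub>(\<^sub>1\<^sub>) \<otimes> g\<^sub>(\<^sub>2\<^sub>) \<alpha>(w)\<close>, these identifications turn \<open>q \<alpha>\<close> into \<open>\<alpha>\<close> on \<open>H\<^sup>\<otimes>\<^sup>n \<otimes> X\<close>, which has
  an explicit inverse; so \<open>q \<alpha>\<close> is bijective.

  The anti-Yetter-Drinfeld condition gives \<open>\<tau>\<^sub>c \<alpha> \<tau>\<^sub>a v \<equiv> \<alpha> v\<close> modulo the relations for coinvariant \<open>v\<close>, and
  stability gives \<open>\<tau>\<^sub>a\<^sup>n\<^sup>+\<^sup>1 = 1\<close> on coinvariants.  On both sides faces and degeneracies are conjugates under \<open>\<tau>\<close>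
  of those of index \<open>0\<close>, for which compatibility with \<open>\<alpha>\<close> is a short computation.  The cyclic structure of
  the target is transported along the bijection.

  A tensor is determined by its values on multilinear forms, so every identity between maps of tensors
  is checked as an identity between the pulled back forms.
\<close>

section \<open>Formal sums and linear maps\<close>

text \<open>The order of the argument is forced by the inverse of \<open>tc\<close>. This inverse is
  the cyclic operator of the dual and enters every coface and codegeneracy of positive index, but
  only \<open>tc\<close> itself is seen to preserve the relations by direct computation. So the
  linear bijectivity of q \<alpha> comes first, and stability of the relations under the inverse is
  deduced from it. On the source side the same question is settled by the order of \<tau>: on
  coinvariants the inverse of \<open>ta\<close> is a power of \<open>ta\<close>. The codegeneracy of
  index 0 applies the counit to the second factor, whereas the counit that fits the face of index 0
  acts on the first. The two are conjugate under \<open>tc\<close>, and this accounts for the index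
  shift between codegeneracies and faces of the dual. The relations are the common kernel of the
  H-invariant forms, so congruences modulo the relations are checked on forms as well.\<close>

definition sm :: "('a \<times> 'b) list \<Rightarrow> ('a \<Rightarrow> 'b \<Rightarrow> 'v::comm_monoid_add) \<Rightarrow> 'v" where
  "sm L f = (\<Sum>(a, b)\<leftarrow>L. f a b)"

lemma sm_Nil [simp]: "sm [] f = 0"
  and sm_Cons [simp]: "sm (p # L) f = f (fst p) (snd p) + sm L f"
  by (simp_all add: sm_def case_prod_unfold)

lemma sm_append [simp]: "sm (L @ K) f = sm L f + sm K f"
  by (induction L) (simp_all add: add.assoc)

lemma sm_concat [simp]: "sm (concat (map (\<lambda>(a, b). E a b) L)) f = sm L (\<lambda>a b. sm (E a b) f)"
  by (induction L) (auto simp: case_prod_unfold)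

lemma sm_map [simp]: "sm (map (\<lambda>(a, b). (p a b, q a b)) L) f = sm L (\<lambda>a b. f (p a b) (q a b))"
  by (induction L) (auto simp: case_prod_unfold)

lemma sm_map_Pair [simp]: "sm (map (Pair c) L) f = sm L (\<lambda>a b. f c (a, b))"
  by (induction L) auto

lemma sm_add: "sm L (\<lambda>a b. f a b + g a b) = sm L f + sm L g"
  by (induction L) (auto simp: ac_simps)

lemma sm_0 [simp]: "sm L (\<lambda>a b. 0) = 0"
  by (induction L) auto

text \<open>Sweedler sums, coaction sums and the formal sums of lists below are all instances of
  \<open>sm\<close>, so this one exchange rule reorders any two independent nested sums.\<close>

lemma sm_swap: "sm L (\<lambda>a b. sm K (f a b)) = sm K (\<lambda>c d. sm L (\<lambda>a b. f a b c d))"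
  by (induction L) (auto simp: sm_add)

lemma sm_scale:
  fixes c :: "'k::field"
  shows "sm L (\<lambda>a b. c * f a b) = c * sm L f" "sm L (\<lambda>a b. f a b * c) = sm L f * c"
  by (induction L) (auto simp: algebra_simps)

lemma sm_cong: "(\<And>a b. (a, b) \<in> set L \<Longrightarrow> f a b = g a b) \<Longrightarrow> sm L f = sm L g"
  unfolding sm_def by (intro arg_cong[of _ _ sum_list] map_cong) auto

lemma sm_apply: "(sm L f) i = sm L (\<lambda>a b. f a b i)"
  by (induction L) auto

text \<open>Linearity as two equations, without the vector space axioms that
  \<open>Vector_Spaces.linear\<close> carries; the closure rules then have no side conditions on the
  scalings and can be chained by \<open>intro\<close>.\<close>

definition lin :: "('k \<Rightarrow> 'a \<Rightarrow> 'a::ab_group_add) \<Rightarrow> ('k \<Rightarrow> 'b \<Rightarrow> 'b::ab_group_add) \<Rightarrow> ('a \<Rightarrow> 'b) \<Rightarrow> bool" where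
  "lin s s' f \<longleftrightarrow> (\<forall>a b. f (a + b) = f a + f b) \<and> (\<forall>c a. f (s c a) = s' c (f a))"

lemma lin_add: "lin s s' f \<Longrightarrow> f (a + b) = f a + f b"
  and lin_scale: "lin s s' f \<Longrightarrow> f (s c a) = s' c (f a)"
  by (simp_all add: lin_def)

lemma lin_0: "lin s s' f \<Longrightarrow> f 0 = 0"
  using lin_add[of s s' f 0 0] by simp

lemma lin_linear: "vector_space s \<Longrightarrow> vector_space s' \<Longrightarrow> Vector_Spaces.linear s s' f \<longleftrightarrow> lin s s' f"
  by (auto simp: Vector_Spaces.linear_iff lin_def)

lemma linear_lin: "Vector_Spaces.linear s s' f \<Longrightarrow> lin s s' f"
  by (auto simp: Vector_Spaces.linear_iff lin_def)

lemma lin_sm_arg: "lin s s' f \<Longrightarrow> f (sm L g) = sm L (\<lambda>a b. f (g a b))"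
  by (induction L) (auto simp: lin_add lin_0)

lemma lin_ident: "lin s s (\<lambda>a. a)"
  by (simp add: lin_def)

lemma lin_sm: "(\<And>p q. lin s ((*) :: 'k::field \<Rightarrow> _) (\<lambda>a. f a p q)) \<Longrightarrow> lin s (*) (\<lambda>a. sm L (f a))"
  unfolding lin_def by (auto simp: sm_add[symmetric] sm_scale[symmetric] intro!: sm_cong)

lemma lin_kmult:
  "lin s ((*) :: 'k::field \<Rightarrow> _) g \<Longrightarrow> lin s (*) (\<lambda>a. c * g a)"
  "lin s ((*) :: 'k::field \<Rightarrow> _) g \<Longrightarrow> lin s (*) (\<lambda>a. g a * c)"
  by (simp_all add: lin_def algebra_simps)

definition bil :: "('k::field \<Rightarrow> 'a \<Rightarrow> 'a::ab_group_add) \<Rightarrow> ('k \<Rightarrow> 'b \<Rightarrow> 'b::ab_group_add) \<Rightarrow>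
    ('a \<Rightarrow> 'b \<Rightarrow> 'k) \<Rightarrow> bool" where
  "bil s t f \<longleftrightarrow> (\<forall>b. lin s (*) (\<lambda>a. f a b)) \<and> (\<forall>a. lin t (*) (f a))"

lemma bilI: "(\<And>b. lin s (*) (\<lambda>a. f a b)) \<Longrightarrow> (\<And>a. lin t (*) (\<lambda>b. f a b)) \<Longrightarrow> bil s t f"
  by (simp add: bil_def)

lemma bilin_bil: "vector_space s \<Longrightarrow> vector_space t \<Longrightarrow> bilin s t (*) f \<longleftrightarrow> bil s t f"
  unfolding bilin_def bil_def by (auto simp: lin_linear[OF _ vector_space_mult])

text \<open>The identity is injective on V, so its restriction has a linear left inverse with values
  in V.\<close>

lemma exists_projection:
  assumes "vector_space s" and "module.subspace s V"
  obtains p where "Vector_Spaces.linear s s p" "\<And>v. p v \<in> V" "\<And>v. v \<in> V \<Longrightarrow> p v = v"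
proof -
  interpret vector_space s by fact
  interpret vector_space_pair s s by unfold_locales
  have "\<exists>g. g ` UNIV \<subseteq> V \<and> Vector_Spaces.linear s s g \<and> (\<forall>v\<in>V. g (id v) = v)"
    by (rule linear_exists_left_inverse_on[OF _ assms(2)]) (auto simp: linear_id id_def linear_ident)
  then show ?thesis using that by auto
qed

text \<open>
  A tensor of a tensor evaluates nested forms only up to linearity of the form in the tensor
  argument on the whole function space; the projection onto the tensors provides it.
\<close>

lemma eval_tens_tensor:
  assumes s: "vector_space s" and V: "module.subspace fscale V"
    and h: "\<And>a b. (a, b) \<in> set L \<Longrightarrow> g a b \<in> V"
    and h': "\<And>a b. (a, b) \<in> set L' \<Longrightarrow> g' a b \<in> V"
    and eq: "sm L (\<lambda>a b. tens s fscale (f a b) (g a b)) = sm L' (\<lambda>a b. tens s fscale (f' a b) (g' a b))"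
    and lin: "\<And>t. t \<in> V \<Longrightarrow> lin s (*) (\<lambda>a. t (\<Phi> a))"
  shows "sm L (\<lambda>a b. g a b (\<Phi> (f a b))) = sm L' (\<lambda>a b. g' a b (\<Phi> (f' a b)))"
proof -
  obtain p where p: "Vector_Spaces.linear fscale fscale p" "\<And>v. p v \<in> V" "\<And>v. v \<in> V \<Longrightarrow> p v = v"
    using exists_projection[OF vector_space_fscale V] by blast
  have "bil s fscale (\<lambda>a t. p t (\<Phi> a))"
    unfolding bil_def using lin[OF p(2)] linear_lin[OF p(1)] by (auto simp: lin_def fscale_def)
  then have b: "bilin s fscale (*) (\<lambda>a t. p t (\<Phi> a))"
    by (simp add: bilin_bil[OF s vector_space_fscale])
  have "sm L (\<lambda>a b. tens s fscale (f a b) (g a b)) (\<lambda>a t. p t (\<Phi> a)) = sm L (\<lambda>a b. g a b (\<Phi> (f a b)))"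
    unfolding sm_apply by (rule sm_cong) (use b h p in \<open>auto simp: tens_def\<close>)
  moreover have "sm L' (\<lambda>a b. tens s fscale (f' a b) (g' a b)) (\<lambda>a t. p t (\<Phi> a)) = sm L' (\<lambda>a b. g' a b (\<Phi> (f' a b)))"
    unfolding sm_apply by (rule sm_cong) (use b h' p in \<open>auto simp: tens_def\<close>)
  ultimately show ?thesis using eq by simp
qed

text \<open>An arbitrary element of the function type depends on the form without any linearity; the
  finite expansion of a tensor into pure tensors supplies it.\<close>

lemma tens_space_eval_lin:
  assumes t: "t \<in> tens_space sA sB" and s: "vector_space sA" "vector_space sB"
    and f: "\<And>a. bil sA sB (f a)" and l: "\<And>x y. lin s (*) (\<lambda>a. f a x y)"
  shows "lin s (*) (\<lambda>a. t (f a))"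
proof -
  obtain ps where ps: "t = (\<Sum>(a, b)\<leftarrow>ps. tens sA sB a b)" using ex_tens_rep[OF s t] by blast
  have "t (f a) = sm ps (\<lambda>x y. f a x y)" for a
    unfolding ps sm_def[symmetric] sm_apply using f bilin_bil[OF s] by (simp add: tens_def)
  then show ?thesis using l by (simp add: lin_sm)
qed

text \<open>The right side no longer mentions the chosen expression; this removes the choice behind
  Sweedler notation.\<close>

lemma tens_rep_eval:
  assumes t: "t \<in> tens_space sA sB" and s: "vector_space sA" "vector_space sB"
    and f: "bil sA sB f"
  shows "sm (tens_rep sA sB t) f = t f"
proof -
  have "t f = (\<Sum>(a, b)\<leftarrow>tens_rep sA sB t. tens sA sB a b) f" using sum_tens_rep[OF s t] by simp
  also have "\<dots> = sm (tens_rep sA sB t) f"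
    unfolding sm_def[symmetric] sm_apply using f bilin_bil[OF s] by (simp add: tens_def)
  finally show ?thesis by simp
qed

lemma tens_eval: "bil sA sB f \<Longrightarrow> vector_space sA \<Longrightarrow> vector_space sB \<Longrightarrow> tens sA sB a b f = f a b"
  by (simp add: tens_def bilin_bil)

lemma tens_space_subspace: "module.subspace fscale (tens_space sA sB)"
  unfolding tens_space_def
  by (rule module.subspace_span[OF vector_space_fscale[unfolded module_iff_vector_space[symmetric]]])

lemma tens_in: "tens sA sB a b \<in> tens_space sA sB"
  unfolding tens_space_def
  by (rule module.span_base[OF vector_space_fscale[unfolded module_iff_vector_space[symmetric]]]) auto


section \<open>Sweedler calculus with forms\<close>

locale hopf =
  fixes H :: "('k::field, 'h::ring_1) hopf_data"
  assumes hopf_algebra: "hopf_algebra H"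
begin

abbreviation "sH \<equiv> hscale H"
abbreviation "\<epsilon> \<equiv> counit H"
abbreviation "S \<equiv> antipode H"
abbreviation "Sw h \<equiv> sm (sw H h)"

lemma vs_H: "vector_space sH"
  using hopf_algebra by (simp add: hopf_algebra_def)

lemma lin_multr: "lin s sH g \<Longrightarrow> lin s sH (\<lambda>a. g a * b)"
  and lin_multl: "lin s sH g \<Longrightarrow> lin s sH (\<lambda>a. b * g a)"
  using hopf_algebra
  by (auto simp: hopf_algebra_def bilin_def Vector_Spaces.linear_iff lin_def distrib_left distrib_right)

lemma lin_antipode: "lin s sH g \<Longrightarrow> lin s sH (\<lambda>a. S (g a))"
  and lin_counit: "lin s sH g \<Longrightarrow> lin s (*) (\<lambda>a. \<epsilon> (g a))"
  using hopf_algebra by (auto simp: hopf_algebra_def Vector_Spaces.linear_iff lin_def)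

lemma lin_hscale: "lin s (*) g \<Longrightarrow> lin s sH (\<lambda>a. sH (g a) b)"
  using vs_H by (auto simp: lin_def vector_space_def)

lemma Sw_eval: "bil sH sH f \<Longrightarrow> Sw h f = comult H h f"
  unfolding sw_def
  by (rule tens_rep_eval) (use hopf_algebra vs_H in \<open>auto simp: hopf_algebra_def\<close>)

text \<open>The list \<open>sw H h\<close> is a choice and does not depend linearly on h. For
  bilinear f, however, the sum is a value of the comultiplication, which does.\<close>

lemma lin_Sw:
  assumes "lin s sH g" and "\<And>b. lin sH (*) (\<lambda>a. f a b)" and "\<And>a. lin sH (*) (\<lambda>b. f a b)"
  shows "lin s (*) (\<lambda>a. Sw (g a) f)"
  using hopf_algebra assms
  by (auto simp: Sw_eval bil_def hopf_algebra_def Vector_Spaces.linear_iff lin_def fscale_def)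

lemmas lins = lin_ident lin_sm lin_kmult lin_multl lin_multr lin_antipode lin_counit lin_hscale lin_Sw

lemma lin_comp: "lin s sH g \<Longrightarrow> lin sH s' f \<Longrightarrow> lin s s' (\<lambda>a. f (g a))"
  by (simp add: lin_def)

lemma Sw_mult:
  assumes "\<And>b. lin sH (*) (\<lambda>a. f a b)" and "\<And>a. lin sH (*) (\<lambda>b. f a b)"
  shows "Sw (g * h) f = Sw g (\<lambda>a b. Sw h (\<lambda>c d. f (a * c) (b * d)))"
proof -
  have b: "bil sH sH f" using assms by (rule bilI)
  have "comult H (g * h) = Sw g (\<lambda>a b. Sw h (\<lambda>c d. htens H (a * c) (b * d)))"
    using hopf_algebra by (simp add: hopf_algebra_def sm_def)
  then show ?thesis by (simp add: Sw_eval[OF b] sm_apply tens_eval[OF b vs_H vs_H])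
qed

lemma Sw_1:
  assumes "\<And>b. lin sH (*) (\<lambda>a. f a b)" and "\<And>a. lin sH (*) (\<lambda>b. f a b)"
  shows "Sw 1 f = f 1 1"
proof -
  have b: "bil sH sH f" using assms by (rule bilI)
  then show ?thesis
    using hopf_algebra by (simp add: hopf_algebra_def Sw_eval[OF b] tens_eval[OF b vs_H vs_H])
qed

lemma Sw_coassoc:
  assumes "\<And>b c. lin sH (*) (\<lambda>a. f a b c)" and "\<And>a c. lin sH (*) (\<lambda>b. f a b c)"
    and "\<And>a b. lin sH (*) (\<lambda>c. f a b c)"
  shows "Sw h (\<lambda>a b. Sw a (\<lambda>c d. f c d b)) = Sw h (\<lambda>a b. Sw b (\<lambda>c d. f a c d))"
proof -
  have b: "bil sH sH (f a)" for a using assms by (intro bilI)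
  \<comment> \<open>The pairing (c, (d, b)) keeps together the two components that the
    coassociativity axiom puts into the inner tensor, so that both double sums become single sums of
    the shape needed by \<open>eval_tens_tensor\<close>.\<close>
  let ?L = "concat (map (\<lambda>(a, b). map (\<lambda>(c, d). (c, (d, b))) (sw H a)) (sw H h))"
  let ?R = "concat (map (\<lambda>(a, b). map (\<lambda>(c, d). (a, (c, d))) (sw H b)) (sw H h))"
  have "sm ?L (\<lambda>a t. (htens H (fst t) (snd t)) (f a)) = sm ?R (\<lambda>a t. (htens H (fst t) (snd t)) (f a))"
  proof (rule eval_tens_tensor[OF vs_H tens_space_subspace, where f = "\<lambda>a t. a" and f' = "\<lambda>a t. a"
        and \<Phi> = f and g = "\<lambda>a t. htens H (fst t) (snd t)" and g' = "\<lambda>a t. htens H (fst t) (snd t)"])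
    show "sm ?L (\<lambda>a t. tens sH fscale a (htens H (fst t) (snd t)))
        = sm ?R (\<lambda>a t. tens sH fscale a (htens H (fst t) (snd t)))"
      using hopf_algebra by (simp add: hopf_algebra_def sm_def[symmetric])
    show "lin sH (*) (\<lambda>a. t (f a))" if "t \<in> tens_space sH sH" for t
      using that vs_H vs_H b assms(1) by (rule tens_space_eval_lin)
  qed (rule tens_in)+
  then show ?thesis by (simp add: tens_eval[OF b vs_H vs_H])
qed

lemma Sw_counit:
  assumes "lin sH (*) f"
  shows "Sw h (\<lambda>a b. \<epsilon> a * f b) = f h" "Sw h (\<lambda>a b. \<epsilon> b * f a) = f h"
    "Sw h (\<lambda>a b. f b * \<epsilon> a) = f h" "Sw h (\<lambda>a b. f a * \<epsilon> b) = f h"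
proof -
  have "f (Sw h (\<lambda>a b. sH (\<epsilon> a) b)) = f h" "f (Sw h (\<lambda>a b. sH (\<epsilon> b) a)) = f h"
    using hopf_algebra by (simp_all add: hopf_algebra_def sm_def)
  then show "Sw h (\<lambda>a b. \<epsilon> a * f b) = f h" "Sw h (\<lambda>a b. \<epsilon> b * f a) = f h"
    "Sw h (\<lambda>a b. f b * \<epsilon> a) = f h" "Sw h (\<lambda>a b. f a * \<epsilon> b) = f h"
    by (simp_all add: lin_sm_arg[OF assms] lin_scale[OF assms] mult.commute)
qed

lemma counit_1 [simp]: "\<epsilon> 1 = 1" and counit_mult [simp]: "\<epsilon> (g * h) = \<epsilon> g * \<epsilon> h"
  using hopf_algebra by (simp_all add: hopf_algebra_def)

lemma Sw_antipode:
  assumes "lin sH (*) f"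
  shows "Sw h (\<lambda>a b. f (S a * b)) = \<epsilon> h * f 1" "Sw h (\<lambda>a b. f (a * S b)) = \<epsilon> h * f 1"
proof -
  have "f (Sw h (\<lambda>a b. S a * b)) = f (sH (\<epsilon> h) 1)" "f (Sw h (\<lambda>a b. a * S b)) = f (sH (\<epsilon> h) 1)"
    using hopf_algebra by (simp_all add: hopf_algebra_def sm_def)
  then show "Sw h (\<lambda>a b. f (S a * b)) = \<epsilon> h * f 1" "Sw h (\<lambda>a b. f (a * S b)) = \<epsilon> h * f 1"
    by (simp_all add: lin_sm_arg[OF assms] lin_scale[OF assms])
qed

lemma eq_by_forms: "(\<And>f. lin sH (*) f \<Longrightarrow> f a = f b) \<Longrightarrow> a = b"
  using separating_form[OF vs_H] linear_lin by metis


lemma antipode_1 [simp]: "S 1 = 1"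
proof (rule eq_by_forms)
  fix f :: "'h \<Rightarrow> 'k" assume f: "lin sH (*) f"
  have "Sw 1 (\<lambda>a b. f (S a * b)) = f (S 1 * 1)"
    by (rule Sw_1) (intro lins lin_comp[OF _ f])+
  then show "f (S 1) = f 1" using Sw_antipode(1)[OF f, of 1] by simp
qed

lemma counit_antipode [simp]: "\<epsilon> (S h) = \<epsilon> h"
proof -
  have "Sw h (\<lambda>a b. \<epsilon> (S a) * \<epsilon> b) = \<epsilon> h"
    using Sw_antipode(1)[OF lin_counit[OF lin_ident], of h] by simp
  then show ?thesis using Sw_counit(4)[of "\<lambda>a. \<epsilon> (S a)" h] by (simp add: lins)
qed

text \<open>Convolution inverses are unique: S(g h) is a left inverse and S(h) S(g) a right inverse
  of the multiplication on H \<otimes> H. The sum \<open>T\<close> is f applied to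
  \<open>S(g1 h1) (g2 h2) (S(h3) S(g3))\<close>, contracted once from the right and once from the
  left.\<close>

lemma antipode_mult: "S (g * h) = S h * S g"
proof (rule eq_by_forms)
  fix f :: "'h \<Rightarrow> 'k" assume f: "lin sH (*) f"
  note L = lins lin_comp[OF _ f]
  define E where "E = (\<lambda>g1 u v h1 p q. f (S (g1 * h1) * (u * p) * (S q * S v)))"
  define T where "T = Sw g (\<lambda>g1 g2. Sw g2 (\<lambda>u v. Sw h (\<lambda>h1 h2. Sw h2 (\<lambda>p q. E g1 u v h1 p q))))"
  have 1: "Sw h2 (\<lambda>p q. E g1 u v h1 p q) = \<epsilon> h2 * f (S (g1 * h1) * (u * S v))" for g1 u v h1 h2
    using Sw_antipode(2)[of "\<lambda>w. f (S (g1 * h1) * (u * w * S v))" h2]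
    by (simp add: E_def mult.assoc L)
  have 2: "Sw h (\<lambda>h1 h2. \<epsilon> h2 * f (S (g1 * h1) * (u * S v))) = f (S (g1 * h) * (u * S v))" for g1 u v
    by (rule Sw_counit(2)) (intro L)
  have 3: "Sw g2 (\<lambda>u v. f (S (g1 * h) * (u * S v))) = \<epsilon> g2 * f (S (g1 * h))" for g1 g2
    using Sw_antipode(2)[of "\<lambda>w. f (S (g1 * h) * w)" g2] by (simp add: L)
  have 4: "Sw g (\<lambda>g1 g2. \<epsilon> g2 * f (S (g1 * h))) = f (S (g * h))"
    by (rule Sw_counit(2)) (intro L)
  have "T = f (S (g * h))" unfolding T_def 1 2 3 4 ..
  have c1: "Sw h (\<lambda>h1 h2. Sw h2 (\<lambda>p q. E g1 u v h1 p q)) = Sw h (\<lambda>a b. Sw a (\<lambda>c d. E g1 u v c d b))" for g1 u v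
    by (rule Sw_coassoc[symmetric]) (unfold E_def, (intro L)+)
  have c2: "T = Sw g (\<lambda>a' b'. Sw a' (\<lambda>c' d'. Sw h (\<lambda>a b. Sw a (\<lambda>c d. E c' d' b' c d b))))"
    unfolding T_def c1 by (rule Sw_coassoc[symmetric]) (unfold E_def, (intro L)+)
  have s: "Sw a' (\<lambda>c' d'. Sw h (\<lambda>a b. Sw a (\<lambda>c d. E c' d' b' c d b)))
     = Sw h (\<lambda>a b. Sw a' (\<lambda>c' d'. Sw a (\<lambda>c d. E c' d' b' c d b)))" for a' b'
    by (rule sm_swap)
  have m: "Sw a' (\<lambda>c' d'. Sw a (\<lambda>c d. E c' d' b' c d b)) = Sw (a' * a) (\<lambda>x y. f (S x * y * (S b * S b')))"
    for a a' b b'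
    unfolding E_def by (rule Sw_mult[symmetric]) (intro L)+
  have k: "Sw x (\<lambda>x y. f (S x * y * c)) = \<epsilon> x * f c" for x c
    using Sw_antipode(1)[of "\<lambda>w. f (w * c)" x] by (simp add: L)
  have 5: "Sw h (\<lambda>a b. \<epsilon> (a' * a) * f (S b * S b')) = \<epsilon> a' * f (S h * S b')" for a' b'
    using Sw_counit(1)[of "\<lambda>b. f (S b * S b')" h] by (simp add: L mult.assoc sm_scale)
  have 6: "Sw g (\<lambda>a' b'. \<epsilon> a' * f (S h * S b')) = f (S h * S g)"
    by (rule Sw_counit(1)) (intro L)
  have "T = f (S h * S g)" unfolding c2 s m k 5 6 ..
  with \<open>T = f (S (g * h))\<close> show "f (S (g * h)) = f (S h * S g)" by simp
qed

text \<open>Uniqueness of convolution inverses again, now of the comultiplication as a map to H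
  \<otimes> H. The sum \<open>T\<close> evaluates the product of the coproduct of S(h1), the
  coproduct of h2, and S(h4) \<otimes> S(h3).\<close>

lemma Sw_antipode_apply:
  assumes "\<And>b. lin sH (*) (\<lambda>a. f a b)" and "\<And>a. lin sH (*) (\<lambda>b. f a b)"
  shows "Sw (S h) f = Sw h (\<lambda>a b. f (S b) (S a))"
proof -
  note L = lins lin_comp[OF _ assms(1)] lin_comp[OF _ assms(2)]
  define E where "E = (\<lambda>p r w. Sw w (\<lambda>t1 t2. Sw (S p) (\<lambda>u v. Sw r (\<lambda>r1 r2. f (u * (r1 * S t2)) (v * (r2 * S t1))))))"
  have lE: "lin sH (*) (\<lambda>p. E p r w)" "lin sH (*) (\<lambda>r. E p r w)" "lin sH (*) (\<lambda>w. E p r w)" for p r w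
    unfolding E_def by (intro L)+
  define T where "T = Sw h (\<lambda>p q. Sw q (\<lambda>r w. E p r w))"
  have 1: "Sw q (\<lambda>r w. E p r w) = \<epsilon> q * Sw (S p) f" for p q
  proof -
    have "Sw q (\<lambda>r w. E p r w)
      = Sw (S p) (\<lambda>u v. Sw q (\<lambda>r w. Sw r (\<lambda>r1 r2. Sw w (\<lambda>t1 t2. f (u * (r1 * S t2)) (v * (r2 * S t1))))))"
    proof -
      have e: "E p r w = Sw (S p) (\<lambda>u v. Sw r (\<lambda>r1 r2. Sw w (\<lambda>t1 t2. f (u * (r1 * S t2)) (v * (r2 * S t1)))))" for r w
        unfolding E_def by (subst sm_swap[of "sw H w"], intro sm_cong, rule sm_swap)
      show ?thesis by (subst sm_swap, rule sm_cong, rule e)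
    qed
    also have "\<dots> = Sw (S p) (\<lambda>u v. \<epsilon> q * f u v)"
    proof (intro sm_cong)
      fix u v
      have "Sw q (\<lambda>r w. Sw r (\<lambda>r1 r2. Sw w (\<lambda>t1 t2. f (u * (r1 * S t2)) (v * (r2 * S t1)))))
        = Sw q (\<lambda>r1 x. Sw x (\<lambda>r2 w. Sw w (\<lambda>t1 t2. f (u * (r1 * S t2)) (v * (r2 * S t1)))))"
        by (rule Sw_coassoc) (intro L)+
      also have "\<dots> = Sw q (\<lambda>r1 x. Sw x (\<lambda>y t2. Sw y (\<lambda>r2 t1. f (u * (r1 * S t2)) (v * (r2 * S t1)))))"
        by (rule sm_cong, rule Sw_coassoc[symmetric]) (intro L)+
      also have "\<dots> = Sw q (\<lambda>r1 x. Sw x (\<lambda>y t2. \<epsilon> y * f (u * (r1 * S t2)) v))"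
        using Sw_antipode(2)[of "\<lambda>w. f c (v * w)" for c] by (intro sm_cong) (simp add: L)
      also have "\<dots> = Sw q (\<lambda>r1 x. f (u * (r1 * S x)) v)"
        by (intro sm_cong Sw_counit(1)) (intro L)
      also have "\<dots> = \<epsilon> q * f u v"
        using Sw_antipode(2)[of "\<lambda>w. f (u * w) v" q] by (simp add: L)
      finally show "Sw q (\<lambda>r w. Sw r (\<lambda>r1 r2. Sw w (\<lambda>t1 t2. f (u * (r1 * S t2)) (v * (r2 * S t1))))) = \<epsilon> q * f u v" .
    qed
    finally show ?thesis by (simp add: sm_scale)
  qed
  have "T = Sw (S h) f" unfolding T_def 1
    by (rule Sw_counit(2)) (intro L)
  have 2: "Sw a (\<lambda>c d. E c d b) = \<epsilon> a * Sw b (\<lambda>t1 t2. f (S t2) (S t1))" for a b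
  proof -
    have "Sw a (\<lambda>c d. E c d b) = Sw b (\<lambda>t1 t2. Sw a (\<lambda>c d. Sw (S c * d) (\<lambda>x y. f (x * S t2) (y * S t1))))"
      unfolding E_def
      by (subst sm_swap, intro sm_cong, subst Sw_mult) ((intro L)+, simp add: mult.assoc)
    also have "\<dots> = Sw b (\<lambda>t1 t2. \<epsilon> a * f (S t2) (S t1))"
    proof (intro sm_cong)
      fix t1 t2
      have "Sw a (\<lambda>c d. Sw (S c * d) (\<lambda>x y. f (x * S t2) (y * S t1))) = \<epsilon> a * Sw 1 (\<lambda>x y. f (x * S t2) (y * S t1))"
        by (rule Sw_antipode(1)[of "\<lambda>w. Sw w (\<lambda>x y. f (x * S t2) (y * S t1))"]) (intro L)
      also have "Sw 1 (\<lambda>x y. f (x * S t2) (y * S t1)) = f (S t2) (S t1)"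
        by (subst Sw_1) ((intro L)+, simp)
      finally show "Sw a (\<lambda>c d. Sw (S c * d) (\<lambda>x y. f (x * S t2) (y * S t1))) = \<epsilon> a * f (S t2) (S t1)" .
    qed
    finally show ?thesis by (simp add: sm_scale)
  qed
  have "T = Sw h (\<lambda>a b. Sw a (\<lambda>c d. E c d b))" unfolding T_def
    by (rule Sw_coassoc[symmetric]) (rule lE)+
  also have "\<dots> = Sw h (\<lambda>t1 t2. f (S t2) (S t1))" unfolding 2
    by (rule Sw_counit(1)) (intro L)
  finally show ?thesis using \<open>T = Sw (S h) f\<close> by simp
qed

end

locale hopf_bij = hopf +
  assumes bij_antipode: "bij (antipode H)"
begin

abbreviation "S' \<equiv> antipode_inv H"

lemma antipode_inverse [simp]: "S (S' h) = h" "S' (S h) = h"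
  using bij_antipode by (auto simp: bij_def surj_f_inv_f inv_f_f)

lemma antipode_eq_iff: "S a = S b \<longleftrightarrow> a = b"
  using bij_antipode by (auto simp: bij_def inj_def)

lemma lin_antipode_inv: "lin s sH g \<Longrightarrow> lin s sH (\<lambda>a. S' (g a))"
  unfolding lin_def
  by (metis antipode_inverse lin_antipode[OF lin_ident, THEN lin_add] lin_antipode[OF lin_ident, THEN lin_scale])

lemmas lins' = lins lin_antipode_inv

lemma antipode_inv_mult: "S' (g * h) = S' h * S' g"
  by (subst antipode_eq_iff[symmetric]) (simp add: antipode_mult)

lemma antipode_inv_1 [simp]: "S' 1 = 1"
  by (subst antipode_eq_iff[symmetric]) simp

lemma counit_antipode_inv [simp]: "\<epsilon> (S' h) = \<epsilon> h"
  using counit_antipode[of "S' h"] by simp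

lemma Sw_antipode_inv_apply:
  assumes "\<And>b. lin sH (*) (\<lambda>a. f a b)" and "\<And>a. lin sH (*) (\<lambda>b. f a b)"
  shows "Sw (S' h) f = Sw h (\<lambda>a b. f (S' b) (S' a))"
proof -
  note L = lins' lin_comp[OF _ assms(1)] lin_comp[OF _ assms(2)]
  have "Sw (S (S' h)) (\<lambda>a b. f (S' b) (S' a)) = Sw (S' h) (\<lambda>a b. f (S' (S a)) (S' (S b)))"
    by (rule Sw_antipode_apply) (intro L)+
  then show ?thesis by simp
qed

text \<open>The inverse antipode reverses products, so applying it inside the antipode axioms yields
  cancellations with the two components in flipped order.\<close>

lemma Sw_antipode_inv:
  assumes "lin sH (*) f"
  shows "Sw h (\<lambda>a b. f (S' b * a)) = \<epsilon> h * f 1" "Sw h (\<lambda>a b. f (b * S' a)) = \<epsilon> h * f 1"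
proof -
  note L = lins' lin_comp[OF _ assms(1)]
  have l: "lin sH (*) (\<lambda>a. f (S' a))" by (intro L)
  show "Sw h (\<lambda>a b. f (S' b * a)) = \<epsilon> h * f 1"
    using Sw_antipode(1)[OF l, of h] by (simp add: antipode_inv_mult)
  show "Sw h (\<lambda>a b. f (b * S' a)) = \<epsilon> h * f 1"
    using Sw_antipode(2)[OF l, of h] by (simp add: antipode_inv_mult)
qed

end


section \<open>Multilinear forms and the combinatorics of the structure maps\<close>

context hopf
begin

text \<open>
  Multilinearity in all lengths at once, which saves the bookkeeping of lengths.  A form of a fixed length
  is extended by \<open>0\<close> (\<open>multilin_cut\<close>).
\<close>

definition mlin :: "('k \<Rightarrow> 'x \<Rightarrow> 'x::ab_group_add) \<Rightarrow> ('h list \<Rightarrow> 'x \<Rightarrow> 'k) \<Rightarrow> bool" where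
  "mlin s F \<longleftrightarrow> (\<forall>hs. lin s (*) (F hs)) \<and> (\<forall>as bs x. lin sH (*) (\<lambda>h. F (as @ h # bs) x))"

lemma mlin_last: "mlin s F \<Longrightarrow> lin t s g \<Longrightarrow> lin t (*) (\<lambda>c. F l (g c))"
  by (simp add: mlin_def lin_def)

lemma mlin_slot: "mlin s F \<Longrightarrow> lin t sH g \<Longrightarrow> lin t (*) (\<lambda>a. F (as @ g a # bs) c)"
  by (simp add: mlin_def lin_def)

text \<open>Unification does not find the split \<open>as @ g a # bs\<close> in a list written with
  explicit heads or a last element; these are the shapes that occur below.\<close>

lemma mlin_slots:
  assumes "mlin s F" "lin t sH g"
  shows "lin t (*) (\<lambda>a. F (g a # l) c)" "lin t (*) (\<lambda>a. F (p # g a # l) c)"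
    "lin t (*) (\<lambda>a. F (l @ [g a]) c)" "lin t (*) (\<lambda>a. F (p # l @ [g a]) c)"
  using mlin_slot[OF assms, of "[]" l] mlin_slot[OF assms, of "[p]" l] mlin_slot[OF assms, of l "[]"]
    mlin_slot[OF assms, of "p # l" "[]"] by simp_all

lemma mlin_extend:
  assumes "mlin s F" "lin t s g"
  shows "mlin t (\<lambda>l c. F l (g c))" "mlin t (\<lambda>l c. F (p # l) (g c))"
    "mlin t (\<lambda>l c. F (l @ [p]) (g c))" "mlin t (\<lambda>l c. F (p # q # l) (g c))"
    "mlin t (\<lambda>l c. F (p # l @ [q]) (g c))"
  using mlin_last[OF assms] mlin_slot[OF assms(1) lin_ident]
    mlin_slot[OF assms(1) lin_ident, of "p # as" for as]
    mlin_slot[OF assms(1) lin_ident, of "p # q # as" for as]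
  by (auto simp: mlin_def)

lemmas atoms = mlin_last mlin_slots mlin_extend

text \<open>A slot is either the head or lies in the tail, so forms given by recursion on the list
  are handled one entry at a time.\<close>

lemma mlin_Cons:
  assumes "lin s (*) (F [])" and "\<And>h. mlin s (\<lambda>l. F (h # l))" and "\<And>l x. lin sH (*) (\<lambda>h. F (h # l) x)"
  shows "mlin s F"
  unfolding mlin_def
proof (intro conjI allI)
  show "lin s (*) (F hs)" for hs using assms by (cases hs) (auto simp: mlin_def)
  show "lin sH (*) (\<lambda>h. F (as @ h # bs) x)" for as bs x
    using assms by (cases as) (auto simp: mlin_def)
qed

lemma mlin_sm: "(\<And>p q. mlin s (\<lambda>l c. F l c p q)) \<Longrightarrow> mlin s (\<lambda>l c. sm L (F l c))"
  by (simp add: mlin_def lin_sm)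

lemma mlin_mult: "mlin s F \<Longrightarrow> mlin s (\<lambda>l c. k * F l c)"
  by (simp add: mlin_def lins)

lemma mlin_Sw:
  assumes "lin s sH g" "\<And>p. mlin sH (\<lambda>l q. F l p q)" "\<And>l q. lin sH (*) (\<lambda>p. F l p q)"
  shows "mlin s (\<lambda>l c. Sw (g c) (F l))"
  using assms by (auto simp: mlin_def intro!: lin_Sw lin_sm)

text \<open>A formal sum is a list of representatives and not itself linear in the entries it is
  built from; multilinearity holds only after evaluation on a form, and that is what is
  recorded.\<close>

definition closed_op :: "('h list \<Rightarrow> ('h list \<times> 'h) list) \<Rightarrow> bool" where
  "closed_op Y \<longleftrightarrow> (\<forall>\<Phi> as bs. mlin sH \<Phi> \<longrightarrow> lin sH (*) (\<lambda>h. sm (Y (as @ h # bs)) \<Phi>))"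

lemma mlin_closed_op:
  assumes "closed_op Y" "\<And>c. mlin sH (\<lambda>l d. \<Psi> l d c)" "\<And>l d. lin s (*) (\<lambda>c. \<Psi> l d c)"
  shows "mlin s (\<lambda>l c. sm (Y l) (\<lambda>l' d. \<Psi> l' d c))"
  using assms by (auto simp: mlin_def closed_op_def intro!: lin_sm)

text \<open>
  Formal sums of pairs of a list of \<open>n\<close> factors and an element of \<open>H\<close>: the diagonal action
  \<open>h\<^sub>(\<^sub>1\<^sub>) h\<^sup>0 \<otimes> \<dots> \<otimes> h\<^sub>(\<^sub>n\<^sub>) h\<^sup>n\<^sup>-\<^sup>1\<close> with the remaining \<open>h\<^sub>(\<^sub>n\<^sub>+\<^sub>1\<^sub>)\<close> (\<open>dg\<close>), the factors of \<open>\<alpha>\<close> with the element that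
  acts on \<open>X\<close> (\<open>al\<close>), and the components \<open>h\<^sup>0\<^sub>(\<^sub>1\<^sub>) \<otimes> \<dots> \<otimes> h\<^sup>n\<^sup>-\<^sup>1\<^sub>(\<^sub>1\<^sub>)\<close> with \<open>h\<^sup>0\<^sub>(\<^sub>2\<^sub>) \<dots> h\<^sup>n\<^sup>-\<^sup>1\<^sub>(\<^sub>2\<^sub>)\<close> (\<open>pl\<close>).
\<close>

primrec dg :: "'h \<Rightarrow> 'h list \<Rightarrow> ('h list \<times> 'h) list" where
  "dg h [] = [([], h)]"
| "dg h (g # gs) = concat (map (\<lambda>(a, b). map (\<lambda>(l, c). (a * g # l, c)) (dg b gs)) (sw H h))"

primrec al :: "'h list \<Rightarrow> ('h list \<times> 'h) list" where
  "al [] = [([], 1)]"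
| "al (h # hs) = concat (map (\<lambda>(a, b). concat (map (\<lambda>(l, p). map (\<lambda>(l', c). (a # l', c * p)) (dg b l)) (al hs))) (sw H h))"

primrec pl :: "'h list \<Rightarrow> ('h list \<times> 'h) list" where
  "pl [] = [([], 1)]"
| "pl (h # hs) = concat (map (\<lambda>(a, b). map (\<lambda>(l, q). (a # l, b * q)) (pl hs)) (sw H h))"

text \<open>
  The inverse of \<open>\<alpha>\<close> is \<open>h\<^sup>0 \<otimes> \<dots> \<otimes> h\<^sup>n \<otimes> x \<mapsto>
  h\<^sup>0\<^sub>(\<^sub>1\<^sub>) \<otimes> S(h\<^sup>0\<^sub>(\<^sub>2\<^sub>)) h\<^sup>1\<^sub>(\<^sub>1\<^sub>) \<otimes> \<dots> \<otimes> S(h\<^sup>n\<^sub>(\<^sub>2\<^sub>)) x\<close>; the first argument of \<open>bq\<close> carries the factor that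
  is passed on to the next entry.
\<close>

primrec bq :: "'h \<Rightarrow> 'h list \<Rightarrow> ('h list \<times> 'h) list" where
  "bq c [] = [([], c)]"
| "bq c (h # hs) = concat (map (\<lambda>(a, b). map (\<lambda>(l, p). (c * a # l, p)) (bq (S b) hs)) (sw H h))"

lemma lin_dg:
  assumes "lin t sH g" "mlin sH \<Phi>"
  shows "lin t (*) (\<lambda>a. sm (dg (g a) hs) \<Phi>)"
proof -
  have "lin sH (*) (\<lambda>a. sm (dg a hs) \<Phi>)" using assms(2)
  proof (induction hs arbitrary: \<Phi>)
    case Nil
    note L = lins atoms[OF Nil]
    show ?case by (simp, intro L)
  next
    case (Cons u hs)
    note L = lins atoms[OF Cons.prems]
    show ?case by (simp, intro L Cons.IH)
  qed
  then show ?thesis by (rule lin_comp[OF assms(1)])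
qed

lemma closed_dg: "closed_op (dg k)"
  unfolding closed_op_def
proof (intro allI impI)
  show "lin sH (*) (\<lambda>h. sm (dg k (as @ h # bs)) \<Phi>)" if "mlin sH \<Phi>" for \<Phi> as bs
    using that
  proof (induction as arbitrary: k \<Phi>)
    case Nil
    note L = lins atoms[OF Nil]
    show ?case by (simp, intro L)
  next
    case (Cons u as)
    note L = lins atoms[OF Cons.prems]
    show ?case by (simp, intro lin_sm Cons.IH L)
  qed
qed

lemmas mlin_dg = mlin_closed_op[OF closed_dg]

lemma closed_al: "closed_op al"
  unfolding closed_op_def
proof (intro allI impI)
  show "lin sH (*) (\<lambda>h. sm (al (as @ h # bs)) \<Phi>)" if "mlin sH \<Phi>" for \<Phi> as bs
    using that
  proof (induction as arbitrary: \<Phi>)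
    case Nil
    note L = lins lin_dg atoms[OF Nil]
    show ?case by (simp, intro L)
  next
    case (Cons u as)
    note L = lins mlin_dg atoms[OF Cons.prems]
    show ?case by (simp, intro lin_sm Cons.IH L)
  qed
qed

lemma closed_pl: "closed_op pl"
  unfolding closed_op_def
proof (intro allI impI)
  show "lin sH (*) (\<lambda>h. sm (pl (as @ h # bs)) \<Phi>)" if "mlin sH \<Phi>" for \<Phi> as bs
    using that
  proof (induction as arbitrary: \<Phi>)
    case Nil
    note L = lins atoms[OF Nil]
    show ?case by (simp, intro L)
  next
    case (Cons u as)
    note L = lins atoms[OF Cons.prems]
    show ?case by (simp, intro lin_sm Cons.IH L)
  qed
qed

lemma lin_bq:
  assumes "lin t sH g" "mlin sH \<Phi>"
  shows "lin t (*) (\<lambda>a. sm (bq (g a) hs) \<Phi>)"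
proof -
  note L = lins atoms[OF assms(2)] assms(1)
  show ?thesis by (cases hs) (simp_all, (intro L)+)
qed

lemma closed_bq: "closed_op (bq k)"
  unfolding closed_op_def
proof (intro allI impI)
  show "lin sH (*) (\<lambda>h. sm (bq k (as @ h # bs)) \<Phi>)" if "mlin sH \<Phi>" for \<Phi> as bs
    using that
  proof (induction as arbitrary: k \<Phi>)
    case Nil
    note L = lins lin_bq atoms[OF Nil]
    show ?case by (simp, intro L)
  next
    case (Cons u as)
    note L = lins atoms[OF Cons.prems]
    show ?case by (simp, intro lin_sm Cons.IH L)
  qed
qed

lemmas forms = lins mlin_sm mlin_mult mlin_Sw mlin_dg mlin_closed_op[OF closed_al]
  mlin_closed_op[OF closed_pl] mlin_closed_op[OF closed_bq] lin_dg lin_bq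

section \<open>Identities for the diagonal action, the factors of \<alpha> and their inverse\<close>

lemma dg_1: "mlin sH \<Phi> \<Longrightarrow> sm (dg 1 hs) \<Phi> = \<Phi> hs 1"
proof (induction hs arbitrary: \<Phi>)
  case (Cons u hs)
  note L = forms atoms[OF Cons.prems]
  have "sm (dg 1 (u # hs)) \<Phi> = Sw 1 (\<lambda>a b. sm (dg b hs) (\<lambda>l c. \<Phi> (a * u # l) c))" by simp
  also have "\<dots> = sm (dg 1 hs) (\<lambda>l c. \<Phi> (1 * u # l) c)" by (rule Sw_1) (intro L)+
  also have "\<dots> = \<Phi> (1 * u # hs) 1" by (rule Cons.IH) (intro L)
  finally show ?case by simp
qed simp

text \<open>Multiplicativity of the comultiplication makes the diagonal action associative. The
  leftover components multiply as \<open>d * c\<close>, because h acts after g.\<close>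

lemma dg_dg:
  "mlin sH \<Phi> \<Longrightarrow> sm (dg g hs) (\<lambda>l c. sm (dg h l) (\<lambda>l' d. \<Phi> l' (d * c))) = sm (dg (h * g) hs) \<Phi>"
proof (induction hs arbitrary: \<Phi> g h)
  case (Cons u hs)
  note L = forms atoms[OF Cons.prems]
  have 1: "sm (dg b hs) (\<lambda>l c. sm (dg q l) (\<lambda>l' d. \<Phi> (p # l') (d * c))) = sm (dg (q * b) hs) (\<lambda>l. \<Phi> (p # l))"
    for p q b by (rule Cons.IH) (intro L)
  have "sm (dg g (u # hs)) (\<lambda>l c. sm (dg h l) (\<lambda>l' d. \<Phi> l' (d * c)))
    = Sw g (\<lambda>a b. sm (dg b hs) (\<lambda>l c. Sw h (\<lambda>p q. sm (dg q l) (\<lambda>l' d. \<Phi> (p * (a * u) # l') (d * c)))))"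
    by simp
  also have "\<dots> = Sw g (\<lambda>a b. Sw h (\<lambda>p q. sm (dg (q * b) hs) (\<lambda>l. \<Phi> (p * (a * u) # l))))"
    by (rule sm_cong) (subst sm_swap, simp only: 1)
  also have "\<dots> = Sw h (\<lambda>p q. Sw g (\<lambda>a b. sm (dg (q * b) hs) (\<lambda>l. \<Phi> (p * a * u # l))))"
    by (subst sm_swap) (simp add: mult.assoc)
  also have "\<dots> = Sw (h * g) (\<lambda>x y. sm (dg y hs) (\<lambda>l. \<Phi> (x * u # l)))"
    by (rule Sw_mult[symmetric]) (intro L)+
  finally show ?case by simp
qed simp

lemma dg_snoc: "sm (dg h (l @ [z])) \<Phi> = sm (dg h l) (\<lambda>l' c. Sw c (\<lambda>a b. \<Phi> (l' @ [a * z]) b))"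
  by (induction l arbitrary: h \<Phi>) simp_all

text \<open>By coassociativity, splitting the component that is left over after the action is the
  same as setting aside the last component of h beforehand.\<close>

lemma dg_comodule:
  "(\<And>b. mlin sH (\<lambda>l a. \<Psi> l a b)) \<Longrightarrow> (\<And>l a. lin sH (*) (\<lambda>b. \<Psi> l a b)) \<Longrightarrow>
    sm (dg h hs) (\<lambda>l c. Sw c (\<lambda>a b. \<Psi> l a b)) = Sw h (\<lambda>a b. sm (dg a hs) (\<lambda>l c. \<Psi> l c b))"
proof (induction hs arbitrary: \<Psi> h)
  case (Cons u hs)
  note L = forms atoms[OF Cons.prems(1)] lin_comp[OF _ Cons.prems(2)]
  have "sm (dg h (u # hs)) (\<lambda>l c. Sw c (\<lambda>a b. \<Psi> l a b))
     = Sw h (\<lambda>a b. sm (dg b hs) (\<lambda>l c. Sw c (\<lambda>p q. \<Psi> (a * u # l) p q)))" by simp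
  also have "\<dots> = Sw h (\<lambda>a b. Sw b (\<lambda>p q. sm (dg p hs) (\<lambda>l c. \<Psi> (a * u # l) c q)))"
    by (intro sm_cong Cons.IH) (intro L)+
  also have "\<dots> = Sw h (\<lambda>a b. Sw a (\<lambda>p q. sm (dg q hs) (\<lambda>l c. \<Psi> (p * u # l) c b)))"
    by (rule Sw_coassoc[symmetric]) (intro L)+
  finally show ?case by simp
qed simp

text \<open>The recursion of \<open>al\<close> runs over the first factor, while \<open>ta\<close>
  acts at the last one. This is the recursion from the other end, needed when \<alpha> is compared
  with \<open>ta\<close>.\<close>

lemma al_snoc:
  "mlin sH \<Phi> \<Longrightarrow> sm (al (hs @ [h])) \<Phi>
    = sm (al hs) (\<lambda>l p. Sw p (\<lambda>p1 p2. Sw h (\<lambda>h1 h2. \<Phi> (l @ [p1 * h1]) (p2 * h2))))"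
proof (induction hs arbitrary: \<Phi>)
  case Nil
  note L = forms atoms[OF Nil]
  show ?case by (simp, rule sym, rule trans, rule Sw_1) ((intro L)+, simp)
next
  case (Cons u hs)
  note L = forms atoms[OF Cons.prems]
  have "sm (al ((u # hs) @ [h])) \<Phi>
    = Sw u (\<lambda>a b. sm (al (hs @ [h])) (\<lambda>l p. sm (dg b l) (\<lambda>l' c. \<Phi> (a # l') (c * p))))" by simp
  also have "\<dots> = Sw u (\<lambda>a b. sm (al hs) (\<lambda>l p. Sw p (\<lambda>p1 p2. Sw h (\<lambda>h1 h2.
      sm (dg b (l @ [p1 * h1])) (\<lambda>l' c. \<Phi> (a # l') (c * (p2 * h2)))))))"
    by (intro sm_cong Cons.IH) (intro L)
  also have "\<dots> = Sw u (\<lambda>a b. sm (al hs) (\<lambda>l p. sm (dg b l) (\<lambda>l' c. Sw p (\<lambda>p1 p2. Sw h (\<lambda>h1 h2.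
      Sw c (\<lambda>c1 c2. \<Phi> (a # l' @ [c1 * p1 * h1]) (c2 * p2 * h2)))))))"
    by (intro sm_cong, unfold dg_snoc, subst sm_swap[of "sw H h"], subst sm_swap[of _ "dg _ _"])
      (simp add: mult.assoc)
  also have "\<dots> = Sw u (\<lambda>a b. sm (al hs) (\<lambda>l p. sm (dg b l) (\<lambda>l' c. Sw (c * p) (\<lambda>p1 p2. Sw h (\<lambda>h1 h2.
      \<Phi> (a # l' @ [p1 * h1]) (p2 * h2))))))"
  proof (intro sm_cong)
    fix a b l p l' c
    have "Sw p (\<lambda>p1 p2. Sw h (\<lambda>h1 h2. Sw c (\<lambda>c1 c2. \<Phi> (a # l' @ [c1 * p1 * h1]) (c2 * p2 * h2))))
      = Sw c (\<lambda>c1 c2. Sw p (\<lambda>p1 p2. Sw h (\<lambda>h1 h2. \<Phi> (a # l' @ [c1 * p1 * h1]) (c2 * p2 * h2))))"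
      by (subst sm_swap[of "sw H h"]) (rule sm_swap)
    also have "\<dots> = Sw (c * p) (\<lambda>p1 p2. Sw h (\<lambda>h1 h2. \<Phi> (a # l' @ [p1 * h1]) (p2 * h2)))"
      by (rule Sw_mult[symmetric]) (intro L)+
    finally show "Sw p (\<lambda>p1 p2. Sw h (\<lambda>h1 h2. Sw c (\<lambda>c1 c2. \<Phi> (a # l' @ [c1 * p1 * h1]) (c2 * p2 * h2))))
      = Sw (c * p) (\<lambda>p1 p2. Sw h (\<lambda>h1 h2. \<Phi> (a # l' @ [p1 * h1]) (p2 * h2)))" .
  qed
  finally show ?case by simp
qed

text \<open>The element p is the product of the last components of all factors. Splitting it is
  therefore, by coassociativity, the same as splitting every factor first and collecting the second
  components, as \<open>pl\<close> does. This is how the coaction defining the coinvariants enters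
  the comparison with \<open>tc\<close>.\<close>

lemma al_comodule:
  "(\<And>b. mlin sH (\<lambda>l a. \<Psi> l a b)) \<Longrightarrow> (\<And>l a. lin sH (*) (\<lambda>b. \<Psi> l a b)) \<Longrightarrow>
    sm (al hs) (\<lambda>l p. Sw p (\<lambda>a b. \<Psi> l a b)) = sm (pl hs) (\<lambda>l0 q. sm (al l0) (\<lambda>l p. \<Psi> l p q))"
proof (induction hs arbitrary: \<Psi>)
  case Nil
  note L = forms atoms[OF Nil(1)] lin_comp[OF _ Nil(2)]
  show ?case by (simp, rule Sw_1) (intro L)+
next
  case (Cons u hs)
  note L = forms atoms[OF Cons.prems(1)] lin_comp[OF _ Cons.prems(2)]
  \<comment> \<open>All dependence on the three components of the head u is collected in a trilinear
    expression, to which coassociativity applies.\<close>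
  define \<Omega> where "\<Omega> = (\<lambda>a b c. sm (pl hs) (\<lambda>l0 q. sm (al l0) (\<lambda>l p. sm (dg b l) (\<lambda>l' d. \<Psi> (a # l') (d * p) (c * q)))))"
  have c: "Sw (c * p) (\<lambda>x y. \<Psi> (a # l') x y) = Sw p (\<lambda>p1 p2. Sw c (\<lambda>c1 c2. \<Psi> (a # l') (c1 * p1) (c2 * p2)))"
    for a l' c p
    by (subst sm_swap, rule Sw_mult) (intro L)+
  have d: "sm (dg b l) (\<lambda>l' c. Sw p (\<lambda>p1 p2. Sw c (\<lambda>c1 c2. \<Psi> (a # l') (c1 * p1) (c2 * p2))))
    = Sw p (\<lambda>p1 p2. Sw b (\<lambda>b1 b2. sm (dg b1 l) (\<lambda>l' c. \<Psi> (a # l') (c * p1) (b2 * p2))))" for a b l p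
    by (subst sm_swap, intro sm_cong, rule dg_comodule) (intro L)+
  have "sm (al (u # hs)) (\<lambda>l p. Sw p (\<lambda>a b. \<Psi> l a b))
    = Sw u (\<lambda>a b. sm (al hs) (\<lambda>l p. Sw p (\<lambda>p1 p2. Sw b (\<lambda>b1 b2. sm (dg b1 l) (\<lambda>l' c. \<Psi> (a # l') (c * p1) (b2 * p2))))))"
    by (simp add: c d)
  also have "\<dots> = Sw u (\<lambda>a b. sm (pl hs) (\<lambda>l0 q. sm (al l0) (\<lambda>l p. Sw b (\<lambda>b1 b2. sm (dg b1 l) (\<lambda>l' c. \<Psi> (a # l') (c * p) (b2 * q))))))"
    by (intro sm_cong Cons.IH) (intro L)+
  also have "\<dots> = Sw u (\<lambda>a b. Sw b (\<lambda>b1 b2. \<Omega> a b1 b2))"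
    unfolding \<Omega>_def by (intro sm_cong, subst sm_swap[of "al _"], subst sm_swap[of "pl _"]) simp
  also have "\<dots> = Sw u (\<lambda>a b. Sw a (\<lambda>a1 a2. \<Omega> a1 a2 b))"
    by (rule Sw_coassoc[symmetric]) (unfold \<Omega>_def, (intro L)+)
  also have "\<dots> = sm (pl (u # hs)) (\<lambda>l0 q. sm (al l0) (\<lambda>l p. \<Psi> l p q))"
    unfolding \<Omega>_def by (simp, intro sm_cong, subst sm_swap[of "sw H _" "pl _"]) simp
  finally show ?case .
qed

lemma al_counit0:
  "mlin sH \<Phi> \<Longrightarrow> sm (al (g # hs)) (\<lambda>l p. \<epsilon> (hd l) * \<Phi> (tl l) p)
    = sm (al hs) (\<lambda>l p. sm (dg g l) (\<lambda>l' c. \<Phi> l' (c * p)))"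
proof -
  assume \<Phi>: "mlin sH \<Phi>"
  note L = forms atoms[OF \<Phi>]
  have "sm (al (g # hs)) (\<lambda>l p. \<epsilon> (hd l) * \<Phi> (tl l) p)
    = Sw g (\<lambda>a b. \<epsilon> a * sm (al hs) (\<lambda>l p. sm (dg b l) (\<lambda>l' c. \<Phi> l' (c * p))))"
    by (simp add: sm_scale)
  also have "\<dots> = sm (al hs) (\<lambda>l p. sm (dg g l) (\<lambda>l' c. \<Phi> l' (c * p)))"
    by (rule Sw_counit(1)) (intro L)
  finally show ?thesis .
qed

text \<open>This is why the face of index 0 corresponds to the counit on the first factor: once its
  first component is removed, g acts diagonally on the factors coming from \<open>h # hs\<close>,
  and multiplicativity of the comultiplication turns these into the factors of
  \<open>g * h # hs\<close>.\<close>

lemma al_mult: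
  assumes \<Phi>: "mlin sH \<Phi>"
  shows "sm (al (g # h # hs)) (\<lambda>l p. \<epsilon> (hd l) * \<Phi> (tl l) p) = sm (al (g * h # hs)) \<Phi>"
proof -
  note L = forms atoms[OF \<Phi>]
  have 1: "sm (dg b l) (\<lambda>l' c. sm (dg v l') (\<lambda>l'' d. \<Phi> (x # l'') (d * (c * p))))
    = sm (dg (v * b) l) (\<lambda>l' c. \<Phi> (x # l') (c * p))" for b l v x p
    using dg_dg[of "\<lambda>l c. \<Phi> (x # l) (c * p)" b l v] by (simp add: L mult.assoc)
  have "sm (al (g # h # hs)) (\<lambda>l p. \<epsilon> (hd l) * \<Phi> (tl l) p)
    = Sw h (\<lambda>a b. sm (al hs) (\<lambda>l p. sm (dg b l) (\<lambda>l' c. Sw g (\<lambda>u v. sm (dg v l') (\<lambda>l'' d. \<Phi> (u * a # l'') (d * (c * p)))))))"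
    unfolding al_counit0[OF \<Phi>] by simp
  also have "\<dots> = Sw h (\<lambda>a b. Sw g (\<lambda>u v. sm (al hs) (\<lambda>l p. sm (dg (v * b) l) (\<lambda>l' c. \<Phi> (u * a # l') (c * p)))))"
    by (intro sm_cong, subst sm_swap[of "dg _ _"], subst sm_swap[of "al _"]) (simp add: 1)
  also have "\<dots> = Sw g (\<lambda>u v. Sw h (\<lambda>a b. sm (al hs) (\<lambda>l p. sm (dg (v * b) l) (\<lambda>l' c. \<Phi> (u * a # l') (c * p)))))"
    by (rule sm_swap)
  also have "\<dots> = Sw (g * h) (\<lambda>a b. sm (al hs) (\<lambda>l p. sm (dg b l) (\<lambda>l' c. \<Phi> (a # l') (c * p))))"
    by (rule Sw_mult[symmetric]) (intro L)+
  finally show ?thesis by simp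
qed

lemma al_unit:
  assumes \<Phi>: "mlin sH \<Phi>"
  shows "sm (al (1 # hs)) \<Phi> = sm (al hs) (\<lambda>l p. \<Phi> (1 # l) p)"
proof -
  note L = forms atoms[OF \<Phi>]
  have "sm (al (1 # hs)) \<Phi> = Sw 1 (\<lambda>u v. sm (al hs) (\<lambda>l p. sm (dg v l) (\<lambda>l' c. \<Phi> (u # l') (c * p))))" by simp
  also have "\<dots> = sm (al hs) (\<lambda>l p. sm (dg 1 l) (\<lambda>l' c. \<Phi> (1 # l') (c * p)))" by (rule Sw_1) (intro L)+
  also have "\<dots> = sm (al hs) (\<lambda>l p. \<Phi> (1 # l) (1 * p))" by (intro sm_cong dg_1) (intro L)
  finally show ?thesis by simp
qed

text \<open>A unit in second position contributes nothing of its own, so the first two factors are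
  the components h1 and h2, which is the coproduct of a single first factor.\<close>

lemma al_degen:
  assumes \<Phi>: "mlin sH \<Phi>"
  shows "sm (al (h # 1 # hs)) \<Phi> = sm (al (h # hs)) (\<lambda>l p. Sw (hd l) (\<lambda>a b. \<Phi> (a # b # tl l) p))"
proof -
  note L = forms atoms[OF \<Phi>]
  have "sm (al (h # 1 # hs)) \<Phi> = Sw h (\<lambda>a b. sm (al (1 # hs)) (\<lambda>l p. sm (dg b l) (\<lambda>l' c. \<Phi> (a # l') (c * p))))"
    by simp
  also have "\<dots> = Sw h (\<lambda>a b. sm (al hs) (\<lambda>l p. sm (dg b (1 # l)) (\<lambda>l' c. \<Phi> (a # l') (c * p))))"
    by (intro sm_cong al_unit) (intro L)
  also have "\<dots> = Sw h (\<lambda>a b. Sw b (\<lambda>u v. sm (al hs) (\<lambda>l p. sm (dg v l) (\<lambda>l' c. \<Phi> (a # u # l') (c * p)))))"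
    by (intro sm_cong, subst sm_swap) simp
  also have "\<dots> = Sw h (\<lambda>a b. Sw a (\<lambda>u v. sm (al hs) (\<lambda>l p. sm (dg b l) (\<lambda>l' c. \<Phi> (u # v # l') (c * p)))))"
    by (rule Sw_coassoc[symmetric]) (intro L)+
  also have "\<dots> = sm (al (h # hs)) (\<lambda>l p. Sw (hd l) (\<lambda>a b. \<Phi> (a # b # tl l) p))"
    by (simp, intro sm_cong, subst sm_swap, intro sm_cong, rule sm_swap)
  finally show ?thesis .
qed

lemma pl_snoc: "sm (pl (hs @ [h])) \<Phi> = sm (pl hs) (\<lambda>l q. Sw h (\<lambda>a b. \<Phi> (l @ [a]) (q * b)))"
  by (induction hs arbitrary: \<Phi>) (simp_all add: mult.assoc)

lemma pl_counit: "mlin s F \<Longrightarrow> sm (pl hs) (\<lambda>l q. \<epsilon> q * F l x) = F hs x"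
proof (induction hs arbitrary: F)
  case (Cons u hs)
  note L = forms atoms[OF Cons.prems]
  have "sm (pl (u # hs)) (\<lambda>l q. \<epsilon> q * F l x) = Sw u (\<lambda>a b. \<epsilon> b * sm (pl hs) (\<lambda>l q. \<epsilon> q * F (a # l) x))"
    by (simp add: mult.assoc sm_scale)
  also have "\<dots> = Sw u (\<lambda>a b. \<epsilon> b * F (a # hs) x)"
    by (intro sm_cong arg_cong[of _ _ "(*) _"] Cons.IH) (intro L)
  also have "\<dots> = F (u # hs) x" by (rule Sw_counit(2)) (intro L)
  finally show ?case .
qed simp

lemma pl_comodule:
  "(\<And>b. mlin sH (\<lambda>l a. \<Psi> l a b)) \<Longrightarrow> (\<And>l a. lin sH (*) (\<lambda>b. \<Psi> l a b)) \<Longrightarrow>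
    sm (pl hs) (\<lambda>l q. sm (pl l) (\<lambda>l' q'. \<Psi> l' q' q)) = sm (pl hs) (\<lambda>l q. Sw q (\<lambda>a b. \<Psi> l a b))"
proof (induction hs arbitrary: \<Psi>)
  case Nil
  note L = forms atoms[OF Nil(1)] lin_comp[OF _ Nil(2)]
  show ?case by (simp, rule Sw_1[symmetric]) (intro L)+
next
  case (Cons u hs)
  note L = forms atoms[OF Cons.prems(1)] lin_comp[OF _ Cons.prems(2)]
  define \<Omega> where "\<Omega> = (\<lambda>a b c. sm (pl hs) (\<lambda>l q. sm (pl l) (\<lambda>l' q'. \<Psi> (a # l') (b * q') (c * q))))"
  have "sm (pl (u # hs)) (\<lambda>l q. sm (pl l) (\<lambda>l' q'. \<Psi> l' q' q)) = Sw u (\<lambda>a b. Sw a (\<lambda>c d. \<Omega> c d b))"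
    unfolding \<Omega>_def by (simp, intro sm_cong, rule sm_swap)
  also have "\<dots> = Sw u (\<lambda>a b. Sw b (\<lambda>c d. \<Omega> a c d))"
    by (rule Sw_coassoc) (unfold \<Omega>_def, (intro L)+)
  also have "\<dots> = Sw u (\<lambda>a b. Sw b (\<lambda>c d. sm (pl hs) (\<lambda>l q. Sw q (\<lambda>x y. \<Psi> (a # l) (c * x) (d * y)))))"
    unfolding \<Omega>_def by (intro sm_cong Cons.IH) (intro L)+
  also have "\<dots> = sm (pl (u # hs)) (\<lambda>l q. Sw q (\<lambda>a b. \<Psi> l a b))"
    by (simp, intro sm_cong, subst sm_swap, intro sm_cong, rule Sw_mult[symmetric]) (intro L)+
  finally show ?case .
qed

text \<open>The cancellation behind both the inverse of \<open>ta\<close> and the inverse of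
  \<alpha>: after reassociation the last two of three components meet through the antipode and the
  counit removes them.\<close>

lemma Sw_antipode_middle:
  assumes "\<And>b. lin sH (*) (\<lambda>a. f a b)" and "\<And>a. lin sH (*) (\<lambda>b. f a b)"
  shows "Sw h (\<lambda>a b. Sw a (\<lambda>c d. f c (S d * b))) = f h 1"
    and "Sw h (\<lambda>a b. Sw a (\<lambda>c d. f c (d * S b))) = f h 1"
proof -
  note L = forms lin_comp[OF _ assms(1)] lin_comp[OF _ assms(2)]
  have "Sw h (\<lambda>a b. Sw a (\<lambda>c d. f c (S d * b))) = Sw h (\<lambda>a b. Sw b (\<lambda>c d. f a (S c * d)))"
    by (rule Sw_coassoc) (intro L)+
  also have "\<dots> = Sw h (\<lambda>a b. \<epsilon> b * f a 1)" by (intro sm_cong Sw_antipode) (intro L)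
  also have "\<dots> = f h 1" by (rule Sw_counit) (intro L)
  finally show "Sw h (\<lambda>a b. Sw a (\<lambda>c d. f c (S d * b))) = f h 1" .
  have "Sw h (\<lambda>a b. Sw a (\<lambda>c d. f c (d * S b))) = Sw h (\<lambda>a b. Sw b (\<lambda>c d. f a (c * S d)))"
    by (rule Sw_coassoc) (intro L)+
  also have "\<dots> = Sw h (\<lambda>a b. \<epsilon> b * f a 1)" by (intro sm_cong Sw_antipode) (intro L)
  also have "\<dots> = f h 1" by (rule Sw_counit) (intro L)
  finally show "Sw h (\<lambda>a b. Sw a (\<lambda>c d. f c (d * S b))) = f h 1" .
qed

text \<open>Neighbouring entries cancel: the entry that receives h1 u passes on S(h2 u2) = S(u2)
  S(h2), which meets h3. Only the first factor still sees h. Since the recursion step of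
  \<open>al\<close> is a diagonal action, this is the reason why \<open>bq\<close> inverts
  \<open>al\<close>.\<close>

lemma bq_dg:
  "mlin sH \<Phi> \<Longrightarrow> sm (dg h hs) (\<lambda>l d. sm (bq c l) (\<lambda>l' e. \<Phi> l' (e * d))) = sm (bq (c * h) hs) \<Phi>"
proof (induction hs arbitrary: \<Phi> c h)
  case (Cons u hs)
  note L = forms atoms[OF Cons.prems]
  define f where "f = (\<lambda>x g1 g2 y. sm (bq (S g2 * y) hs) (\<lambda>l. \<Phi> (c * (x * g1) # l)))"
  have IH: "sm (dg b hs) (\<lambda>l d. sm (bq (S v) l) (\<lambda>l' e. \<Phi> (x # l') (e * d))) = sm (bq (S v * b) hs) (\<lambda>l. \<Phi> (x # l))"
    for b v x by (rule Cons.IH) (intro L)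
  have "sm (dg h (u # hs)) (\<lambda>l d. sm (bq c l) (\<lambda>l' e. \<Phi> l' (e * d)))
    = Sw h (\<lambda>a b. Sw (a * u) (\<lambda>x v. sm (bq (S v * b) hs) (\<lambda>l. \<Phi> (c * x # l))))"
    by (simp, intro sm_cong, subst sm_swap, intro sm_cong, rule IH)
  also have "\<dots> = Sw h (\<lambda>a b. Sw a (\<lambda>x v. Sw u (\<lambda>g1 g2. f x g1 g2 (S v * b))))"
    unfolding f_def
    by (intro sm_cong, subst Sw_mult) ((intro L)+, simp add: antipode_mult mult.assoc)
  also have "\<dots> = Sw u (\<lambda>g1 g2. f h g1 g2 1)"
    by (rule Sw_antipode_middle(1)) (unfold f_def, (intro L)+)
  finally show ?case by (simp add: f_def mult.assoc)
qed simp

lemma bq_al: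
  "mlin sH \<Phi> \<Longrightarrow> sm (al hs) (\<lambda>l p. sm (bq 1 l) (\<lambda>l' e. \<Phi> l' (e * p))) = \<Phi> hs 1"
proof (induction hs arbitrary: \<Phi>)
  case (Cons u hs)
  note L = forms atoms[OF Cons.prems]
  have 1: "sm (dg b l) (\<lambda>l' c. sm (bq v l') (\<lambda>l'' e. \<Phi> (x # l'') (e * (c * p))))
     = sm (bq (v * b) l) (\<lambda>l' e. \<Phi> (x # l') (e * p))" for b l v x p
    using bq_dg[of "\<lambda>l e. \<Phi> (x # l) (e * p)" b l v] by (simp add: L mult.assoc)
  have "sm (al (u # hs)) (\<lambda>l p. sm (bq 1 l) (\<lambda>l' e. \<Phi> l' (e * p)))
    = sm (al hs) (\<lambda>l p. Sw u (\<lambda>a b. Sw a (\<lambda>x v. sm (bq (S v * b) l) (\<lambda>l' e. \<Phi> (x # l') (e * p)))))"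
    by (simp, subst sm_swap, intro sm_cong, subst sm_swap, intro sm_cong, rule 1)
  also have "\<dots> = sm (al hs) (\<lambda>l p. sm (bq 1 l) (\<lambda>l' e. \<Phi> (u # l') (e * p)))"
    by (intro sm_cong Sw_antipode_middle(1)[where f = "\<lambda>x y. sm (bq y _) (\<lambda>l' e. \<Phi> (x # l') (e * _))"]) (intro L)+
  also have "\<dots> = \<Phi> (u # hs) 1" by (rule Cons.IH) (intro L)
  finally show ?case .
qed simp

text \<open>The carried factor c changes along the recursion, so the identity at c = 1 is proved for
  all c. The induction hypothesis at \<open>S b\<close> followed by \<open>dg_dg\<close> leaves
  \<open>v * S b\<close>, which cancels.\<close>

lemma al_bq:
  "mlin sH \<Phi> \<Longrightarrow> sm (bq c hs) (\<lambda>l p. sm (al l) (\<lambda>l' e. \<Phi> l' (e * p))) = sm (dg c hs) \<Phi>"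
proof (induction hs arbitrary: \<Phi> c)
  case (Cons u hs)
  note L = forms atoms[OF Cons.prems]
  define f where "f = (\<lambda>c1 c2 x y. sm (dg (c2 * y) hs) (\<lambda>l. \<Phi> (c1 * x # l)))"
  have 1: "sm (bq (S b) hs) (\<lambda>l p. sm (al l) (\<lambda>l' e. sm (dg v l') (\<lambda>l'' d. \<Phi> (x # l'') (d * e * p))))
     = sm (dg (v * S b) hs) (\<lambda>l. \<Phi> (x # l))" for b v x
  proof -
    have "sm (bq (S b) hs) (\<lambda>l p. sm (al l) (\<lambda>l' e. sm (dg v l') (\<lambda>l'' d. \<Phi> (x # l'') (d * (e * p)))))
      = sm (dg (S b) hs) (\<lambda>l' e. sm (dg v l') (\<lambda>l'' d. \<Phi> (x # l'') (d * e)))"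
      by (rule Cons.IH) (intro L)
    also have "\<dots> = sm (dg (v * S b) hs) (\<lambda>l. \<Phi> (x # l))" by (rule dg_dg) (intro L)
    finally show ?thesis by (simp add: mult.assoc)
  qed
  have "sm (bq c (u # hs)) (\<lambda>l p. sm (al l) (\<lambda>l' e. \<Phi> l' (e * p)))
    = Sw u (\<lambda>a b. Sw (c * a) (\<lambda>x v. sm (dg (v * S b) hs) (\<lambda>l. \<Phi> (x # l))))"
    by (simp, intro sm_cong, subst sm_swap, intro sm_cong, rule 1)
  also have "\<dots> = Sw u (\<lambda>a b. Sw a (\<lambda>x v. Sw c (\<lambda>c1 c2. f c1 c2 x (v * S b))))"
    unfolding f_def
    by (intro sm_cong, subst Sw_mult) ((intro L)+, subst sm_swap, simp add: mult.assoc)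
  also have "\<dots> = Sw c (\<lambda>c1 c2. f c1 c2 u 1)"
    by (rule Sw_antipode_middle(2)) (unfold f_def, (intro L)+)
  finally show ?case by (simp add: f_def)
qed simp

end


section \<open>Forms on tensor spaces\<close>

lemma sum_list_map_concat: "(\<Sum>x\<leftarrow>concat xss. f x) = (\<Sum>xs\<leftarrow>xss. \<Sum>x\<leftarrow>xs. f x)"
  for f :: "'a \<Rightarrow> 'b::monoid_add"
  by (induction xss) auto

locale ayd_module = hopf_bij H for H :: "('k::field, 'h::ring_1) hopf_data" +
  fixes M :: "('k, 'h, 'x::ab_group_add) hmod_data"
  assumes ayd: "anti_yetter_drinfeld H M" and stable: "stable_hmodule H M"
begin

abbreviation "sX \<equiv> xscale M"
abbreviation "ac \<equiv> act M"
abbreviation "Cs x \<equiv> sm (csw H M x)"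

lemma vs_X: "vector_space sX"
  using ayd by (auto simp: anti_yetter_drinfeld_def left_hmodule_def bilin_def Vector_Spaces.linear_iff)

lemma lin_act:
  "lin t sH g \<Longrightarrow> lin t sX (\<lambda>a. ac (g a) x)"
  "lin t sX g' \<Longrightarrow> lin t sX (\<lambda>a. ac h (g' a))"
  using ayd
  by (auto simp: anti_yetter_drinfeld_def left_hmodule_def bilin_def Vector_Spaces.linear_iff lin_def)

lemma act_mult: "ac (g * h) x = ac g (ac h x)" and act_1 [simp]: "ac 1 x = x"
  using ayd by (simp_all add: anti_yetter_drinfeld_def left_hmodule_def)

lemma coact_in: "coact M x \<in> tens_space sH sX"
  using ayd by (simp add: anti_yetter_drinfeld_def left_hcomodule_def)

lemma Cs_eval: "bil sH sX f \<Longrightarrow> Cs x f = coact M x f"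
  unfolding csw_def by (rule tens_rep_eval[OF coact_in vs_H vs_X])

lemma lin_Cs:
  assumes "lin s sX g" and "\<And>b. lin sH (*) (\<lambda>a. f a b)" and "\<And>a. lin sX (*) (\<lambda>b. f a b)"
  shows "lin s (*) (\<lambda>a. Cs (g a) f)"
  using ayd assms
  by (auto simp: Cs_eval bil_def anti_yetter_drinfeld_def left_hcomodule_def Vector_Spaces.linear_iff
      lin_def fscale_def)

lemma Cs_coassoc:
  assumes "\<And>b c. lin sH (*) (\<lambda>a. f a b c)" and "\<And>a c. lin sH (*) (\<lambda>b. f a b c)"
    and "\<And>a b. lin sX (*) (\<lambda>c. f a b c)"
  shows "Cs x (\<lambda>y x0. Sw y (\<lambda>a b. f a b x0)) = Cs x (\<lambda>y x0. Cs x0 (\<lambda>z x1. f y z x1))"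
proof -
  have b: "bil sH sX (f a)" for a using assms by (intro bilI)
  let ?L = "concat (map (\<lambda>(y, x0). map (\<lambda>(a, b). (a, (b, x0))) (sw H y)) (csw H M x))"
  let ?R = "concat (map (\<lambda>(y, x0). map (\<lambda>(z, x1). (y, (z, x1))) (csw H M x0)) (csw H M x))"
  have "sm ?L (\<lambda>a t. (xtens H M (fst t) (snd t)) (f a)) = sm ?R (\<lambda>a t. (xtens H M (fst t) (snd t)) (f a))"
  proof (rule eval_tens_tensor[OF vs_H tens_space_subspace, where f = "\<lambda>a t. a" and f' = "\<lambda>a t. a"
        and \<Phi> = f and g = "\<lambda>a t. xtens H M (fst t) (snd t)" and g' = "\<lambda>a t. xtens H M (fst t) (snd t)"])
    show "sm ?L (\<lambda>a t. tens sH fscale a (xtens H M (fst t) (snd t)))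
        = sm ?R (\<lambda>a t. tens sH fscale a (xtens H M (fst t) (snd t)))"
      using ayd by (simp add: anti_yetter_drinfeld_def left_hcomodule_def sm_def[symmetric])
    show "lin sH (*) (\<lambda>a. t (f a))" if "t \<in> tens_space sH sX" for t
      using that vs_H vs_X b assms(1) by (rule tens_space_eval_lin)
  qed (rule tens_in)+
  then show ?thesis by (simp add: tens_eval[OF b vs_H vs_X])
qed

lemma Cs_counit:
  assumes "lin sX (*) f"
  shows "Cs x (\<lambda>y x0. \<epsilon> y * f x0) = f x"
proof -
  have "f (Cs x (\<lambda>y x0. sX (\<epsilon> y) x0)) = f x"
    using ayd by (simp add: anti_yetter_drinfeld_def left_hcomodule_def sm_def)
  then show ?thesis by (simp add: lin_sm_arg[OF assms] lin_scale[OF assms])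
qed

lemma Cs_stable:
  assumes "lin sX (*) f"
  shows "Cs x (\<lambda>y x0. f (ac (S y) x0)) = f x"
proof -
  have "f (Cs x (\<lambda>y x0. ac (S y) x0)) = f x"
    using stable by (simp add: stable_hmodule_def sm_def)
  then show ?thesis by (simp add: lin_sm_arg[OF assms])
qed

lemma Cs_act:
  assumes "\<And>b. lin sH (*) (\<lambda>a. f a b)" and "\<And>a. lin sX (*) (\<lambda>b. f a b)"
  shows "Cs (ac h x) f = Sw h (\<lambda>a b. Sw b (\<lambda>c d. Cs x (\<lambda>y x0. f (a * y * S' d) (ac c x0))))"
proof -
  have b: "bil sH sX f" using assms by (rule bilI)
  have "coact M (ac h x) = (\<Sum>s\<leftarrow>sws H 2 h. Cs x (\<lambda>y x0. xtens H M (s ! 0 * y * S' (s ! 2)) (ac (s ! 1) x0)))"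
    using ayd by (simp add: anti_yetter_drinfeld_def sm_def)
  also have "\<dots> = Sw h (\<lambda>a b. Sw b (\<lambda>c d. Cs x (\<lambda>y x0. xtens H M (a * y * S' d) (ac c x0))))"
    by (simp add: numeral_2_eq_2 sm_def case_prod_unfold sum_list_map_concat o_def)
  finally show ?thesis
    by (simp add: Cs_eval[OF b] sm_apply tens_eval[OF b vs_H vs_X])
qed

lemma lin_zero: "lin s (*) (\<lambda>a. 0 :: 'k)"
  by (simp add: lin_def)

lemma mlin_Cs:
  assumes "lin s sX g" "\<And>p. mlin sX (\<lambda>l q. F l p q)" "\<And>l q. lin sH (*) (\<lambda>p. F l p q)"
  shows "mlin s (\<lambda>l c. Cs (g c) (F l))"
  using assms by (auto simp: mlin_def intro!: lin_Cs lin_sm)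

lemma mlin_zero: "mlin s (\<lambda>l x. 0 :: 'k)"
  by (simp add: mlin_def lin_zero)

lemmas xforms = forms lin_antipode_inv lin_act lin_Cs lin_zero mlin_Cs mlin_zero

lemma mlin_snocI:
  assumes "lin s (*) (F [])" and "\<And>h. mlin s (\<lambda>l. F (l @ [h]))" and "\<And>l x. lin sH (*) (\<lambda>h. F (l @ [h]) x)"
  shows "mlin s F"
  unfolding mlin_def
proof (intro conjI allI)
  show "lin s (*) (F hs)" for hs using assms by (cases hs rule: rev_cases) (auto simp: mlin_def)
  show "lin sH (*) (\<lambda>h. F (as @ h # bs) x)" for as bs x
  proof (cases bs rule: rev_cases)
    case Nil
    then show ?thesis using assms(3) by simp
  next
    case (snoc cs c)
    then show ?thesis using assms(2)[of c] unfolding mlin_def by (auto dest!: conjunct2 spec[of _ as] spec[of _ cs])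
  qed
qed

text \<open>Indexed by the number of H-factors and not by the degree: the proof works with n factors
  next to the n + 1 factors of degree n.\<close>

definition sp :: "nat \<Rightarrow> ('k, 'h, 'x) tensor set" where
  "sp m = tensor_space sH sX m"

abbreviation "pt \<equiv> ptens H M"

lemma mlin_multilin: "mlin sX F \<Longrightarrow> multilin sH sX (*) m F"
  unfolding multilin_def
  by (auto simp: lin_linear[OF vs_X vector_space_mult] lin_linear[OF vs_H vector_space_mult] mlin_def
      upd_conv_take_nth_drop)

lemma multilin_cut:
  assumes "multilin sH sX (*) m F"
  shows "mlin sX (\<lambda>l x. if length l = m then F l x else 0)"
  unfolding mlin_def
proof (intro conjI allI)
  show "lin sX (*) (\<lambda>x. if length l = m then F l x else 0)" for l
    using assms by (cases "length l = m") (simp_all add: multilin_def lin_zero linear_lin)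
  show "lin sH (*) (\<lambda>h. if length (as @ h # bs) = m then F (as @ h # bs) x else 0)" for as bs x
  proof (cases "length (as @ 0 # bs) = m")
    case True
    then have "lin sH (*) (\<lambda>h. F ((as @ 0 # bs)[length as := h]) x)"
      using assms unfolding multilin_def
      by (metis add_diff_cancel_left' length_Cons length_append less_add_Suc1 linear_lin add_Suc_right)
    then show ?thesis using True by simp
  qed (simp add: lin_zero)
qed

lemma sp_rep:
  assumes "u \<in> sp m"
  obtains ps where "\<And>l x. (l, x) \<in> set ps \<Longrightarrow> length l = m" "u = sm ps pt"
    "\<And>F. multilin sH sX (*) m F \<Longrightarrow> u F = sm ps F" "\<And>F. \<not> multilin sH sX (*) m F \<Longrightarrow> u F = 0"
proof -
  obtain ps where ps: "\<forall>(l, x)\<in>set ps. length l = m" "u = (\<Sum>(l, x)\<leftarrow>ps. pt l x)"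
    using ex_tensor_rep[OF vs_H vs_X] assms unfolding sp_def by blast
  then have u: "u = sm ps pt" by (simp add: sm_def)
  show thesis
  proof (rule that[OF _ u])
    show "u F = sm ps F" if "multilin sH sX (*) m F" for F
      unfolding u sm_apply by (rule sm_cong) (use that ps in \<open>auto simp: pure_tensor_def\<close>)
    show "u F = 0" if "\<not> multilin sH sX (*) m F" for F
    proof -
      have "sm ps (\<lambda>l x. pt l x F) = sm ps (\<lambda>l x. 0)"
        by (rule sm_cong) (use that ps in \<open>auto simp: pure_tensor_def\<close>)
      then show ?thesis unfolding u sm_apply by simp
    qed
  qed (use ps in auto)
qed

lemma sp_cong:
  assumes "u \<in> sp m" "mlin sX F" "mlin sX G" "\<And>l x. length l = m \<Longrightarrow> F l x = G l x"
  shows "u F = u G"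
proof -
  obtain ps where ps: "\<And>l x. (l, x) \<in> set ps \<Longrightarrow> length l = m"
    "\<And>F. multilin sH sX (*) m F \<Longrightarrow> u F = sm ps F" using sp_rep[OF assms(1)] by metis
  show ?thesis unfolding ps(2)[OF mlin_multilin[OF assms(2)]] ps(2)[OF mlin_multilin[OF assms(3)]]
    by (rule sm_cong) (use ps assms in auto)
qed

text \<open>A tensor vanishes on functions that are not multilinear in its own length, and it sees a
  form only on lists of that length; cutting off a form elsewhere thus changes nothing and makes it
  multilinear in all lengths.\<close>

lemma sp_eqI:
  assumes u: "u \<in> sp m" and v: "v \<in> sp m" and eq: "\<And>F. mlin sX F \<Longrightarrow> u F = v F"
  shows "u = v"
proof
  fix F
  show "u F = v F"
  proof (cases "multilin sH sX (*) m F")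
    case True
    let ?G = "\<lambda>l x. if length l = m then F l x else 0"
    have *: "w F = w ?G" if w: "w \<in> sp m" for w
    proof -
      obtain ps where ps: "\<And>l x. (l, x) \<in> set ps \<Longrightarrow> length l = m"
        "\<And>F. multilin sH sX (*) m F \<Longrightarrow> w F = sm ps F" using sp_rep[OF w] by metis
      show ?thesis unfolding ps(2)[OF True] ps(2)[OF mlin_multilin[OF multilin_cut[OF True]]]
        by (rule sm_cong) (use ps in auto)
    qed
    show ?thesis using *[OF u] *[OF v] eq[OF multilin_cut[OF True]] by simp
  next
    case False
    then show ?thesis using sp_rep[OF u] sp_rep[OF v] by metis
  qed
qed

interpretation fs: vector_space "fscale :: 'k \<Rightarrow> ('i \<Rightarrow> 'k) \<Rightarrow> _"
  by (rule vector_space_fscale)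

lemma sp_subspace: "module.subspace fscale (sp m)"
  unfolding sp_def tensor_space_def by (rule fs.subspace_span)

lemma sp_add: "u \<in> sp m \<Longrightarrow> v \<in> sp m \<Longrightarrow> u + v \<in> sp m"
  and sp_scale: "u \<in> sp m \<Longrightarrow> fscale c u \<in> sp m"
  and sp_0: "0 \<in> sp m" and sp_diff: "u \<in> sp m \<Longrightarrow> v \<in> sp m \<Longrightarrow> u - v \<in> sp m"
  using sp_subspace by (auto simp: fs.subspace_def intro: fs.subspace_diff)

lemma pt_in: "length l = m \<Longrightarrow> pt l x \<in> sp m"
  unfolding sp_def tensor_space_def by (rule fs.span_base) auto

lemma sm_in_sp: "(\<And>a b. (a, b) \<in> set L \<Longrightarrow> f a b \<in> sp m) \<Longrightarrow> sm L f \<in> sp m"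
  by (induction L) (auto simp: sp_0 intro!: sp_add)

lemma pt_apply: "mlin sX F \<Longrightarrow> pt l x F = F l x"
  by (simp add: pure_tensor_def mlin_multilin)

lemma sp_apply_lin:
  assumes u: "u \<in> sp m" and F: "\<And>q. mlin sX (\<lambda>l x. G l x q)" and q: "\<And>l x. lin t (*) (G l x)"
  shows "lin t (*) (\<lambda>q. u (\<lambda>l x. G l x q))"
proof -
  obtain ps where ps: "\<And>F. multilin sH sX (*) m F \<Longrightarrow> u F = sm ps F" using sp_rep[OF u] by metis
  show ?thesis unfolding ps[OF mlin_multilin[OF F]] by (intro lin_sm q)
qed

text \<open>
  \<open>P\<close> is the transpose of \<open>f\<close>; it only matters on lists of length \<open>m\<close> and takes junk values on others.
\<close>

definition dual :: "nat \<Rightarrow> nat \<Rightarrow> (('k, 'h, 'x) tensor \<Rightarrow> ('k, 'h, 'x) tensor) \<Rightarrow>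
    (('h list \<Rightarrow> 'x \<Rightarrow> 'k) \<Rightarrow> 'h list \<Rightarrow> 'x \<Rightarrow> 'k) \<Rightarrow> bool" where
  "dual m n f P \<longleftrightarrow> (\<forall>F. mlin sX F \<longrightarrow> mlin sX (P F)) \<and>
     (\<forall>u\<in>sp m. f u \<in> sp n \<and> (\<forall>F. mlin sX F \<longrightarrow> f u F = u (P F)))"

lemma dualD:
  assumes "dual m n f P"
  shows "mlin sX F \<Longrightarrow> mlin sX (P F)" "u \<in> sp m \<Longrightarrow> f u \<in> sp n"
    "u \<in> sp m \<Longrightarrow> mlin sX F \<Longrightarrow> f u F = u (P F)"
  using assms by (auto simp: dual_def)

text \<open>Independence of the chosen expression comes from the multilinearity of
  \<open>P F\<close>: evaluated on F, the sum over the expression becomes the value of u on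
  \<open>P F\<close>.\<close>

lemma dual_ext:
  assumes P: "\<And>F. mlin sX F \<Longrightarrow> mlin sX (P F)"
    and G: "\<And>hs x. length hs = m \<Longrightarrow> G hs x \<in> sp n"
    and GP: "\<And>F hs x. mlin sX F \<Longrightarrow> length hs = m \<Longrightarrow> G hs x F = P F hs x"
  shows "dual m n (lin_ext sH sX m G) P"
  unfolding dual_def
proof (intro conjI allI impI ballI)
  fix u assume u: "u \<in> sp m"
  let ?ps = "tensor_rep sH sX m u"
  have ps: "\<And>l x. (l, x) \<in> set ?ps \<Longrightarrow> length l = m" "u = sm ?ps pt"
    using tensor_rep[OF vs_H vs_X u[unfolded sp_def]] by (auto simp: sm_def)
  have e: "lin_ext sH sX m G u = sm ?ps G" by (simp add: lin_ext_def sm_def)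
  show "lin_ext sH sX m G u \<in> sp n" unfolding e by (rule sm_in_sp) (auto intro!: G dest: ps(1))
  fix F :: "'h list \<Rightarrow> 'x \<Rightarrow> 'k" assume F: "mlin sX F"
  have "lin_ext sH sX m G u F = sm ?ps (P F)"
    unfolding e sm_apply by (rule sm_cong) (use ps(1) GP[OF F] in blast)
  also have "\<dots> = sm ?ps (\<lambda>l x. pt l x (P F))" by (simp add: pt_apply P F)
  also have "\<dots> = u (P F)" by (subst (2) ps(2)) (simp add: sm_apply)
  finally show "lin_ext sH sX m G u F = u (P F)" .
qed (rule P)

text \<open>Having a transpose already implies linearity, because forms separate tensors.\<close>

lemma dual_add: "dual m n f P \<Longrightarrow> u \<in> sp m \<Longrightarrow> v \<in> sp m \<Longrightarrow> f (u + v) = f u + f v"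
  by (rule sp_eqI[of _ n]) (auto simp: dualD sp_add)

lemma fscale_apply: "fscale c u i = c * u i"
  by (simp add: fscale_def)

lemma dual_scale: "dual m n f P \<Longrightarrow> u \<in> sp m \<Longrightarrow> f (fscale c u) = fscale c (f u)"
  by (rule sp_eqI[of _ n]) (simp_all add: dualD sp_scale fscale_apply)

lemma dual_comp: "dual m n f P \<Longrightarrow> dual n r g Q \<Longrightarrow> dual m r (\<lambda>u. g (f u)) (\<lambda>F. P (Q F))"
  by (auto simp: dual_def)

lemma dual_id: "dual m m (\<lambda>u. u) (\<lambda>F. F)"
  by (auto simp: dual_def)

lemma dual_eqI:
  assumes "dual m n f P" "dual m n g Q" "u \<in> sp m"
    and "\<And>F l x. mlin sX F \<Longrightarrow> length l = m \<Longrightarrow> P F l x = Q F l x"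
  shows "f u = g u"
proof (rule sp_eqI[of _ n])
  fix F :: "'h list \<Rightarrow> 'x \<Rightarrow> 'k" assume "mlin sX F"
  then show "f u F = g u F" using assms by (simp add: dualD) (rule sp_cong, auto simp: dualD)
qed (use assms dualD in auto)

lemma dual_0: "dual m n f P \<Longrightarrow> f 0 = 0"
  using dual_add[OF _ sp_0 sp_0, of m n f P] by simp

lemma dual_diff:
  assumes "dual m n f P" "u \<in> sp m" "v \<in> sp m"
  shows "f (u - v) = f u - f v"
  using dual_add[OF assms(1), of "u - v" v] assms by (simp add: sp_diff)

text \<open>The transpose of the right coaction: G stands for a form on the tensor product of the
  tensor space with H, and is pulled back along \<open>rho\<close>.\<close>

definition coact_form :: "('h list \<Rightarrow> 'x \<Rightarrow> 'h \<Rightarrow> 'k) \<Rightarrow> 'h list \<Rightarrow> 'x \<Rightarrow> 'k" where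
  "coact_form G hs x = sm (pl hs) (\<lambda>l q. Cs x (\<lambda>y x0. G l x0 (q * S y)))"

definition tri :: "('h list \<Rightarrow> 'x \<Rightarrow> 'h \<Rightarrow> 'k) \<Rightarrow> bool" where
  "tri G \<longleftrightarrow> (\<forall>q. mlin sX (\<lambda>l x. G l x q)) \<and> (\<forall>l x. lin sH (*) (G l x))"

lemma triD: "tri G \<Longrightarrow> mlin sX (\<lambda>l x. G l x q)" "tri G \<Longrightarrow> lin sH (*) (\<lambda>q. G l x q)"
  by (simp_all add: tri_def)

lemma tri_last: "tri G \<Longrightarrow> lin s sH g \<Longrightarrow> lin s (*) (\<lambda>a. G l x (g a))"
  by (rule lin_comp[OF _ triD(2)])

lemma tri_mlin:
  assumes "tri G" "lin t sH g"
  shows "mlin t (\<lambda>l c. G l x (g c))" "mlin t (\<lambda>l c. G (p # l) x (g c))" "mlin t (\<lambda>l c. G (l @ [p]) x (g c))"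
  using tri_last[OF assms] mlin_slot[OF triD(1)[OF assms(1)] lin_ident]
    mlin_slot[OF triD(1)[OF assms(1)] lin_ident, of "p # as" for as]
  by (auto simp: mlin_def)

lemmas tri_atoms = atoms[OF triD(1)] tri_last tri_mlin

lemma mlin_coact_form: "tri G \<Longrightarrow> mlin sX (coact_form G)"
proof -
  assume G: "tri G"
  note L = xforms tri_atoms[OF G]
  show "mlin sX (coact_form G)"
    unfolding coact_form_def by (intro L)
qed

lemma rho_apply:
  assumes u: "u \<in> sp (n + 1)" and ps: "ps = tensor_rep sH sX (n + 1) u"
  shows "rho H M n u \<beta> = sm ps (\<lambda>hs x. sm (pl hs) (\<lambda>l q. Cs x (\<lambda>y x0. tens fscale sH (pt l x0) (q * S y) \<beta>)))"
proof -
  have pl: "map (\<lambda>ps. (map fst ps, prod_list (map snd ps))) (product_lists (map (sw H) hs)) = pl hs" for hs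
  proof (induction hs)
    case (Cons a hs)
    show ?case by (simp add: map_concat o_def case_prod_unfold Cons[symmetric])
  qed simp
  have "rho H M n u = sm ps (\<lambda>hs x. sm (pl hs) (\<lambda>l q. Cs x (\<lambda>y x0. tens fscale sH (pt l x0) (q * S y))))"
    unfolding rho_def lin_ext_def ps sm_def[symmetric]
    by (simp add: pl[symmetric] sm_def o_def)
  then show ?thesis by (simp add: sm_apply)
qed

text \<open>Coinvariance is an equation of tensors and hence tested by bilinear forms on tensors and
  H. Restriction to pure tensors, cut off at length n + 1, turns such a form into one satisfying
  \<open>tri\<close>; conversely a \<open>tri\<close> form is evaluated on a tensor after a
  projection onto the tensor space, which makes it bilinear on the whole function space.\<close>

lemma coinvariants_iff:
  "u \<in> coinvariants H M n \<longleftrightarrow>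
    u \<in> sp (n + 1) \<and> (\<forall>G. tri G \<longrightarrow> u (coact_form G) = u (\<lambda>l x. G l x 1))"
proof (cases "u \<in> sp (n + 1)")
  case True
  note u = True
  define ps where "ps = tensor_rep sH sX (n + 1) u"
  have ps: "\<And>l x. (l, x) \<in> set ps \<Longrightarrow> length l = n + 1" "u = sm ps pt"
    using tensor_rep[OF vs_H vs_X u[unfolded sp_def]] by (auto simp: ps_def sm_def)
  have ev: "u F = sm ps F" if "mlin sX F" for F
    by (subst ps(2)) (simp add: sm_apply pt_apply that)
  have len: "length l = length hs" if "(l, q) \<in> set (pl hs)" for l hs q
    using that by (induction hs arbitrary: l q) auto
  have len': "length l' = n + 1" if "(l, x) \<in> set ps" "(l', q) \<in> set (pl l)" for l x l' q
    using len[OF that(2)] ps(1)[OF that(1)] by simp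
  have "rho H M n u = tens fscale sH u 1" if *: "\<And>G. tri G \<Longrightarrow> u (coact_form G) = u (\<lambda>l x. G l x 1)"
  proof
    fix \<beta> :: "('k, 'h, 'x) tensor \<Rightarrow> 'h \<Rightarrow> 'k"
    show "rho H M n u \<beta> = tens fscale sH u 1 \<beta>"
    proof (cases "bil fscale sH \<beta>")
      case True
      define G where "G = (\<lambda>l x q. if length l = n + 1 then \<beta> (pt l x) q else 0)"
      have \<beta>1: "lin fscale (*) (\<lambda>t. \<beta> t q)" and \<beta>2: "lin sH (*) (\<beta> t)" for t q
        using True by (auto simp: bil_def)
      have lp: "multilin sH sX fscale (n + 1) pt" by (rule multilin_pure_tensor[OF vs_H vs_X])
      have "multilin sH sX (*) (n + 1) (\<lambda>l x. \<beta> (pt l x) q)" for q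
      proof -
        have l: "Vector_Spaces.linear fscale (*) (\<lambda>t. \<beta> t q)"
          using \<beta>1 by (simp add: lin_linear[OF vector_space_fscale vector_space_mult])
        show ?thesis using lp unfolding multilin_def by (auto intro: linear_compose'[OF _ l])
      qed
      then have "mlin sX (\<lambda>l x. G l x q)" for q unfolding G_def by (rule multilin_cut)
      moreover have "lin sH (*) (G l x)" for l x
        by (cases "length l = n + 1") (simp_all add: G_def lin_zero \<beta>2)
      ultimately have G: "tri G" by (simp add: tri_def)
      have "rho H M n u \<beta> = sm ps (coact_form G)"
        unfolding rho_apply[OF u ps_def] coact_form_def G_def
        by (intro sm_cong) (auto simp: tens_eval[OF True vector_space_fscale vs_H] dest: len')
      also have "\<dots> = u (coact_form G)" by (rule ev[symmetric]) (rule mlin_coact_form[OF G])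
      also have "\<dots> = u (\<lambda>l x. G l x 1)" by (rule *[OF G])
      also have "\<dots> = sm ps (\<lambda>l x. G l x 1)" by (rule ev) (rule triD[OF G])
      also have "\<dots> = sm ps (\<lambda>l x. \<beta> (pt l x) 1)" by (rule sm_cong) (auto simp: G_def dest: ps(1))
      also have "\<dots> = \<beta> u 1" by (subst ps(2)) (rule lin_sm_arg[OF \<beta>1, symmetric])
      finally show ?thesis by (simp add: tens_eval[OF True vector_space_fscale vs_H])
    next
      case False
      then have "\<not> bilin fscale sH (*) \<beta>" by (simp add: bilin_bil vector_space_fscale vs_H)
      then show ?thesis by (simp add: rho_apply[OF u ps_def] tens_def)
    qed
  qed
  moreover have "u (coact_form G) = u (\<lambda>l x. G l x 1)"
    if *: "rho H M n u = tens fscale sH u 1" and G: "tri G" for G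
  proof -
    obtain p where p: "Vector_Spaces.linear fscale fscale p" "\<And>v. p v \<in> sp (n + 1)" "\<And>v. v \<in> sp (n + 1) \<Longrightarrow> p v = v"
      using exists_projection[OF vector_space_fscale sp_subspace[of "n + 1"]] by blast
    define \<beta> where "\<beta> = (\<lambda>t q. p t (\<lambda>l x. G l x q))"
    have \<beta>: "bil fscale sH \<beta>"
      unfolding bil_def \<beta>_def
      using sp_apply_lin[OF p(2) triD(1)[OF G] triD(2)[OF G]] linear_lin[OF p(1)] by (auto simp: lin_def fscale_def)
    have e: "\<beta> (pt l x) q = G l x q" if "length l = n + 1" for l x q
      using that by (simp add: \<beta>_def p(3) pt_in pt_apply triD[OF G])
    have "u (coact_form G) = sm ps (coact_form G)" by (rule ev) (rule mlin_coact_form[OF G])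
    also have "\<dots> = rho H M n u \<beta>"
      unfolding rho_apply[OF u ps_def] coact_form_def
      by (intro sm_cong) (auto simp: tens_eval[OF \<beta> vector_space_fscale vs_H] e dest: len')
    also have "\<dots> = u (\<lambda>l x. G l x 1)"
      unfolding * tens_eval[OF \<beta> vector_space_fscale vs_H] by (simp add: \<beta>_def p(3)[OF u])
    finally show ?thesis .
  qed
  ultimately show ?thesis using u by (auto simp: coinvariants_def T_space_def sp_def)
qed (simp add: coinvariants_def T_space_def sp_def)

end


section \<open>The algebra side\<close>

text \<open>Recursive, so that the simplicial identities follow by induction on the position;
  \<open>mult_at_eq\<close> connects it with the expression that defines the faces.\<close>

fun mult_at :: "nat \<Rightarrow> 'a::times list \<Rightarrow> 'a list" where
  "mult_at 0 (a # b # l) = a * b # l"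
| "mult_at (Suc j) (a # l) = a # mult_at j l"
| "mult_at _ l = l"

fun insert_one :: "nat \<Rightarrow> 'a::one list \<Rightarrow> 'a list" where
  "insert_one 0 (a # l) = a # 1 # l"
| "insert_one (Suc j) (a # l) = a # insert_one j l"
| "insert_one _ [] = []"

lemma mult_at_eq:
  "Suc j < length l \<Longrightarrow> mult_at j l = take j l @ [l ! j * l ! (j + 1)] @ drop (j + 2) l"
  by (induction j l rule: mult_at.induct) auto

lemma length_mult_at [simp]: "Suc j < length l \<Longrightarrow> length (mult_at j l) = length l - 1"
  by (simp add: mult_at_eq)

lemma length_insert_one [simp]: "j < length l \<Longrightarrow> length (insert_one j l) = Suc (length l)"
  by (induction j l rule: insert_one.induct) auto

lemma mult_at_append: "Suc j < length l \<Longrightarrow> mult_at j (l @ r) = mult_at j l @ r"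
  by (induction j l rule: mult_at.induct) auto

lemma mult_at_append2: "mult_at (length l) (l @ a # b # r) = l @ a * b # r"
  by (induction l) auto

lemma insert_one_append: "j < length l \<Longrightarrow> insert_one j (l @ r) = insert_one j l @ r"
  by (induction j l rule: insert_one.induct) auto

lemma insert_one_append2: "insert_one (length l) (l @ a # r) = l @ a # 1 # r"
  by (induction l) auto

lemma mult_at_mult_at:
  fixes l :: "'a::semigroup_mult list"
  shows "i < j \<Longrightarrow> Suc j < length l \<Longrightarrow> mult_at i (mult_at j l) = mult_at (j - 1) (mult_at i l)"
proof (induction i arbitrary: j l)
  case 0
  then show ?case by (cases j; cases "j - 1"; cases l; cases "tl l"; cases "tl (tl l)") (auto simp: mult.assoc)
next
  case (Suc i)
  then show ?case by (cases j; cases "j - 1"; cases l) auto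
qed

lemma insert_one_insert_one:
  "i \<le> j \<Longrightarrow> j < length l \<Longrightarrow> insert_one i (insert_one j l) = insert_one (Suc j) (insert_one i l)"
proof (induction i arbitrary: j l)
  case 0
  then show ?case by (cases j; cases l) auto
next
  case (Suc i)
  then show ?case by (cases j; cases l) auto
qed

lemma mult_at_insert_one_less:
  "i < j \<Longrightarrow> j < length l \<Longrightarrow> mult_at i (insert_one j l) = insert_one (j - 1) (mult_at i l)"
proof (induction i arbitrary: j l)
  case 0
  then show ?case by (cases j; cases l; cases "j - 1"; cases "tl l") auto
next
  case (Suc i)
  then show ?case by (cases j; cases l; cases "j - 1") auto
qed

lemma mult_at_insert_one_eq:
  fixes l :: "'a::monoid_mult list"
  shows "j < length l \<Longrightarrow> mult_at j (insert_one j l) = l"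
  by (induction j l rule: insert_one.induct) auto

lemma mult_at_insert_one_Suc:
  fixes l :: "'a::monoid_mult list"
  shows "Suc j < length l \<Longrightarrow> mult_at (Suc j) (insert_one j l) = l"
proof (induction j l rule: insert_one.induct)
  case (1 a l)
  then show ?case by (cases l) auto
qed auto

lemma mult_at_insert_one_greater:
  "Suc j < i \<Longrightarrow> i < length l \<Longrightarrow> mult_at i (insert_one j l) = insert_one j (mult_at (i - 1) l)"
proof (induction j arbitrary: i l)
  case 0
  then show ?case by (cases i; cases l; cases "i - 1") auto
next
  case (Suc j)
  then show ?case by (cases i; cases l; cases "i - 1") auto
qed


context ayd_module
begin

text \<open>Here and in the next definitions the default 0 on lists that are too short keeps the
  transpose multilinear in all lengths.\<close>

definition tau_form :: "('h list \<Rightarrow> 'x \<Rightarrow> 'k) \<Rightarrow> 'h list \<Rightarrow> 'x \<Rightarrow> 'k" where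
  "tau_form F = (\<lambda>l x. if l = [] then 0 else Sw (last l) (\<lambda>a b. F (a # butlast l) (ac b x)))"

definition tau_inv_form :: "('h list \<Rightarrow> 'x \<Rightarrow> 'k) \<Rightarrow> 'h list \<Rightarrow> 'x \<Rightarrow> 'k" where
  "tau_inv_form F = (\<lambda>l x. if l = [] then 0 else Sw (hd l) (\<lambda>a b. F (tl l @ [a]) (ac (S b) x)))"

definition mult_form :: "nat \<Rightarrow> ('h list \<Rightarrow> 'x \<Rightarrow> 'k) \<Rightarrow> 'h list \<Rightarrow> 'x \<Rightarrow> 'k" where
  "mult_form j F = (\<lambda>l x. if Suc j < length l then F (mult_at j l) x else 0)"

definition insert_form :: "nat \<Rightarrow> ('h list \<Rightarrow> 'x \<Rightarrow> 'k) \<Rightarrow> 'h list \<Rightarrow> 'x \<Rightarrow> 'k" where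
  "insert_form j F = (\<lambda>l x. if j < length l then F (insert_one j l) x else 0)"

lemma tau_form_snoc [simp]: "tau_form F (l @ [h]) = (\<lambda>x. Sw h (\<lambda>a b. F (a # l) (ac b x)))"
  by (simp add: tau_form_def)

lemma tau_form_Nil [simp]: "tau_form F [] = (\<lambda>x. 0)"
  by (simp add: tau_form_def)

lemma tau_inv_form_simps [simp]:
  "tau_inv_form F (h # l) = (\<lambda>x. Sw h (\<lambda>a b. F (l @ [a]) (ac (S b) x)))"
  "tau_inv_form F [] = (\<lambda>x. 0)"
  by (simp_all add: tau_inv_form_def)

lemma mlin_tau_form: "mlin sX F \<Longrightarrow> mlin sX (tau_form F)"
proof -
  assume F: "mlin sX F"
  note L = xforms atoms[OF F]
  show ?thesis by (rule mlin_snocI; simp; (intro L)?)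
qed

lemma mlin_tau_inv_form: "mlin sX F \<Longrightarrow> mlin sX (tau_inv_form F)"
proof -
  assume F: "mlin sX F"
  note L = xforms atoms[OF F]
  show ?thesis by (rule mlin_Cons; simp; (intro L)?)
qed

lemma mlin_mult_form: "mlin sX F \<Longrightarrow> mlin sX (mult_form j F)"
proof (induction j arbitrary: F)
  case 0
  note L = xforms atoms[OF 0]
  have "mlin sX (\<lambda>l. mult_form 0 F (h # l))" for h
    by (rule mlin_Cons; simp add: mult_form_def; (intro L)?)
  moreover have "lin sH (*) (\<lambda>h. mult_form 0 F (h # l) x)" for l x
    by (cases l; simp add: mult_form_def; (intro L)?)
  moreover have "lin sX (*) (mult_form 0 F [])" by (simp add: mult_form_def lin_zero)
  ultimately show ?case by (rule mlin_Cons[rotated])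
next
  case (Suc j)
  note L = xforms atoms[OF Suc.prems]
  have e: "(\<lambda>l. mult_form (Suc j) F (h # l)) = mult_form j (\<lambda>l. F (h # l))" for h
    by (auto simp: mult_form_def fun_eq_iff)
  have "mlin sX (\<lambda>l. mult_form (Suc j) F (h # l))" for h
    unfolding e by (rule Suc.IH) (intro L)
  moreover have "lin sH (*) (\<lambda>h. mult_form (Suc j) F (h # l) x)" for l x
    by (cases "Suc j < length l"; simp add: mult_form_def; (intro L)?)
  moreover have "lin sX (*) (mult_form (Suc j) F [])" by (simp add: mult_form_def lin_zero)
  ultimately show ?case by (rule mlin_Cons[rotated])
qed

lemma mlin_insert_form: "mlin sX F \<Longrightarrow> mlin sX (insert_form j F)"
proof (induction j arbitrary: F)
  case 0
  note L = xforms atoms[OF 0]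
  show ?case by (rule mlin_Cons; simp add: insert_form_def; (intro L)?)
next
  case (Suc j)
  note L = xforms atoms[OF Suc.prems]
  have e: "(\<lambda>l. insert_form (Suc j) F (h # l)) = insert_form j (\<lambda>l. F (h # l))" for h
    by (auto simp: insert_form_def fun_eq_iff)
  have "mlin sX (\<lambda>l. insert_form (Suc j) F (h # l))" for h
    unfolding e by (rule Suc.IH) (intro L)
  moreover have "lin sH (*) (\<lambda>h. insert_form (Suc j) F (h # l) x)" for l x
    by (cases "j < length l"; simp add: insert_form_def; (intro L)?)
  moreover have "lin sX (*) (insert_form (Suc j) F [])" by (simp add: insert_form_def lin_zero)
  ultimately show ?case by (rule mlin_Cons[rotated])
qed

text \<open>The first factor returns to the end and S of its second component undoes the action on
  X. This replaces the \<open>inv_into\<close> through which the degeneracies are defined.\<close>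

definition tau_a_inv :: "nat \<Rightarrow> ('k, 'h, 'x) tensor \<Rightarrow> ('k, 'h, 'x) tensor" where
  "tau_a_inv n = lin_ext sH sX (n + 1) (\<lambda>hs x. Sw (hd hs) (\<lambda>a b. pt (tl hs @ [a]) (ac (S b) x)))"

lemma dual_cong:
  assumes "dual m n f P" "\<And>F. mlin sX F \<Longrightarrow> mlin sX (Q F)"
    and "\<And>F l x. mlin sX F \<Longrightarrow> length l = m \<Longrightarrow> P F l x = Q F l x"
  shows "dual m n f Q"
proof -
  have "u (P F) = u (Q F)" if "u \<in> sp m" "mlin sX F" for u F
    by (rule sp_cong[OF that(1)]) (use assms that dualD(1)[OF assms(1)] in auto)
  then show ?thesis using assms(1,2) by (auto simp: dual_def)
qed

lemma dual_fun_cong: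
  "dual m n f P \<Longrightarrow> (\<And>u. u \<in> sp m \<Longrightarrow> f u = g u) \<Longrightarrow> dual m n g P"
  unfolding dual_def by auto

lemma dual_tau_a: "dual (Suc n) (Suc n) (tau_a H M n) tau_form"
  unfolding tau_a_def sm_def[symmetric] Suc_eq_plus1[symmetric]
  by (rule dual_ext[OF mlin_tau_form]) (auto simp: tau_form_def sm_apply pt_apply intro!: sm_in_sp pt_in)

lemma dual_tau_a_inv: "dual (Suc n) (Suc n) (tau_a_inv n) tau_inv_form"
  unfolding tau_a_inv_def Suc_eq_plus1[symmetric]
  by (rule dual_ext[OF mlin_tau_inv_form]) (auto simp: tau_inv_form_def sm_apply pt_apply intro!: sm_in_sp pt_in)

lemma tau_form_inverse:
  assumes F: "mlin sX F" and l: "l \<noteq> []"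
  shows "tau_inv_form (tau_form F) l x = F l x" "tau_form (tau_inv_form F) l x = F l x"
proof -
  note L = xforms atoms[OF F]
  obtain g gs where g: "l = g # gs" using l by (cases l) auto
  have "tau_inv_form (tau_form F) l x = Sw g (\<lambda>a b. Sw a (\<lambda>c d. F (c # gs) (ac (d * S b) x)))"
    by (simp add: g act_mult)
  also have "\<dots> = F (g # gs) (ac 1 x)"
    by (rule Sw_antipode_middle(2)[where f = "\<lambda>c w. F (c # gs) (ac w x)"]) (intro L)+
  finally show "tau_inv_form (tau_form F) l x = F l x" by (simp add: g)
  obtain h hs where h: "l = hs @ [h]" using l by (cases l rule: rev_cases) auto
  have "tau_form (tau_inv_form F) l x = Sw h (\<lambda>a b. Sw a (\<lambda>c d. F (hs @ [c]) (ac (S d * b) x)))"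
    by (simp add: h act_mult)
  also have "\<dots> = F (hs @ [h]) (ac 1 x)"
    by (rule Sw_antipode_middle(1)[where f = "\<lambda>c w. F (hs @ [c]) (ac w x)"]) (intro L)+
  finally show "tau_form (tau_inv_form F) l x = F l x" by (simp add: h)
qed

lemma tau_a_inverse:
  assumes "u \<in> sp (Suc n)"
  shows "tau_a_inv n (tau_a H M n u) = u" "tau_a H M n (tau_a_inv n u) = u"
proof -
  show "tau_a_inv n (tau_a H M n u) = u"
    by (rule dual_eqI[OF dual_comp[OF dual_tau_a dual_tau_a_inv] dual_id assms]) (rule tau_form_inverse, auto)
  show "tau_a H M n (tau_a_inv n u) = u"
    by (rule dual_eqI[OF dual_comp[OF dual_tau_a_inv dual_tau_a] dual_id assms]) (rule tau_form_inverse, auto)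
qed

lemma tau_a_inv_in: "u \<in> sp (Suc n) \<Longrightarrow> tau_a_inv n u \<in> sp (Suc n)"
  by (rule dualD[OF dual_tau_a_inv])

lemma T_space_eq: "T_space H M n = sp (Suc n)"
  by (simp add: T_space_def sp_def)

lemma inv_into_tau_a:
  assumes "u \<in> sp (Suc n)"
  shows "inv_into (T_space H M n) (tau_a H M n) u = tau_a_inv n u"
proof -
  have "inj_on (tau_a H M n) (sp (Suc n))"
    by (rule inj_on_inverseI[of _ "tau_a_inv n"]) (rule tau_a_inverse)
  then show ?thesis
    unfolding T_space_eq by (rule inv_into_f_eq) (rule tau_a_inv_in[OF assms], rule tau_a_inverse[OF assms])
qed

lemma dual_face_a:
  assumes "j < n"
  shows "dual (Suc n) n (face_a H M n j) (mult_form j)"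
  unfolding face_a_def Suc_eq_plus1[symmetric] using assms
  by (intro dual_ext[OF mlin_mult_form]) (auto simp: mult_form_def mult_at_eq pt_apply intro!: pt_in)

text \<open>The last face is the face of index 0 after \<open>ta\<close>, so its transpose is a
  composite.\<close>

lemma dual_face_a_last:
  assumes "1 \<le> n"
  shows "dual (Suc n) n (face_a H M n n) (\<lambda>F. tau_form (mult_form 0 F))"
  unfolding face_a_def sm_def[symmetric] Suc_eq_plus1[symmetric]
proof (intro dual_ext)
  fix F :: "'h list \<Rightarrow> 'x \<Rightarrow> 'k" and hs :: "'h list" and x
  assume F: "mlin sX F" and hs: "length hs = Suc n"
  then obtain a r where r: "hs = a # r" "length r = n" by (cases hs) auto
  moreover obtain l b where "r = l @ [b]" using r assms by (cases r rule: rev_cases) auto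
  ultimately have "hs = a # l @ [b]" by simp
  then show "(if n < n then pt (take n hs @ [hs ! n * hs ! Suc n] @ drop (n + 2) hs) x
        else Sw (last hs) (\<lambda>a b. pt (a * hd hs # tl (butlast hs)) (ac b x))) F = tau_form (mult_form 0 F) hs x"
    using F by (simp add: tau_form_def mult_form_def sm_apply pt_apply)
qed (use assms in \<open>auto simp: mlin_tau_form mlin_mult_form intro!: sm_in_sp pt_in\<close>)

lemma dual_degen0_a: "dual (Suc n) (Suc (Suc n)) (degen0_a H M n) (insert_form 0)"
  unfolding degen0_a_def Suc_eq_plus1[symmetric]
proof (intro dual_ext)
  fix F :: "'h list \<Rightarrow> 'x \<Rightarrow> 'k" and hs :: "'h list" and x
  assume F: "mlin sX F" and hs: "length hs = Suc n"
  then show "pt (hd hs # 1 # tl hs) x F = insert_form 0 F hs x"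
    by (cases hs) (auto simp: insert_form_def pt_apply)
qed (auto simp: mlin_insert_form intro!: pt_in)

lemma degen_a_Suc: "degen_a H M n (Suc j) u
    = tau_a H M (n + 1) (degen_a H M n j (inv_into (T_space H M n) (tau_a H M n) u))"
  unfolding degen_a_def by (subst funpow.simps(2), subst funpow_Suc_right) simp

text \<open>Conjugation by \<open>ta\<close> moves the inserted unit one place to the right. The
  first factor travels to the end and back, and its components acting on X cancel through
  \<open>d * S b\<close>.\<close>

lemma dual_degen_a: "j \<le> n \<Longrightarrow> dual (Suc n) (Suc (Suc n)) (degen_a H M n j) (insert_form j)"
proof (induction j)
  case 0
  have "degen_a H M n 0 = degen0_a H M n" by (simp add: fun_eq_iff degen_a_def)
  then show ?case using dual_degen0_a by simp
next
  case (Suc j)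
  have d: "dual (Suc n) (Suc (Suc n)) (\<lambda>u. tau_a H M (n + 1) (degen_a H M n j (tau_a_inv n u)))
     (\<lambda>F. tau_inv_form (insert_form j (tau_form F)))"
    unfolding Suc_eq_plus1[symmetric]
    using Suc.prems by (intro dual_comp[OF dual_comp[OF dual_tau_a_inv Suc.IH] dual_tau_a]) simp
  have d2: "dual (Suc n) (Suc (Suc n)) (degen_a H M n (Suc j)) (\<lambda>F. tau_inv_form (insert_form j (tau_form F)))"
    by (rule dual_fun_cong[OF d]) (simp add: degen_a_Suc inv_into_tau_a)
  have "dual (Suc n) (Suc (Suc n)) (degen_a H M n (Suc j)) (insert_form (Suc j))"
  proof (rule dual_cong[OF d2 mlin_insert_form])
    fix F :: "'h list \<Rightarrow> 'x \<Rightarrow> 'k" and l :: "'h list" and x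
    assume F: "mlin sX F" and l: "length l = Suc n"
    then obtain g gs where g: "l = g # gs" by (cases l) auto
    have j: "j < length gs" using l Suc.prems g by simp
    note L = xforms atoms[OF F]
    have "tau_inv_form (insert_form j (tau_form F)) l x
       = Sw g (\<lambda>a b. Sw a (\<lambda>c d. F (c # insert_one j gs) (ac (d * S b) x)))"
      using j by (simp add: g insert_form_def insert_one_append act_mult)
    also have "\<dots> = F (g # insert_one j gs) (ac 1 x)"
      by (rule Sw_antipode_middle(2)[where f = "\<lambda>c w. F (c # insert_one j gs) (ac w x)"]) (intro L)+
    finally show "tau_inv_form (insert_form j (tau_form F)) l x = insert_form (Suc j) F l x"
      using j by (simp add: g insert_form_def)
  qed
  then show ?case by simp
qed


section \<open>The para-cyclic identities on the algebra side\<close>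

abbreviation "ta \<equiv> tau_a H M"
abbreviation "da \<equiv> face_a H M"
abbreviation "sa \<equiv> degen_a H M"
abbreviation "CC \<equiv> coinvariants H M"

lemma tau_form_snoc_Cons: "tau_form F (a # l @ [h]) = (\<lambda>x. Sw h (\<lambda>c d. F (c # a # l) (ac d x)))"
  using tau_form_snoc[of F "a # l" h] by simp

lemma face_a_in:
  assumes "j \<le> Suc n" "u \<in> sp (Suc (Suc n))"
  shows "da (Suc n) j u \<in> sp (Suc n)"
proof (cases "j = Suc n")
  case True
  show ?thesis unfolding True by (rule dualD(2)[OF dual_face_a_last assms(2)]) simp
next
  case False
  then show ?thesis using assms by (intro dualD(2)[OF dual_face_a assms(2)]) simp
qed

lemma degen_a_in: "j \<le> n \<Longrightarrow> u \<in> sp (Suc n) \<Longrightarrow> sa n j u \<in> sp (Suc (Suc n))"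
  by (rule dualD[OF dual_degen_a])

lemma tau_a_in: "u \<in> sp (Suc n) \<Longrightarrow> ta n u \<in> sp (Suc n)"
  by (rule dualD[OF dual_tau_a])

lemma face0_tau:
  assumes u: "u \<in> sp (Suc (Suc n))"
  shows "da (Suc n) 0 (ta (Suc n) u) = da (Suc n) (Suc n) u"
  by (rule dual_eqI[OF dual_comp[OF dual_tau_a dual_face_a] dual_face_a_last u]) auto

lemma face_tau:
  assumes j: "j \<le> n" and u: "u \<in> sp (Suc (Suc n))"
  shows "da (Suc n) (Suc j) (ta (Suc n) u) = ta n (da (Suc n) j u)"
proof (cases "j = n")
  case False
  show ?thesis
  proof (rule dual_eqI[OF dual_comp[OF dual_tau_a dual_face_a] dual_comp[OF dual_face_a dual_tau_a] u])
    fix F :: "'h list \<Rightarrow> 'x \<Rightarrow> 'k" and l :: "'h list" and x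
    assume F: "mlin sX F" and l: "length l = Suc (Suc n)"
    then obtain hs h where h: "l = hs @ [h]" "length hs = Suc n" by (cases l rule: rev_cases) auto
    then show "tau_form (mult_form (Suc j) F) l x = mult_form j (tau_form F) l x"
      using j False by (simp add: mult_form_def mult_at_append)
  qed (use j False in auto)
next
  case True
  \<comment> \<open>The face of index n + 1 is the last one and itself contains a rotation, so two
    factors k and h are moved in turn; their components combine into those of \<open>k * h\<close>
    by multiplicativity.\<close>
  show ?thesis unfolding True
  proof (rule dual_eqI[OF dual_comp[OF dual_tau_a dual_face_a_last] dual_comp[OF dual_face_a dual_tau_a] u])
    fix F :: "'h list \<Rightarrow> 'x \<Rightarrow> 'k" and l :: "'h list" and x
    assume F: "mlin sX F" and l: "length l = Suc (Suc n)"
    then obtain hs h where h: "l = hs @ [h]" "length hs = Suc n" by (cases l rule: rev_cases) auto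
    then obtain ks k where k: "hs = ks @ [k]" "length ks = n" by (cases hs rule: rev_cases) auto
    note L = xforms atoms[OF F]
    have "tau_form (tau_form (mult_form 0 F)) (ks @ [k, h]) x
       = Sw h (\<lambda>a b. tau_form (mult_form 0 F) ((a # ks) @ [k]) (ac b x))"
      using tau_form_snoc[of _ "ks @ [k]" h] by simp
    also have "\<dots> = Sw h (\<lambda>a b. Sw k (\<lambda>c d. F (c * a # ks) (ac (d * b) x)))"
      unfolding tau_form_snoc by (simp add: mult_form_def act_mult)
    also have "\<dots> = Sw (k * h) (\<lambda>c d. F (c # ks) (ac d x))"
      by (subst sm_swap, rule Sw_mult[symmetric]) (intro L)+
    also have "\<dots> = mult_form n (tau_form F) (ks @ [k, h]) x"
      using k mult_at_append2[of ks k h "[]"] by (simp add: mult_form_def)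
    finally show "tau_form (tau_form (mult_form 0 F)) l x = mult_form n (tau_form F) l x"
      using h k by simp
  qed auto
qed

lemma degen_tau:
  assumes j: "j < n" and u: "u \<in> sp (Suc n)"
  shows "sa n (Suc j) (ta n u) = ta (Suc n) (sa n j u)"
proof (rule dual_eqI[OF dual_comp[OF dual_tau_a dual_degen_a] dual_comp[OF dual_degen_a dual_tau_a] u])
  fix F :: "'h list \<Rightarrow> 'x \<Rightarrow> 'k" and l :: "'h list" and x
  assume F: "mlin sX F" and l: "length l = Suc n"
  then obtain hs h where h: "l = hs @ [h]" "length hs = n" by (cases l rule: rev_cases) auto
  then show "tau_form (insert_form (Suc j) F) l x = insert_form j (tau_form F) l x"
    using j by (simp add: insert_form_def insert_one_append)
qed (use j in auto)

lemma degen0_tau: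
  assumes u: "u \<in> sp (Suc n)"
  shows "sa n 0 (ta n u) = ta (Suc n) (ta (Suc n) (sa n n u))"
proof (rule dual_eqI[OF dual_comp[OF dual_tau_a dual_degen_a]
      dual_comp[OF dual_comp[OF dual_degen_a dual_tau_a] dual_tau_a] u])
  fix F :: "'h list \<Rightarrow> 'x \<Rightarrow> 'k" and l :: "'h list" and x
  assume F: "mlin sX F" and l: "length l = Suc n"
  then obtain hs h where h: "l = hs @ [h]" "length hs = n" by (cases l rule: rev_cases) auto
  note L = xforms atoms[OF F]
  have "insert_form n (tau_form (tau_form F)) l x = tau_form (tau_form F) ((hs @ [h]) @ [1]) x"
    using h insert_one_append2[of hs h "[]"] by (simp add: insert_form_def)
  also have "\<dots> = Sw 1 (\<lambda>a b. tau_form F ((a # hs) @ [h]) (ac b x))"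
    using tau_form_snoc[of "tau_form F" "hs @ [h]" 1] by simp
  also have "\<dots> = Sw 1 (\<lambda>a b. Sw h (\<lambda>c d. F (c # a # hs) (ac (d * b) x)))"
    by (simp add: tau_form_snoc_Cons act_mult)
  also have "\<dots> = Sw h (\<lambda>c d. F (c # 1 # hs) (ac (d * 1) x))"
    by (rule Sw_1) (intro L)+
  also have "\<dots> = tau_form (insert_form 0 F) l x" by (simp add: h insert_form_def)
  finally show "tau_form (insert_form 0 F) l x = insert_form n (tau_form (tau_form F)) l x" by simp
qed auto

lemma tau_a_inj: "u \<in> sp (Suc n) \<Longrightarrow> v \<in> sp (Suc n) \<Longrightarrow> ta n u = ta n v \<Longrightarrow> u = v"
  by (metis tau_a_inverse(1))

lemma face_face_low:
  assumes ij: "i < j" "j < Suc (Suc n)" and u: "u \<in> sp (Suc (Suc (Suc n)))"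
  shows "da (Suc n) i (da (Suc (Suc n)) j u) = da (Suc n) (j - 1) (da (Suc (Suc n)) i u)"
  by (rule dual_eqI[OF dual_comp[OF dual_face_a dual_face_a] dual_comp[OF dual_face_a dual_face_a] u])
    (use ij in \<open>auto simp: mult_form_def mult_at_mult_at\<close>)

text \<open>Only the inner faces are products at a fixed position. Identities that involve the last
  face are reduced to inner ones by trading it for the face of index 0 after \<open>ta\<close>, and
  by moving \<open>ta\<close> across faces.\<close>

lemma face_face:
  assumes ij: "i < j" "j \<le> Suc (Suc n)" and u: "u \<in> sp (Suc (Suc (Suc n)))"
  shows "da (Suc n) i (da (Suc (Suc n)) j u) = da (Suc n) (j - 1) (da (Suc (Suc n)) i u)"
proof (cases "j = Suc (Suc n)")
  case False
  then show ?thesis using face_face_low ij u by simp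
next
  case j: True
  let ?N = "Suc (Suc n)"
  \<comment> \<open>The case i = 0 comes first, because the case i = n + 1 reduces to it, applied to
    \<open>ta ?N u\<close>.\<close>
  have top0: "da (Suc n) 0 (da ?N ?N v) = da (Suc n) (Suc n) (da ?N 0 v)" if v: "v \<in> sp (Suc ?N)" for v
  proof -
    have "da (Suc n) (Suc n) (da ?N 0 v) = da (Suc n) 0 (ta (Suc n) (da ?N 0 v))"
      by (simp add: face0_tau face_a_in v)
    also have "\<dots> = da (Suc n) 0 (da ?N (Suc 0) (ta ?N v))" by (simp add: face_tau v)
    also have "\<dots> = da (Suc n) 0 (da ?N 0 (ta ?N v))"
      using face_face_low[of 0 1 n "ta ?N v"] by (simp add: tau_a_in v)
    also have "\<dots> = da (Suc n) 0 (da ?N ?N v)" by (simp add: face0_tau v)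
    finally show ?thesis by simp
  qed
  show ?thesis
  proof (cases "i = 0")
    case True
    then show ?thesis using top0[OF u] j by simp
  next
    case False
    have i: "i \<le> Suc n" using ij j by simp
    have "da (Suc n) (Suc n) (da ?N i u) = da (Suc n) 0 (ta (Suc n) (da ?N i u))"
      using i by (simp add: face0_tau face_a_in u)
    also have "\<dots> = da (Suc n) 0 (da ?N (Suc i) (ta ?N u))" using i by (simp add: face_tau u)
    also have "\<dots> = da (Suc n) i (da ?N 0 (ta ?N u))"
    proof (cases "Suc i = ?N")
      case True
      then show ?thesis using top0[OF tau_a_in[OF u]] by simp
    next
      case False
      then show ?thesis using face_face_low[of 0 "Suc i" n "ta ?N u"] i by (simp add: tau_a_in u)
    qed
    also have "\<dots> = da (Suc n) i (da ?N ?N u)" by (simp add: face0_tau u)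
    finally show ?thesis by (simp add: j)
  qed
qed

lemma degen_degen:
  assumes ij: "i \<le> j" "j \<le> n" and u: "u \<in> sp (Suc n)"
  shows "sa (Suc n) i (sa n j u) = sa (Suc n) (Suc j) (sa n i u)"
  by (rule dual_eqI[OF dual_comp[OF dual_degen_a dual_degen_a] dual_comp[OF dual_degen_a dual_degen_a] u])
    (use ij in \<open>auto simp: insert_form_def insert_one_insert_one\<close>)

lemma face_degen_less:
  assumes ij: "i < j" "j \<le> Suc n" and u: "u \<in> sp (Suc (Suc n))"
  shows "da (Suc (Suc n)) i (sa (Suc n) j u) = sa n (j - 1) (da (Suc n) i u)"
  by (rule dual_eqI[OF dual_comp[OF dual_degen_a dual_face_a] dual_comp[OF dual_face_a dual_degen_a] u])
    (use ij in \<open>auto simp: insert_form_def mult_form_def mult_at_insert_one_less\<close>)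

lemma face_degen_eq:
  assumes j: "j \<le> n" and u: "u \<in> sp (Suc n)"
  shows "da (Suc n) j (sa n j u) = u"
  by (rule dual_eqI[OF dual_comp[OF dual_degen_a dual_face_a] dual_id u])
    (use j in \<open>auto simp: insert_form_def mult_form_def mult_at_insert_one_eq\<close>)

lemma face_degen_Suc:
  assumes j: "j \<le> n" and u: "u \<in> sp (Suc n)"
  shows "da (Suc n) (Suc j) (sa n j u) = u"
proof (cases "j = n")
  case False
  then have j: "j < n" using j by simp
  show ?thesis
    by (rule dual_eqI[OF dual_comp[OF dual_degen_a dual_face_a] dual_id u])
      (use j in \<open>auto simp: insert_form_def mult_form_def mult_at_insert_one_Suc\<close>)
next
  case True
  have s: "sa n n u \<in> sp (Suc (Suc n))" by (rule degen_a_in) (use u in auto)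
  \<comment> \<open>Both sides are compared after applying the injective map \<open>ta n\<close>:
    this turns the last face of the last degeneracy into the face of index 1 of the degeneracy of
    index 0.\<close>
  have "ta n (da (Suc n) (Suc n) (sa n n u)) = ta n (da (Suc n) 0 (ta (Suc n) (sa n n u)))"
    by (simp add: face0_tau s)
  also have "\<dots> = da (Suc n) (Suc 0) (ta (Suc n) (ta (Suc n) (sa n n u)))"
    by (simp add: face_tau tau_a_in s)
  also have "\<dots> = da (Suc n) (Suc 0) (sa n 0 (ta n u))" by (simp add: degen0_tau u)
  also have "\<dots> = ta n u"
  proof (cases "n = 0")
    case True
    \<comment> \<open>Out of degree 1 the face of index 1 is itself the last face, so this identity
      is not an instance of the inner one.\<close>
    have t: "ta 0 u \<in> sp (Suc 0)" using u True tau_a_in by blast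
    show ?thesis unfolding True
    proof (rule dual_eqI[OF dual_comp[OF dual_degen_a dual_face_a_last[of "Suc 0"]] dual_id t])
      fix F :: "'h list \<Rightarrow> 'x \<Rightarrow> 'k" and l :: "'h list" and x
      assume F: "mlin sX F" and l: "length l = Suc 0"
      then obtain h where h: "l = [h]" by (cases l) auto
      note L = xforms atoms[OF F]
      have "insert_form 0 (tau_form (mult_form 0 F)) l x = tau_form (mult_form 0 F) ([h] @ [1]) x"
        by (simp add: insert_form_def h)
      also have "\<dots> = Sw 1 (\<lambda>a b. F [a * h] (ac b x))" unfolding tau_form_snoc by (simp add: mult_form_def)
      also have "\<dots> = F [1 * h] (ac 1 x)" by (rule Sw_1) (intro L)+
      finally show "insert_form 0 (tau_form (mult_form 0 F)) l x = F l x" by (simp add: h)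
    qed auto
  next
    case False
    then have j: "0 < n" by simp
    show ?thesis
      by (rule dual_eqI[OF dual_comp[OF dual_degen_a dual_face_a] dual_id tau_a_in[OF u]])
        (use j in \<open>auto simp: insert_form_def mult_form_def mult_at_insert_one_Suc\<close>)
  qed
  finally show ?thesis unfolding True
    by (rule tau_a_inj[rotated 2]) (rule face_a_in[OF le_refl s], rule u)
qed

lemma face_degen_greater:
  assumes ij: "Suc j < i" "i \<le> Suc (Suc n)" and u: "u \<in> sp (Suc (Suc n))"
  shows "da (Suc (Suc n)) i (sa (Suc n) j u) = sa n j (da (Suc n) (i - 1) u)"
proof (cases "i = Suc (Suc n)")
  case False
  show ?thesis
    by (rule dual_eqI[OF dual_comp[OF dual_degen_a dual_face_a] dual_comp[OF dual_face_a dual_degen_a] u])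
      (use ij False in \<open>auto simp: insert_form_def mult_form_def mult_at_insert_one_greater\<close>)
next
  case True
  have j: "j < Suc n" using ij True by simp
  have "da (Suc (Suc n)) i (sa (Suc n) j u) = da (Suc (Suc n)) 0 (ta (Suc (Suc n)) (sa (Suc n) j u))"
    using j by (simp add: True face0_tau degen_a_in u)
  also have "\<dots> = da (Suc (Suc n)) 0 (sa (Suc n) (Suc j) (ta (Suc n) u))"
    using j by (simp add: degen_tau u)
  also have "\<dots> = sa n j (da (Suc n) 0 (ta (Suc n) u))"
    using j face_degen_less[of 0 "Suc j" n "ta (Suc n) u"] by (simp add: tau_a_in u)
  finally show ?thesis by (simp add: True face0_tau u)
qed


subsection \<open>Coinvariants\<close>

text \<open>A weakening of colinearity of f: the coaction after f may differ from the coaction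
  before f by a transformation of the H-component, encoded in G', as long as that transformation
  fixes the value at 1. For \<open>ta\<close> it is a twisted conjugation.\<close>

lemma coinvariants_mapI:
  assumes f: "dual (Suc n) (Suc m) f P" and u: "u \<in> CC n"
    and G: "\<And>G. tri G \<Longrightarrow> \<exists>G'. tri G' \<and> (\<forall>l x. length l = Suc n \<longrightarrow>
        P (coact_form G) l x = coact_form G' l x \<and> P (\<lambda>l x. G l x 1) l x = G' l x 1)"
  shows "f u \<in> CC m"
proof -
  have u1: "u \<in> sp (Suc n)" and u2: "\<And>G. tri G \<Longrightarrow> u (coact_form G) = u (\<lambda>l x. G l x 1)"
    using u by (auto simp: coinvariants_iff)
  have "f u (coact_form G) = f u (\<lambda>l x. G l x 1)" if tG: "tri G" for G
  proof -
    obtain G' where G': "tri G'" "\<And>l x. length l = Suc n \<Longrightarrow> P (coact_form G) l x = coact_form G' l x"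
       "\<And>l x. length l = Suc n \<Longrightarrow> P (\<lambda>l x. G l x 1) l x = G' l x 1" using G[OF tG] by blast
    have "f u (coact_form G) = u (P (coact_form G))" by (rule dualD(3)[OF f u1 mlin_coact_form[OF tG]])
    also have "\<dots> = u (coact_form G')"
      by (rule sp_cong[OF u1 dualD(1)[OF f] _ G'(2)]) (intro mlin_coact_form tG G' | assumption)+
    also have "\<dots> = u (\<lambda>l x. G' l x 1)" by (rule u2[OF G'(1)])
    also have "\<dots> = u (P (\<lambda>l x. G l x 1))"
      by (rule sp_cong[OF u1 _ dualD(1)[OF f] G'(3)[symmetric]]) (intro triD(1) tG G' | assumption)+
    also have "\<dots> = f u (\<lambda>l x. G l x 1)" by (rule dualD(3)[OF f u1, symmetric]) (rule triD[OF tG])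
    finally show ?thesis .
  qed
  then show ?thesis using dualD(2)[OF f u1] by (simp add: coinvariants_iff)
qed

text \<open>The two bracketings of a fivefold coproduct that arise when the coaction is computed
  after and before \<open>ta\<close>.\<close>

lemma Sw5:
  assumes "\<And>b c d e. lin sH (*) (\<lambda>a. E a b c d e)" "\<And>a c d e. lin sH (*) (\<lambda>b. E a b c d e)"
    "\<And>a b d e. lin sH (*) (\<lambda>c. E a b c d e)" "\<And>a b c e. lin sH (*) (\<lambda>d. E a b c d e)"
    "\<And>a b c d. lin sH (*) (\<lambda>e. E a b c d e)"
  shows "Sw h (\<lambda>u v. Sw u (\<lambda>a b. Sw v (\<lambda>c w. Sw w (\<lambda>d e. E a b c d e))))
    = Sw h (\<lambda>p e. Sw p (\<lambda>a r. Sw r (\<lambda>b s. Sw s (\<lambda>c d. E a b c d e))))"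
proof -
  note L = forms lin_comp[OF _ assms(1)] lin_comp[OF _ assms(2)] lin_comp[OF _ assms(3)]
    lin_comp[OF _ assms(4)] lin_comp[OF _ assms(5)]
  have "Sw h (\<lambda>p e. Sw p (\<lambda>a r. Sw r (\<lambda>b s. Sw s (\<lambda>c d. E a b c d e))))
    = Sw h (\<lambda>a w. Sw w (\<lambda>r e. Sw r (\<lambda>b s. Sw s (\<lambda>c d. E a b c d e))))"
    by (rule Sw_coassoc) (intro L)+
  also have "\<dots> = Sw h (\<lambda>a w. Sw w (\<lambda>b v. Sw v (\<lambda>s e. Sw s (\<lambda>c d. E a b c d e))))"
    by (rule sm_cong, rule Sw_coassoc) (intro L)+
  also have "\<dots> = Sw h (\<lambda>a w. Sw w (\<lambda>b v. Sw v (\<lambda>c z. Sw z (\<lambda>d e. E a b c d e))))"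
    by (rule sm_cong, rule sm_cong, rule Sw_coassoc) (intro L)+
  also have "\<dots> = Sw h (\<lambda>u v. Sw u (\<lambda>a b. Sw v (\<lambda>c w. Sw w (\<lambda>d e. E a b c d e))))"
    by (rule Sw_coassoc[symmetric]) (intro L)+
  finally show ?thesis by simp
qed

lemma tau_a_coinvariants:
  assumes "u \<in> CC n"
  shows "ta n u \<in> CC n"
proof (rule coinvariants_mapI[OF dual_tau_a assms])
  fix G assume G: "tri G"
  note L = xforms tri_atoms[OF G]
  \<comment> \<open>Let h be the last factor with components h1 to h5. The anti-Yetter-Drinfeld
    condition gives the coaction component \<open>h2 l2 S(h3 y S'(h5))\<close>, where l2 comes from
    the other factors; this equals h2 q S(h3) with \<open>q = l2 h5 S(y)\<close>, the component
    before rotation. At q = 1 the factors h2 and S(h3) cancel.\<close>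
  define G' where "G' = (\<lambda>l x q. if l = [] then 0 else
    Sw (last l) (\<lambda>a r. Sw r (\<lambda>b s. Sw s (\<lambda>c d. G (a # butlast l) (ac d x) (b * q * S c)))))"
  have G's: "G' (l @ [h]) x q = Sw h (\<lambda>a r. Sw r (\<lambda>b s. Sw s (\<lambda>c d. G (a # l) (ac d x) (b * q * S c))))"
    for l h x q by (simp add: G'_def)
  have "mlin sX (\<lambda>l x. G' l x q)" for q
    by (rule mlin_snocI; (unfold G's)?; (intro L)?) (simp add: G'_def lin_zero)
  moreover have "lin sH (*) (G' l x)" for l x
    unfolding G'_def by (cases "l = []"; simp; (intro L)?)
  ultimately have tG: "tri G'" by (simp add: tri_def)
  have "tau_form (coact_form G) (l @ [h]) x = coact_form G' (l @ [h]) x" for l h x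
  proof -
    define E where "E = (\<lambda>a b c d e. sm (pl l) (\<lambda>l q. Cs x (\<lambda>y x0. G (a # l) (ac d x0) (b * (q * (e * (S y * S c)))))))"
    have E: "lin sH (*) (\<lambda>a. E a b c d e)" "lin sH (*) (\<lambda>b. E a b c d e)"
      "lin sH (*) (\<lambda>c. E a b c d e)" "lin sH (*) (\<lambda>d. E a b c d e)"
      "lin sH (*) (\<lambda>e. E a b c d e)" for a b c d e
      unfolding E_def by (intro L)+
    have cs: "Cs (ac b x) (\<lambda>y x0. G (a1 # l) x0 (a2 * q * S y))
      = Sw b (\<lambda>b1 r. Sw r (\<lambda>b2 b3. Cs x (\<lambda>y x0. G (a1 # l) (ac b2 x0) (a2 * q * S (b1 * y * S' b3)))))"
      for b l a1 a2 q
      by (rule Cs_act) (intro L)+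
    have "tau_form (coact_form G) (l @ [h]) x = Sw h (\<lambda>a b. Sw a (\<lambda>a1 a2. sm (pl l) (\<lambda>l q.
        Sw b (\<lambda>b1 r. Sw r (\<lambda>b2 b3. Cs x (\<lambda>y x0. G (a1 # l) (ac b2 x0) (a2 * q * S (b1 * y * S' b3))))))))"
      by (simp add: coact_form_def cs)
    also have "\<dots> = Sw h (\<lambda>u v. Sw u (\<lambda>a b. Sw v (\<lambda>c w. Sw w (\<lambda>d e. E a b c d e))))"
      unfolding E_def
      by (intro sm_cong, subst sm_swap, intro sm_cong, subst sm_swap, intro sm_cong)
        (simp add: antipode_mult mult.assoc)
    also have "\<dots> = Sw h (\<lambda>p e. Sw p (\<lambda>a r. Sw r (\<lambda>b s. Sw s (\<lambda>c d. E a b c d e))))"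
      by (rule Sw5) (rule E)+
    also have "\<dots> = coact_form G' (l @ [h]) x"
    proof -
      have "coact_form G' (l @ [h]) x = sm (pl l) (\<lambda>l q. Sw h (\<lambda>p e. Cs x (\<lambda>y x0. Sw p (\<lambda>a r. Sw r (\<lambda>b s.
          Sw s (\<lambda>c d. G (a # l) (ac d x0) (b * (q * (e * (S y * S c))))))))))"
        unfolding coact_form_def pl_snoc G's by (simp add: mult.assoc)
      also have "\<dots> = sm (pl l) (\<lambda>l q. Sw h (\<lambda>p e. Sw p (\<lambda>a r. Sw r (\<lambda>b s.
          Sw s (\<lambda>c d. Cs x (\<lambda>y x0. G (a # l) (ac d x0) (b * (q * (e * (S y * S c))))))))))"
        by (intro sm_cong, subst sm_swap, intro sm_cong, subst sm_swap, intro sm_cong, rule sm_swap)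
      also have "\<dots> = Sw h (\<lambda>p e. Sw p (\<lambda>a r. Sw r (\<lambda>b s. Sw s (\<lambda>c d. E a b c d e))))"
        unfolding E_def
        by (subst sm_swap, intro sm_cong, subst sm_swap, intro sm_cong, subst sm_swap, intro sm_cong, rule sm_swap)
      finally show ?thesis by simp
    qed
    finally show ?thesis .
  qed
  moreover have "tau_form (\<lambda>l x. G l x 1) (l @ [h]) x = G' (l @ [h]) x 1" for l h x
  proof -
    have "Sw r (\<lambda>b s. Sw s (\<lambda>c d. G (a # l) (ac d x) (b * S c))) = G (a # l) (ac r x) 1" for a r
    proof -
      have "Sw r (\<lambda>b s. Sw s (\<lambda>c d. G (a # l) (ac d x) (b * S c))) = Sw r (\<lambda>s d. Sw s (\<lambda>b c. G (a # l) (ac d x) (b * S c)))"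
        by (rule Sw_coassoc[symmetric]) (intro L)+
      also have "\<dots> = Sw r (\<lambda>s d. \<epsilon> s * G (a # l) (ac d x) 1)"
        by (intro sm_cong Sw_antipode) (intro L)
      also have "\<dots> = G (a # l) (ac r x) 1" by (rule Sw_counit) (intro L)
      finally show ?thesis .
    qed
    then show ?thesis by (simp add: G's)
  qed
  ultimately have "tau_form (coact_form G) l x = coact_form G' l x \<and> tau_form (\<lambda>l x. G l x 1) l x = G' l x 1"
    if "length l = Suc n" for l x using that by (cases l rule: rev_cases) auto
  then show "\<exists>G'. tri G' \<and> (\<forall>l x. length l = Suc n \<longrightarrow>
        tau_form (coact_form G) l x = coact_form G' l x \<and> tau_form (\<lambda>l x. G l x 1) l x = G' l x 1)"
    using tG by blast
qed

lemma degen0_coinvariants: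
  assumes "u \<in> CC n"
  shows "sa n 0 u \<in> CC (Suc n)"
proof (rule coinvariants_mapI[OF dual_degen_a assms])
  fix G assume G: "tri G"
  note L = xforms tri_atoms[OF G]
  define G' where "G' = (\<lambda>l x q. insert_form 0 (\<lambda>l x. G l x q) l x)"
  have "lin sH (*) (G' l x)" for l x
    unfolding G'_def insert_form_def by (cases "l = []"; simp; (intro L)?)
  then have tG: "tri G'" by (simp add: tri_def) (simp add: G'_def mlin_insert_form triD[OF G])
  have "insert_form 0 (coact_form G) (h # l) x = coact_form G' (h # l) x" for h l x
  proof -
    have "insert_form 0 (coact_form G) (h # l) x = Sw h (\<lambda>a b. Sw 1 (\<lambda>c d. sm (pl l) (\<lambda>l q.
        Cs x (\<lambda>y x0. G (a # c # l) x0 (b * (d * q) * S y)))))"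
      by (simp add: insert_form_def coact_form_def)
    also have "\<dots> = Sw h (\<lambda>a b. sm (pl l) (\<lambda>l q. Cs x (\<lambda>y x0. G (a # 1 # l) x0 (b * (1 * q) * S y))))"
      by (intro sm_cong Sw_1) (intro L)+
    also have "\<dots> = coact_form G' (h # l) x"
      by (simp add: coact_form_def G'_def insert_form_def)
    finally show ?thesis .
  qed
  then show "\<exists>G'. tri G' \<and> (\<forall>l x. length l = Suc n \<longrightarrow>
        insert_form 0 (coact_form G) l x = coact_form G' l x \<and> insert_form 0 (\<lambda>l x. G l x 1) l x = G' l x 1)"
    using tG by (intro exI[of _ G']) (auto simp: length_Suc_conv G'_def)
qed simp

lemma face0_coinvariants:
  assumes "u \<in> CC (Suc n)"
  shows "da (Suc n) 0 u \<in> CC n"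
proof (rule coinvariants_mapI[OF dual_face_a assms])
  fix G assume G: "tri G"
  note L = xforms tri_atoms[OF G]
  define G' where "G' = (\<lambda>l x q. mult_form 0 (\<lambda>l x. G l x q) l x)"
  have "lin sH (*) (G' l x)" for l x
    unfolding G'_def mult_form_def by (cases "Suc 0 < length l"; simp; (intro L)?)
  then have tG: "tri G'" by (simp add: tri_def) (simp add: G'_def mlin_mult_form triD[OF G])
  have "mult_form 0 (coact_form G) (g # h # l) x = coact_form G' (g # h # l) x" for g h l x
  proof -
    have "mult_form 0 (coact_form G) (g # h # l) x = Sw (g * h) (\<lambda>a b. sm (pl l) (\<lambda>l q.
        Cs x (\<lambda>y x0. G (a # l) x0 (b * q * S y))))"
      by (simp add: mult_form_def coact_form_def)
    also have "\<dots> = Sw g (\<lambda>a b. Sw h (\<lambda>c d. sm (pl l) (\<lambda>l q. Cs x (\<lambda>y x0. G (a * c # l) x0 (b * d * q * S y)))))"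
      by (rule Sw_mult) (intro L)+
    also have "\<dots> = coact_form G' (g # h # l) x"
      by (simp add: coact_form_def G'_def mult_form_def mult.assoc)
    finally show ?thesis .
  qed
  then show "\<exists>G'. tri G' \<and> (\<forall>l x. length l = Suc (Suc n) \<longrightarrow>
        mult_form 0 (coact_form G) l x = coact_form G' l x \<and> mult_form 0 (\<lambda>l x. G l x 1) l x = G' l x 1)"
    using tG by (intro exI[of _ G']) (auto simp: length_Suc_conv G'_def)
qed simp

lemma dual_funpow: "dual m m f P \<Longrightarrow> dual m m (f ^^ j) (P ^^ j)"
proof (induction j)
  case 0
  show ?case using dual_id by (simp add: id_def)
next
  case (Suc j)
  have "dual m m (\<lambda>u. f ((f ^^ j) u)) (\<lambda>F. (P ^^ j) (P F))" using dual_comp[OF Suc.IH Suc.prems] Suc.prems by simp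
  then show ?case by (simp add: o_def funpow_swap1)
qed

text \<open>The prefix \<open>as\<close> is general because each rotation puts the last entry in
  front of the whole list.\<close>

lemma tau_form_iterate:
  "(tau_form ^^ length bs) F (as @ bs) x = sm (pl bs) (\<lambda>l q. F (l @ as) (ac q x))"
proof (induction bs arbitrary: as F)
  case (Cons h bs)
  have "(tau_form ^^ length (h # bs)) F (as @ h # bs) x = (tau_form ^^ length bs) (tau_form F) ((as @ [h]) @ bs) x"
    by (simp add: funpow_swap1)
  also have "\<dots> = sm (pl bs) (\<lambda>l q. tau_form F ((l @ as) @ [h]) (ac q x))"
    unfolding Cons.IH by simp
  also have "\<dots> = sm (pl bs) (\<lambda>l q. Sw h (\<lambda>a b. F (a # l @ as) (ac (b * q) x)))"
    unfolding tau_form_snoc by (simp add: act_mult)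
  also have "\<dots> = sm (pl (h # bs)) (\<lambda>l q. F (l @ as) (ac q x))"
    by (subst sm_swap) simp
  finally show ?case .
qed simp

text \<open>
  The iterate \<open>\<tau>\<^sub>a\<^sup>n\<^sup>+\<^sup>1\<close> replaces \<open>x\<close> by \<open>h\<^sup>0\<^sub>(\<^sub>2\<^sub>) \<dots> h\<^sup>n\<^sub>(\<^sub>2\<^sub>) x\<close>.  Writing \<open>x = S(x\<^sub>(\<^sub>-\<^sub>1\<^sub>)) x\<^sub>(\<^sub>0\<^sub>)\<close> makes the coaction appear.
\<close>

lemma tau_a_order:
  assumes u: "u \<in> CC n"
  shows "(ta n ^^ Suc n) u = u"
proof -
  have u1: "u \<in> sp (Suc n)" and u2: "\<And>G. tri G \<Longrightarrow> u (coact_form G) = u (\<lambda>l x. G l x 1)"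
    using u by (auto simp: coinvariants_iff)
  note d = dual_funpow[OF dual_tau_a[of n], of "Suc n"]
  show ?thesis
  proof (rule sp_eqI[OF dualD(2)[OF d u1] u1])
    fix F :: "'h list \<Rightarrow> 'x \<Rightarrow> 'k" assume F: "mlin sX F"
    note L = xforms atoms[OF F]
    define G where "G = (\<lambda>l x q. F l (ac q x))"
    have G: "tri G" unfolding tri_def G_def by (intro conjI allI L)
    have "(ta n ^^ Suc n) u F = u ((tau_form ^^ Suc n) F)" by (rule dualD(3)[OF d u1 F])
    also have "\<dots> = u (coact_form G)"
    proof (rule sp_cong[OF u1 dualD(1)[OF d F] mlin_coact_form[OF G]])
      fix l :: "'h list" and x assume l: "length l = Suc n"
      have "(tau_form ^^ Suc n) F l x = sm (pl l) (\<lambda>l q. F l (ac q x))"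
        using tau_form_iterate[of l F "[]" x] l by simp
      also have "\<dots> = sm (pl l) (\<lambda>l q. Cs x (\<lambda>y x0. F l (ac q (ac (S y) x0))))"
        by (intro sm_cong Cs_stable[symmetric]) (intro L)
      finally show "(tau_form ^^ Suc n) F l x = coact_form G l x" by (simp add: coact_form_def G_def act_mult)
    qed
    also have "\<dots> = u F" unfolding u2[OF G] by (simp add: G_def)
    finally show "(ta n ^^ Suc n) u F = u F" .
  qed
qed

lemma coinvariants_sp: "u \<in> CC n \<Longrightarrow> u \<in> sp (Suc n)"
  by (simp add: coinvariants_iff)

lemma tau_a_funpow_coinvariants: "u \<in> CC n \<Longrightarrow> (ta n ^^ j) u \<in> CC n"
  by (induction j) (auto intro: tau_a_coinvariants)

text \<open>On coinvariants the rotation has order dividing n + 1, so its inverse is the n-th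
  power.\<close>

lemma tau_a_inv_coinvariants:
  assumes u: "u \<in> CC n"
  shows "tau_a_inv n u \<in> CC n"
proof -
  have "tau_a_inv n u = tau_a_inv n (ta n ((ta n ^^ n) u))" using tau_a_order[OF u] by simp
  also have "\<dots> = (ta n ^^ n) u"
    by (rule tau_a_inverse(1)) (rule coinvariants_sp[OF tau_a_funpow_coinvariants[OF u]])
  finally show ?thesis using tau_a_funpow_coinvariants[OF u] by simp
qed

lemma degen_a_coinvariants: "j \<le> n \<Longrightarrow> u \<in> CC n \<Longrightarrow> sa n j u \<in> CC (Suc n)"
proof (induction j arbitrary: u)
  case 0
  then show ?case by (simp add: degen0_coinvariants)
next
  case (Suc j)
  have "sa n (Suc j) u = ta (Suc n) (sa n j (tau_a_inv n u))"
    using degen_tau[of j n "tau_a_inv n u"] Suc.prems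
    by (simp add: tau_a_inverse coinvariants_sp tau_a_inv_coinvariants)
  then show ?case using Suc by (simp add: tau_a_coinvariants tau_a_inv_coinvariants)
qed

lemma face_a_conj:
  assumes "j \<le> n" "u \<in> sp (Suc (Suc n))"
  shows "da (Suc n) (Suc j) u = ta n (da (Suc n) j (tau_a_inv (Suc n) u))"
  using face_tau[of j n "tau_a_inv (Suc n) u"] assms
  by (simp add: tau_a_inverse dualD(2)[OF dual_tau_a_inv])

lemma face_a_coinvariants: "j \<le> Suc n \<Longrightarrow> u \<in> CC (Suc n) \<Longrightarrow> da (Suc n) j u \<in> CC n"
proof (induction j arbitrary: u)
  case 0
  then show ?case by (simp add: face0_coinvariants)
next
  case (Suc j)
  then show ?case
    by (simp add: face_a_conj coinvariants_sp tau_a_coinvariants tau_a_inv_coinvariants)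
qed

section \<open>The coalgebra side\<close>

abbreviation "tc \<equiv> tau_c H M"

definition tau_c_form :: "('h list \<Rightarrow> 'x \<Rightarrow> 'k) \<Rightarrow> 'h list \<Rightarrow> 'x \<Rightarrow> 'k" where
  "tau_c_form F = (\<lambda>l x. if l = [] then 0 else Cs x (\<lambda>y x0. F (tl l @ [y * hd l]) x0))"

definition tau_c_inv_form :: "('h list \<Rightarrow> 'x \<Rightarrow> 'k) \<Rightarrow> 'h list \<Rightarrow> 'x \<Rightarrow> 'k" where
  "tau_c_inv_form F = (\<lambda>l x. if l = [] then 0 else Cs x (\<lambda>y x0. F (S' y * last l # butlast l) x0))"

definition tau_c_inv :: "nat \<Rightarrow> ('k, 'h, 'x) tensor \<Rightarrow> ('k, 'h, 'x) tensor" where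
  "tau_c_inv n = lin_ext sH sX (Suc n) (\<lambda>hs x. Cs x (\<lambda>y x0. pt (S' y * last hs # butlast hs) x0))"

lemma tau_c_form_simps [simp]:
  "tau_c_form F (g # l) = (\<lambda>x. Cs x (\<lambda>y x0. F (l @ [y * g]) x0))" "tau_c_form F [] = (\<lambda>x. 0)"
  by (simp_all add: tau_c_form_def)

lemma tau_c_inv_form_simps [simp]:
  "tau_c_inv_form F (l @ [g]) = (\<lambda>x. Cs x (\<lambda>y x0. F (S' y * g # l) x0))" "tau_c_inv_form F [] = (\<lambda>x. 0)"
  by (simp_all add: tau_c_inv_form_def)

lemma mlin_tau_c_form: "mlin sX F \<Longrightarrow> mlin sX (tau_c_form F)"
proof -
  assume F: "mlin sX F"
  note L = xforms atoms[OF F]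
  show ?thesis by (rule mlin_Cons; simp; (intro L)?)
qed

lemma mlin_tau_c_inv_form: "mlin sX F \<Longrightarrow> mlin sX (tau_c_inv_form F)"
proof -
  assume F: "mlin sX F"
  note L = xforms atoms[OF F]
  show ?thesis by (rule mlin_snocI; simp; (intro L)?)
qed

lemma dual_tau_c: "dual (Suc n) (Suc n) (tc n) tau_c_form"
  unfolding tau_c_def sm_def[symmetric] Suc_eq_plus1[symmetric]
  by (rule dual_ext[OF mlin_tau_c_form]) (auto simp: tau_c_form_def sm_apply pt_apply intro!: sm_in_sp pt_in)

lemma dual_tau_c_inv: "dual (Suc n) (Suc n) (tau_c_inv n) tau_c_inv_form"
  unfolding tau_c_inv_def
  by (rule dual_ext[OF mlin_tau_c_inv_form]) (auto simp: tau_c_inv_form_def sm_apply pt_apply intro!: sm_in_sp pt_in)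

text \<open>The components of the two successive coactions are multiplied in the order opposite to
  the coproduct, which is the pattern cancelled by the inverse antipode and not by the
  antipode.\<close>

lemma tau_c_form_inverse:
  assumes F: "mlin sX F" and l: "l \<noteq> []"
  shows "tau_c_inv_form (tau_c_form F) l x = F l x" "tau_c_form (tau_c_inv_form F) l x = F l x"
proof -
  note L = xforms atoms[OF F]
  obtain gs g where g: "l = gs @ [g]" using l by (cases l rule: rev_cases) auto
  have "tau_c_inv_form (tau_c_form F) l x = Cs x (\<lambda>y x0. Cs x0 (\<lambda>z x1. F (gs @ [z * S' y * g]) x1))"
    by (simp add: g mult.assoc)
  also have "\<dots> = Cs x (\<lambda>y x0. Sw y (\<lambda>a b. F (gs @ [b * S' a * g]) x0))"
    by (rule Cs_coassoc[symmetric]) (intro L)+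
  also have "\<dots> = Cs x (\<lambda>y x0. \<epsilon> y * F (gs @ [1 * g]) x0)"
    by (intro sm_cong Sw_antipode_inv(2)[where f = "\<lambda>w. F (gs @ [w * g]) _"]) (intro L)
  also have "\<dots> = F (gs @ [1 * g]) x" by (rule Cs_counit) (intro L)
  finally show "tau_c_inv_form (tau_c_form F) l x = F l x" by (simp add: g)
  obtain h hs where h: "l = h # hs" using l by (cases l) auto
  have "tau_c_form (tau_c_inv_form F) l x = Cs x (\<lambda>y x0. Cs x0 (\<lambda>z x1. F (S' z * y * h # hs) x1))"
    by (simp add: h mult.assoc)
  also have "\<dots> = Cs x (\<lambda>y x0. Sw y (\<lambda>a b. F (S' b * a * h # hs) x0))"
    by (rule Cs_coassoc[symmetric]) (intro L)+
  also have "\<dots> = Cs x (\<lambda>y x0. \<epsilon> y * F (1 * h # hs) x0)"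
    by (intro sm_cong Sw_antipode_inv(1)[where f = "\<lambda>w. F (w * h # hs) _"]) (intro L)
  also have "\<dots> = F (1 * h # hs) x" by (rule Cs_counit) (intro L)
  finally show "tau_c_form (tau_c_inv_form F) l x = F l x" by (simp add: h)
qed

lemma tau_c_inverse:
  assumes "u \<in> sp (Suc n)"
  shows "tau_c_inv n (tc n u) = u" "tc n (tau_c_inv n u) = u"
proof -
  show "tau_c_inv n (tc n u) = u"
    by (rule dual_eqI[OF dual_comp[OF dual_tau_c dual_tau_c_inv] dual_id assms]) (rule tau_c_form_inverse, auto)
  show "tc n (tau_c_inv n u) = u"
    by (rule dual_eqI[OF dual_comp[OF dual_tau_c_inv dual_tau_c] dual_id assms]) (rule tau_c_form_inverse, auto)
qed

lemma inv_into_tau_c: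
  assumes "u \<in> sp (Suc n)"
  shows "inv_into (T_space H M n) (tc n) u = tau_c_inv n u"
proof -
  have "inj_on (tc n) (sp (Suc n))"
    by (rule inj_on_inverseI[of _ "tau_c_inv n"]) (rule tau_c_inverse)
  then show ?thesis
    unfolding T_space_eq by (rule inv_into_f_eq) (rule dualD(2)[OF dual_tau_c_inv assms], rule tau_c_inverse[OF assms])
qed

definition split_form :: "('h list \<Rightarrow> 'x \<Rightarrow> 'k) \<Rightarrow> 'h list \<Rightarrow> 'x \<Rightarrow> 'k" where
  "split_form F = (\<lambda>l x. if l = [] then 0 else Sw (hd l) (\<lambda>a b. F (a # b # tl l) x))"

definition counit1_form :: "('h list \<Rightarrow> 'x \<Rightarrow> 'k) \<Rightarrow> 'h list \<Rightarrow> 'x \<Rightarrow> 'k" where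
  "counit1_form F = (\<lambda>l x. if Suc 0 < length l then \<epsilon> (l ! 1) * F (hd l # drop 2 l) x else 0)"

definition counit0_form :: "('h list \<Rightarrow> 'x \<Rightarrow> 'k) \<Rightarrow> 'h list \<Rightarrow> 'x \<Rightarrow> 'k" where
  "counit0_form F = (\<lambda>l x. if l = [] then 0 else \<epsilon> (hd l) * F (tl l) x)"

text \<open>An auxiliary map: the codegeneracy of index 0 applies the counit to the second factor.
  It is the conjugate of this map under \<open>tc\<close>, and this map is the one that \<alpha>
  relates to the face of index 0.\<close>

definition counit0 :: "nat \<Rightarrow> ('k, 'h, 'x) tensor \<Rightarrow> ('k, 'h, 'x) tensor" where
  "counit0 m = lin_ext sH sX (Suc m) (\<lambda>hs x. fscale (\<epsilon> (hd hs)) (pt (tl hs) x))"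

lemma mlin_split_form: "mlin sX F \<Longrightarrow> mlin sX (split_form F)"
proof -
  assume F: "mlin sX F"
  note L = xforms atoms[OF F]
  show ?thesis by (rule mlin_Cons; simp add: split_form_def; (intro L)?)
qed

lemma mlin_counit0_form: "mlin sX F \<Longrightarrow> mlin sX (counit0_form F)"
proof -
  assume F: "mlin sX F"
  note L = xforms atoms[OF F]
  show ?thesis by (rule mlin_Cons; simp add: counit0_form_def; (intro L F)?)
qed

lemma mlin_counit1_form: "mlin sX F \<Longrightarrow> mlin sX (counit1_form F)"
proof -
  assume F: "mlin sX F"
  note L = xforms atoms[OF F]
  have "mlin sX (\<lambda>l. counit1_form F (h # l))" for h
    by (rule mlin_Cons; simp add: counit1_form_def; (intro L)?)
  moreover have "lin sH (*) (\<lambda>h. counit1_form F (h # l) x)" for l x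
    by (cases l; simp add: counit1_form_def; (intro L)?)
  moreover have "lin sX (*) (counit1_form F [])" by (simp add: counit1_form_def lin_zero)
  ultimately show ?thesis by (rule mlin_Cons[rotated])
qed

lemma dual_coface0: "dual (Suc n) (Suc (Suc n)) (coface0 H M n) split_form"
  unfolding coface0_def sm_def[symmetric] Suc_eq_plus1[symmetric]
  by (rule dual_ext[OF mlin_split_form]) (auto simp: split_form_def sm_apply pt_apply intro!: sm_in_sp pt_in)

lemma dual_codegen0: "dual (Suc (Suc n)) (Suc n) (codegen0 H M (Suc n)) counit1_form"
  unfolding codegen0_def Suc_eq_plus1[symmetric]
  by (rule dual_ext[OF mlin_counit1_form])
    (auto simp: counit1_form_def fscale_apply pt_apply intro!: sp_scale pt_in)

lemma dual_counit0: "dual (Suc m) m (counit0 m) counit0_form"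
  unfolding counit0_def
  by (rule dual_ext[OF mlin_counit0_form])
    (auto simp: counit0_form_def fscale_apply pt_apply intro!: sp_scale pt_in)

lemma counit0_tau_c:
  assumes "u \<in> sp (Suc (Suc n))"
  shows "counit0 (Suc n) (tc (Suc n) u) = tc n (codegen0 H M (Suc n) u)"
proof (rule dual_eqI[OF dual_comp[OF dual_tau_c dual_counit0] dual_comp[OF dual_codegen0 dual_tau_c] assms])
  fix F :: "'h list \<Rightarrow> 'x \<Rightarrow> 'k" and l :: "'h list" and x
  assume F: "mlin sX F" and l: "length l = Suc (Suc n)"
  then obtain g h hs where "l = g # h # hs" by (auto simp: length_Suc_conv)
  then show "tau_c_form (counit0_form F) l x = counit1_form (tau_c_form F) l x"
    by (simp add: counit0_form_def counit1_form_def sm_scale)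
qed

lemma length_dg: "(l', c) \<in> set (dg h l) \<Longrightarrow> length l' = length l"
  by (induction l arbitrary: h l' c) auto

lemma length_al: "(l', c) \<in> set (al l) \<Longrightarrow> length l' = length l"
  by (induction l arbitrary: l' c) (auto dest!: length_dg)

lemma length_bq: "(l', c) \<in> set (bq h l) \<Longrightarrow> length l' = length l"
  by (induction l arbitrary: h l' c) auto

lemma length_pl: "(l', c) \<in> set (pl l) \<Longrightarrow> length l' = length l"
  by (induction l arbitrary: l' c) auto

section \<open>The comparison map, its inverse, and the two identifications as maps with
  transposes\<close>

definition dg_form :: "'h \<Rightarrow> ('h list \<Rightarrow> 'x \<Rightarrow> 'k) \<Rightarrow> 'h list \<Rightarrow> 'x \<Rightarrow> 'k" where
  "dg_form h F = (\<lambda>l x. sm (dg h l) (\<lambda>l' c. F l' (ac c x)))"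

definition al_form :: "('h list \<Rightarrow> 'x \<Rightarrow> 'k) \<Rightarrow> 'h list \<Rightarrow> 'x \<Rightarrow> 'k" where
  "al_form F = (\<lambda>l x. sm (al l) (\<lambda>l' p. F l' (ac p x)))"

definition bq_form :: "('h list \<Rightarrow> 'x \<Rightarrow> 'k) \<Rightarrow> 'h list \<Rightarrow> 'x \<Rightarrow> 'k" where
  "bq_form F = (\<lambda>l x. sm (bq 1 l) (\<lambda>l' p. F l' (ac p x)))"

definition pi_form :: "('h list \<Rightarrow> 'x \<Rightarrow> 'k) \<Rightarrow> 'h list \<Rightarrow> 'x \<Rightarrow> 'k" where
  "pi_form F = (\<lambda>l x. if l = [] then 0 else sm (dg (S (hd l)) (tl l)) (\<lambda>l' c. F l' (ac c x)))"

definition sec_form :: "('h list \<Rightarrow> 'x \<Rightarrow> 'k) \<Rightarrow> 'h list \<Rightarrow> 'x \<Rightarrow> 'k" where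
  "sec_form F = coact_form (\<lambda>l x q. F (S' q # l) x)"

lemma mlin_forms:
  assumes F: "mlin sX F"
  shows "mlin sX (dg_form h F)" "mlin sX (al_form F)" "mlin sX (bq_form F)" "mlin sX (pi_form F)"
    "mlin sX (sec_form F)"
proof -
  note L = xforms atoms[OF F]
  show "mlin sX (dg_form h F)" "mlin sX (al_form F)" "mlin sX (bq_form F)"
    unfolding dg_form_def al_form_def bq_form_def by (intro L)+
  show "mlin sX (pi_form F)"
    by (rule mlin_Cons; simp add: pi_form_def; (intro L)?)
  show "mlin sX (sec_form F)"
    unfolding sec_form_def by (intro mlin_coact_form) (unfold tri_def, intro conjI allI L)
qed

definition al_map :: "nat \<Rightarrow> ('k, 'h, 'x) tensor \<Rightarrow> ('k, 'h, 'x) tensor" where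
  "al_map m = lin_ext sH sX m (\<lambda>hs x. sm (al hs) (\<lambda>l p. pt l (ac p x)))"

definition bq_map :: "nat \<Rightarrow> ('k, 'h, 'x) tensor \<Rightarrow> ('k, 'h, 'x) tensor" where
  "bq_map m = lin_ext sH sX m (\<lambda>hs x. sm (bq 1 hs) (\<lambda>l p. pt l (ac p x)))"

definition pi_map :: "nat \<Rightarrow> ('k, 'h, 'x) tensor \<Rightarrow> ('k, 'h, 'x) tensor" where
  "pi_map m = lin_ext sH sX (Suc m) (\<lambda>hs x. sm (dg (S (hd hs)) (tl hs)) (\<lambda>l c. pt l (ac c x)))"

definition sec_map :: "nat \<Rightarrow> ('k, 'h, 'x) tensor \<Rightarrow> ('k, 'h, 'x) tensor" where
  "sec_map m = lin_ext sH sX m (\<lambda>hs x. sm (pl hs) (\<lambda>l q. Cs x (\<lambda>y x0. pt (S' (q * S y) # l) x0)))"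

definition one_map :: "nat \<Rightarrow> ('k, 'h, 'x) tensor \<Rightarrow> ('k, 'h, 'x) tensor" where
  "one_map m = lin_ext sH sX m (\<lambda>hs x. pt (1 # hs) x)"

lemma dual_al_map: "dual m m (al_map m) al_form"
  unfolding al_map_def
  by (rule dual_ext[OF mlin_forms(2)]) (auto simp: al_form_def sm_apply pt_apply length_al intro!: sm_in_sp pt_in)

lemma dual_bq_map: "dual m m (bq_map m) bq_form"
  unfolding bq_map_def
  by (rule dual_ext[OF mlin_forms(3)]) (auto simp: bq_form_def sm_apply pt_apply length_bq intro!: sm_in_sp pt_in)

lemma dual_pi_map: "dual (Suc m) m (pi_map m) pi_form"
  unfolding pi_map_def
  by (rule dual_ext[OF mlin_forms(4)])
    (auto simp: pi_form_def sm_apply pt_apply dest!: length_dg intro!: sm_in_sp pt_in)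

lemma dual_sec_map: "dual m (Suc m) (sec_map m) sec_form"
  unfolding sec_map_def
  by (rule dual_ext[OF mlin_forms(5)])
    (auto simp: sec_form_def coact_form_def sm_apply pt_apply dest!: length_pl intro!: sm_in_sp pt_in)

lemma dual_one_map: "dual m (Suc m) (one_map m) (\<lambda>F l. F (1 # l))"
  unfolding one_map_def
  by (rule dual_ext) (auto simp: pt_apply intro!: pt_in mlin_extend(2)[OF _ lin_ident])

lemma sum_list_swap: "(\<Sum>x\<leftarrow>xs. \<Sum>y\<leftarrow>ys. f x y) = (\<Sum>y\<leftarrow>ys. \<Sum>x\<leftarrow>xs. f x y)"
  for f :: "'a \<Rightarrow> 'b \<Rightarrow> 'c::comm_monoid_add"
  by (induction xs) (simp_all add: sum_list_addf)

lemma upt_0_Suc: "[0..<Suc n] = 0 # map Suc [0..<n]"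
  by (simp add: map_Suc_upt upt_conv_Cons del: upt_Suc)

lemma sum_sws_dg:
  fixes f :: "'h list \<Rightarrow> 'h \<Rightarrow> 'v::comm_monoid_add"
  shows "(\<Sum>s\<leftarrow>sws H (length l) h. f (map (\<lambda>i. s ! i * l ! i) [0..<length l]) (s ! length l)) = sm (dg h l) f"
proof (induction l arbitrary: h f)
  case (Cons g l)
  have "(\<Sum>s\<leftarrow>sws H (length (g # l)) h. f (map (\<lambda>i. s ! i * (g # l) ! i) [0..<length (g # l)]) (s ! length (g # l)))
    = Sw h (\<lambda>a b. \<Sum>s\<leftarrow>sws H (length l) b. f (a * g # map (\<lambda>i. s ! i * l ! i) [0..<length l]) (s ! length l))"
    unfolding length_Cons upt_0_Suc
    by (simp add: sm_def sum_list_map_concat case_prod_unfold o_def)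
  also have "\<dots> = Sw h (\<lambda>a b. sm (dg b l) (\<lambda>l. f (a * g # l)))"
    by (intro sm_cong Cons.IH)
  also have "\<dots> = sm (dg h (g # l)) f" by simp
  finally show ?case .
qed simp

text \<open>Connects the index formula for \<alpha> with the recursion of \<open>al\<close>.
  Shifting i and j together leaves i - j unchanged, so the tail contributes the same formula with
  one factor less; the components of the head after the first multiply it from the left, which is a
  diagonal action.\<close>

lemma sum_product_lists_al:
  fixes f :: "'h list \<Rightarrow> 'h \<Rightarrow> 'v::comm_monoid_add"
  assumes "length hs = m"
  shows "(\<Sum>ss\<leftarrow>product_lists (map (\<lambda>j. sws H (m - j) (hs ! j)) [0..<m]).
      f (map (\<lambda>i. prod_list (map (\<lambda>j. ss ! j ! (i - j)) [0..<Suc i])) [0..<m])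
        (prod_list (map (\<lambda>j. ss ! j ! (m - j)) [0..<m]))) = sm (al hs) f"
  using assms
proof (induction hs arbitrary: m f)
  case (Cons h t)
  define k where "k = length t"
  have m: "m = Suc k" using Cons.prems by (simp add: k_def)
  define wl where "wl = (\<lambda>ss :: 'h list list. map (\<lambda>i. prod_list (map (\<lambda>j. ss ! j ! (i - j)) [0..<Suc i])) [0..<k])"
  define wp where "wp = (\<lambda>ss :: 'h list list. prod_list (map (\<lambda>j. ss ! j ! (k - j)) [0..<k]))"
  define P where "P = product_lists (map (\<lambda>j. sws H (k - j) (t ! j)) [0..<k])"
  have PL: "product_lists (map (\<lambda>j. sws H (m - j) ((h # t) ! j)) [0..<m])
     = concat (map (\<lambda>s. map ((#) s) P) (sws H (Suc k) h))"
    unfolding m upt_0_Suc P_def by (simp add: o_def)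
  have e1: "map (\<lambda>i. prod_list (map (\<lambda>j. (s # ss) ! j ! (i - j)) [0..<Suc i])) [0..<Suc k]
     = s ! 0 # map (\<lambda>i. s ! Suc i * wl ss ! i) [0..<k]" for s :: "'h list" and ss
    unfolding wl_def upt_0_Suc by (simp add: o_def upt_0_Suc del: upt_Suc)
  have e2: "prod_list (map (\<lambda>j. (s # ss) ! j ! (Suc k - j)) [0..<Suc k]) = s ! Suc k * wp ss"
    for s :: "'h list" and ss
    unfolding wp_def upt_0_Suc by (simp add: o_def)
  have lw: "length (wl ss) = k" for ss by (simp add: wl_def)
  have dgs: "(\<Sum>s\<leftarrow>sws H k b. f (a # map (\<lambda>i. s ! i * wl ss ! i) [0..<k]) (s ! k * wp ss))
     = sm (dg b (wl ss)) (\<lambda>l' c. f (a # l') (c * wp ss))" for a b ss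
    using sum_sws_dg[of "\<lambda>l c. f (a # l) (c * wp ss)" "wl ss" b] by (simp add: lw)
  have IH: "(\<Sum>ss\<leftarrow>P. g (wl ss) (wp ss)) = sm (al t) g" for g :: "'h list \<Rightarrow> 'h \<Rightarrow> 'v"
    unfolding P_def wl_def wp_def by (rule Cons.IH) (simp add: k_def)
  have "(\<Sum>ss\<leftarrow>product_lists (map (\<lambda>j. sws H (m - j) ((h # t) ! j)) [0..<m]).
      f (map (\<lambda>i. prod_list (map (\<lambda>j. ss ! j ! (i - j)) [0..<Suc i])) [0..<m])
        (prod_list (map (\<lambda>j. ss ! j ! (m - j)) [0..<m])))
    = (\<Sum>s\<leftarrow>sws H (Suc k) h. \<Sum>ss\<leftarrow>P. f (s ! 0 # map (\<lambda>i. s ! Suc i * wl ss ! i) [0..<k]) (s ! Suc k * wp ss))"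
    unfolding PL sum_list_map_concat by (simp only: m e1 e2 map_map o_def)
  also have "\<dots> = Sw h (\<lambda>a b. \<Sum>s\<leftarrow>sws H k b. \<Sum>ss\<leftarrow>P. f (a # map (\<lambda>i. s ! i * wl ss ! i) [0..<k]) (s ! k * wp ss))"
    by (simp add: sm_def sum_list_map_concat case_prod_unfold o_def)
  also have "\<dots> = Sw h (\<lambda>a b. \<Sum>ss\<leftarrow>P. sm (dg b (wl ss)) (\<lambda>l' c. f (a # l') (c * wp ss)))"
    by (subst sum_list_swap) (simp only: dgs)
  also have "\<dots> = Sw h (\<lambda>a b. sm (al t) (\<lambda>l p. sm (dg b l) (\<lambda>l' c. f (a # l') (c * p))))"
    by (intro sm_cong IH)
  also have "\<dots> = sm (al (h # t)) f" by simp
  finally show ?case .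
qed simp

lemma alpha_eq: "alpha H M n u = al_map (Suc n) u" if "u \<in> sp (Suc n)"
proof -
  have "length l = Suc n" if "(l, x) \<in> set (tensor_rep sH sX (Suc n) u)" for l x
    using tensor_rep(1)[OF vs_H vs_X \<open>u \<in> sp (Suc n)\<close>[unfolded sp_def]] that by auto
  then show ?thesis
    unfolding alpha_def al_map_def lin_ext_def Suc_eq_plus1[symmetric] sm_def[of "tensor_rep _ _ _ _", symmetric]
    by (intro sm_cong sum_product_lists_al[where f = "\<lambda>l p. pt l (ac p _)"])
qed

lemma dual_alpha: "dual (Suc n) (Suc n) (alpha H M n) al_form"
  by (rule dual_fun_cong[OF dual_al_map]) (simp add: alpha_eq)

lemma dual_diag_act: "dual (Suc n) (Suc n) (diag_act H M n h) (dg_form h)"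
proof (rule dual_fun_cong)
  show "dual (Suc n) (Suc n) (lin_ext sH sX (Suc n) (\<lambda>hs x. sm (dg h hs) (\<lambda>l c. pt l (ac c x)))) (dg_form h)"
    by (rule dual_ext[OF mlin_forms(1)])
      (auto simp: dg_form_def sm_apply pt_apply dest!: length_dg intro!: sm_in_sp pt_in)
  fix u assume u: "u \<in> sp (Suc n)"
  have len: "length l = Suc n" if "(l, x) \<in> set (tensor_rep sH sX (Suc n) u)" for l x
    using tensor_rep(1)[OF vs_H vs_X u[unfolded sp_def]] that by auto
  have e: "(\<Sum>s\<leftarrow>sws H (Suc n) h. pt (map (\<lambda>i. s ! i * l ! i) [0..<Suc n]) (ac (s ! Suc n) x))
      = sm (dg h l) (\<lambda>l c. pt l (ac c x))" if "length l = Suc n" for l x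
    using sum_sws_dg[of "\<lambda>l c. pt l (ac c x)" l h] unfolding that .
  show "lin_ext sH sX (Suc n) (\<lambda>hs x. sm (dg h hs) (\<lambda>l c. pt l (ac c x))) u = diag_act H M n h u"
    unfolding diag_act_def lin_ext_def Suc_eq_plus1[symmetric] sm_def[of "tensor_rep _ _ _ _", symmetric]
    by (rule sm_cong) (rule e[symmetric], erule len)
qed

lemma al_map_inverse:
  assumes "u \<in> sp m"
  shows "bq_map m (al_map m u) = u" "al_map m (bq_map m u) = u"
proof -
  show "bq_map m (al_map m u) = u"
  proof (rule dual_eqI[OF dual_comp[OF dual_al_map dual_bq_map] dual_id assms])
    fix F :: "'h list \<Rightarrow> 'x \<Rightarrow> 'k" and l :: "'h list" and x
    assume F: "mlin sX F"
    note L = xforms atoms[OF F]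
    have "sm (al l) (\<lambda>l p. sm (bq 1 l) (\<lambda>l' e. F l' (ac (e * p) x))) = F l (ac 1 x)"
      by (rule bq_al) (intro L)
    then show "al_form (bq_form F) l x = F l x" by (simp add: al_form_def bq_form_def act_mult)
  qed
  show "al_map m (bq_map m u) = u"
  proof (rule dual_eqI[OF dual_comp[OF dual_bq_map dual_al_map] dual_id assms])
    fix F :: "'h list \<Rightarrow> 'x \<Rightarrow> 'k" and l :: "'h list" and x
    assume F: "mlin sX F"
    note L = xforms atoms[OF F]
    have "sm (bq 1 l) (\<lambda>l p. sm (al l) (\<lambda>l' e. F l' (ac (e * p) x))) = sm (dg 1 l) (\<lambda>l c. F l (ac c x))"
      by (rule al_bq) (intro L)
    also have "\<dots> = F l (ac 1 x)" by (rule dg_1) (intro L)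
    finally show "bq_form (al_form F) l x = F l x" by (simp add: al_form_def bq_form_def act_mult)
  qed
qed

lemma counit0_alpha:
  assumes "u \<in> sp (Suc (Suc n))"
  shows "counit0 (Suc n) (alpha H M (Suc n) u) = alpha H M n (da (Suc n) 0 u)"
proof (rule dual_eqI[OF dual_comp[OF dual_alpha dual_counit0] dual_comp[OF dual_face_a dual_alpha] assms])
  fix F :: "'h list \<Rightarrow> 'x \<Rightarrow> 'k" and l :: "'h list" and x
  assume F: "mlin sX F" and l: "length l = Suc (Suc n)"
  note L = xforms atoms[OF F]
  obtain g h hs where lg: "l = g # h # hs" using l by (auto simp: length_Suc_conv)
  have "al_form (counit0_form F) l x = sm (al l) (\<lambda>l p. \<epsilon> (hd l) * F (tl l) (ac p x))"
    unfolding al_form_def by (rule sm_cong) (auto simp: counit0_form_def lg dest!: length_al)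
  also have "\<dots> = sm (al (g * h # hs)) (\<lambda>l p. F l (ac p x))"
    unfolding lg by (rule al_mult) (intro L)
  finally show "al_form (counit0_form F) l x = mult_form 0 (al_form F) l x"
    by (simp add: al_form_def mult_form_def lg del: al.simps)
qed simp

lemma coface0_alpha:
  assumes "u \<in> sp (Suc n)"
  shows "coface0 H M n (alpha H M n u) = alpha H M (Suc n) (sa n 0 u)"
proof (rule dual_eqI[OF dual_comp[OF dual_alpha dual_coface0] dual_comp[OF dual_degen_a dual_alpha] assms])
  fix F :: "'h list \<Rightarrow> 'x \<Rightarrow> 'k" and l :: "'h list" and x
  assume F: "mlin sX F" and l: "length l = Suc n"
  note L = xforms atoms[OF F]
  obtain h hs where lg: "l = h # hs" using l by (auto simp: length_Suc_conv)
  have "al_form (split_form F) l x = sm (al (h # hs)) (\<lambda>l p. Sw (hd l) (\<lambda>a b. F (a # b # tl l) (ac p x)))"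
    unfolding al_form_def lg by (rule sm_cong) (auto simp: split_form_def dest!: length_al simp del: al.simps)
  also have "\<dots> = sm (al (h # 1 # hs)) (\<lambda>l p. F l (ac p x))"
    by (rule al_degen[symmetric]) (intro L)
  finally show "al_form (split_form F) l x = insert_form 0 (al_form F) l x"
    by (simp add: al_form_def insert_form_def lg del: al.simps)
qed simp


subsection \<open>Invariant forms\<close>

interpretation fs: vector_space "fscale :: 'k \<Rightarrow> ('i \<Rightarrow> 'k) \<Rightarrow> _"
  by (rule vector_space_fscale)

abbreviation "WW \<equiv> coinvariant_relations H M"

text \<open>These are the forms that factor through the quotient by the relations; m is the number
  of H-factors.\<close>

definition inv_form :: "nat \<Rightarrow> ('h list \<Rightarrow> 'x \<Rightarrow> 'k) \<Rightarrow> bool" where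
  "inv_form m F \<longleftrightarrow> mlin sX F \<and> (\<forall>h l x. length l = m \<longrightarrow> sm (dg h l) (\<lambda>l' c. F l' (ac c x)) = \<epsilon> h * F l x)"

lemma inv_formD:
  "inv_form m F \<Longrightarrow> mlin sX F"
  "inv_form m F \<Longrightarrow> length l = m \<Longrightarrow> sm (dg h l) (\<lambda>l' c. F l' (ac c x)) = \<epsilon> h * F l x"
  by (simp_all add: inv_form_def)

lemma WW_subspace: "module.subspace fscale (WW n)"
  unfolding coinvariant_relations_def by (rule fs.subspace_span)

lemma WW_sp: "WW n \<subseteq> sp (Suc n)"
  unfolding coinvariant_relations_def
proof (rule fs.span_minimal[OF _ sp_subspace])
  show "{diag_act H M n h v - fscale (\<epsilon> h) v |h v. v \<in> T_space H M n} \<subseteq> sp (Suc n)"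
    by (auto simp: T_space_eq intro!: sp_diff sp_scale dualD(2)[OF dual_diag_act])
qed

lemma sp_apply_scale:
  assumes "u \<in> sp m" "mlin sX F"
  shows "u (\<lambda>l x. c * F l x) = c * u F"
proof -
  obtain ps where ps: "\<And>F. multilin sH sX (*) m F \<Longrightarrow> u F = sm ps F" using sp_rep[OF assms(1)] by metis
  show ?thesis
    unfolding ps[OF mlin_multilin[OF assms(2)]] ps[OF mlin_multilin[OF mlin_mult[OF assms(2)]]] by (rule sm_scale)
qed

lemma inv_form_WW:
  assumes "u \<in> WW n" "inv_form (Suc n) F"
  shows "u F = 0"
  using assms(1) unfolding coinvariant_relations_def
proof (induction rule: fs.span_induct)
  case base
  show ?case by (auto simp: fs.subspace_def fscale_apply)
next
  case (step w)
  then obtain h v where w: "w = diag_act H M n h v - fscale (\<epsilon> h) v" and v: "v \<in> sp (Suc n)"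
    by (auto simp: T_space_eq)
  note F = inv_formD[OF assms(2)]
  have "diag_act H M n h v F = v (dg_form h F)" by (rule dualD(3)[OF dual_diag_act v F(1)])
  also have "\<dots> = v (\<lambda>l x. \<epsilon> h * F l x)"
    by (rule sp_cong[OF v mlin_forms(1)[OF F(1)] mlin_mult[OF F(1)]]) (simp add: dg_form_def F(2))
  also have "\<dots> = \<epsilon> h * v F" by (rule sp_apply_scale[OF v F(1)])
  finally show ?case by (simp add: w fscale_apply)
qed

text \<open>A subspace is the common kernel of the functionals vanishing on it. If u were outside, a
  functional that is nonzero on u minus its projection, composed with the complementary projection,
  would vanish on the relations and not on u; its form is invariant because the relations contain
  their generators.\<close>

lemma WW_I:
  assumes u: "u \<in> sp (Suc n)" and inv: "\<And>F. inv_form (Suc n) F \<Longrightarrow> u F = 0"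
  shows "u \<in> WW n"
proof (rule ccontr)
  assume no: "u \<notin> WW n"
  obtain p where p: "Vector_Spaces.linear fscale fscale p" "\<And>v. p v \<in> WW n" "\<And>v. v \<in> WW n \<Longrightarrow> p v = v"
    using exists_projection[OF vector_space_fscale WW_subspace[of n]] by blast
  have ne: "u - p u \<noteq> 0" using no p(2)[of u] by auto
  obtain g where g: "Vector_Spaces.linear fscale (*) g" "g (u - p u) \<noteq> g 0"
    using separating_form[OF vector_space_fscale ne] by blast
  have gl: "lin fscale (*) g" and pl: "lin fscale fscale p" using g(1) p(1) by (simp_all add: linear_lin)
  define L where "L = (\<lambda>v. g (v - p v))"
  have L: "lin fscale (*) L"
    unfolding lin_def L_def
    by (simp add: lin_add[OF pl] lin_scale[OF pl] add_diff_add lin_add[OF gl] lin_scale[OF gl]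
        fs.scale_right_diff_distrib[symmetric])
  have LW: "L w = 0" if "w \<in> WW n" for w using p(3)[OF that] lin_0[OF gl] by (simp add: L_def)
  have Lu: "L u \<noteq> 0" using g(2) lin_0[OF gl] by (simp add: L_def)
  have Ll: "Vector_Spaces.linear fscale (*) L" using L by (simp add: lin_linear[OF vector_space_fscale vector_space_mult])
  define F where "F = (\<lambda>l x. if length l = Suc n then L (pt l x) else 0)"
  have "multilin sH sX (*) (Suc n) (\<lambda>l x. L (pt l x))"
    using multilin_pure_tensor[OF vs_H vs_X, of "Suc n"] unfolding multilin_def
    by (auto intro: linear_compose'[OF _ Ll])
  then have F: "mlin sX F" unfolding F_def by (rule multilin_cut)
  have ev: "v F = L v" if v: "v \<in> sp (Suc n)" for v
  proof -
    obtain ps where ps: "\<And>l x. (l, x) \<in> set ps \<Longrightarrow> length l = Suc n" "v = sm ps pt"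
      "\<And>F. multilin sH sX (*) (Suc n) F \<Longrightarrow> v F = sm ps F" using sp_rep[OF v] by metis
    have "v F = sm ps F" by (rule ps(3)[OF mlin_multilin[OF F]])
    also have "\<dots> = sm ps (\<lambda>l x. L (pt l x))" by (rule sm_cong) (auto simp: F_def ps(1))
    also have "\<dots> = L v" unfolding ps(2) by (rule lin_sm_arg[OF L, symmetric])
    finally show ?thesis .
  qed
  have "inv_form (Suc n) F"
    unfolding inv_form_def
  proof (intro conjI allI impI)
    fix h :: 'h and l :: "'h list" and x assume l: "length l = Suc n"
    have pt: "pt l x \<in> sp (Suc n)" using l by (rule pt_in)
    have "diag_act H M n h (pt l x) - fscale (\<epsilon> h) (pt l x) \<in> WW n"
      unfolding coinvariant_relations_def by (rule fs.span_base) (use pt in \<open>auto simp: T_space_eq\<close>)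
    then have "L (diag_act H M n h (pt l x) - fscale (\<epsilon> h) (pt l x)) = 0" by (rule LW)
    then have "diag_act H M n h (pt l x) F - \<epsilon> h * pt l x F = 0"
      using ev[OF sp_diff[OF dualD(2)[OF dual_diag_act pt] sp_scale[OF pt]], of h "\<epsilon> h"]
      by (simp add: fscale_apply)
    then show "sm (dg h l) (\<lambda>l' c. F l' (ac c x)) = \<epsilon> h * F l x"
      by (simp add: dualD(3)[OF dual_diag_act pt F] pt_apply F mlin_forms(1)[OF F]) (simp add: dg_form_def)
  qed (rule F)
  then show False using inv[of F] ev[OF u] Lu by simp
qed

lemma inv_form_counit0: "inv_form n F \<Longrightarrow> inv_form (Suc n) (counit0_form F)"
proof -
  assume F: "inv_form n F"
  note F1 = inv_formD(1)[OF F]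
  note L = xforms atoms[OF F1]
  show ?thesis unfolding inv_form_def
  proof (intro conjI allI impI)
    fix h :: 'h and l :: "'h list" and x assume l: "length l = Suc n"
    then obtain g gs where g: "l = g # gs" "length gs = n" by (auto simp: length_Suc_conv)
    have "sm (dg h l) (\<lambda>l' c. counit0_form F l' (ac c x))
      = Sw h (\<lambda>a b. \<epsilon> a * (\<epsilon> g * sm (dg b gs) (\<lambda>l c. F l (ac c x))))"
      by (simp add: g counit0_form_def sm_scale mult.assoc)
    also have "\<dots> = \<epsilon> g * sm (dg h gs) (\<lambda>l c. F l (ac c x))" by (rule Sw_counit) (intro L)
    also have "\<dots> = \<epsilon> h * counit0_form F l x" by (simp add: inv_formD(2)[OF F g(2)] g counit0_form_def)
    finally show "sm (dg h l) (\<lambda>l' c. counit0_form F l' (ac c x)) = \<epsilon> h * counit0_form F l x" .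
  qed (rule mlin_counit0_form[OF F1])
qed

lemma inv_form_split: "inv_form (Suc (Suc n)) F \<Longrightarrow> inv_form (Suc n) (split_form F)"
proof -
  assume F: "inv_form (Suc (Suc n)) F"
  note F1 = inv_formD(1)[OF F]
  note L = xforms atoms[OF F1]
  show ?thesis unfolding inv_form_def
  proof (intro conjI allI impI)
    fix h :: 'h and l :: "'h list" and x assume l: "length l = Suc n"
    then obtain g gs where g: "l = g # gs" "length gs = n" by (auto simp: length_Suc_conv)
    define E where "E = (\<lambda>p q a1 a2 b. sm (dg b gs) (\<lambda>l c. F (a1 * p # a2 * q # l) (ac c x)))"
    have "sm (dg h l) (\<lambda>l' c. split_form F l' (ac c x))
      = Sw h (\<lambda>a b. Sw (a * g) (\<lambda>p q. sm (dg b gs) (\<lambda>l c. F (p # q # l) (ac c x))))"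
      by (simp add: g split_form_def) (intro sm_cong, rule sm_swap)
    also have "\<dots> = Sw h (\<lambda>a b. Sw a (\<lambda>a1 a2. Sw g (\<lambda>p q. E p q a1 a2 b)))"
      unfolding E_def by (intro sm_cong Sw_mult) (intro L)+
    also have "\<dots> = Sw h (\<lambda>a w. Sw w (\<lambda>a2 b. Sw g (\<lambda>p q. E p q a a2 b)))"
      by (rule Sw_coassoc) (unfold E_def, (intro L)+)
    also have "\<dots> = Sw g (\<lambda>p q. sm (dg h (p # q # gs)) (\<lambda>l c. F l (ac c x)))"
    proof -
      have "Sw h (\<lambda>a w. Sw w (\<lambda>a2 b. Sw g (\<lambda>p q. E p q a a2 b))) = Sw h (\<lambda>a w. Sw g (\<lambda>p q. Sw w (\<lambda>a2 b. E p q a a2 b)))"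
        by (intro sm_cong sm_swap)
      also have "\<dots> = Sw g (\<lambda>p q. Sw h (\<lambda>a w. Sw w (\<lambda>a2 b. E p q a a2 b)))" by (rule sm_swap)
      finally show ?thesis by (simp add: E_def)
    qed
    also have "\<dots> = Sw g (\<lambda>p q. \<epsilon> h * F (p # q # gs) x)"
      by (intro sm_cong inv_formD(2)[OF F]) (simp add: g)
    also have "\<dots> = \<epsilon> h * split_form F l x" by (simp add: g split_form_def sm_scale)
    finally show "sm (dg h l) (\<lambda>l' c. split_form F l' (ac c x)) = \<epsilon> h * split_form F l x" .
  qed (rule mlin_split_form[OF F1])
qed

text \<open>The bracketing in which the component under S' is split off first, as
  \<open>dg_comodule\<close> and \<open>al_comodule\<close> expect it.\<close>

lemma Cs_act':
  assumes "\<And>b. lin sH (*) (\<lambda>a. f a b)" and "\<And>a. lin sX (*) (\<lambda>b. f a b)"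
  shows "Cs (ac h x) f = Sw h (\<lambda>p d. Sw p (\<lambda>a c. Cs x (\<lambda>y x0. f (a * y * S' d) (ac c x0))))"
proof -
  note L = xforms lin_comp[OF _ assms(1)]
  have l2: "lin t sX g \<Longrightarrow> lin t (*) (\<lambda>b. f a (g b))" for t g a
    using assms(2)[of a] by (simp add: lin_def)
  have "Sw h (\<lambda>p d. Sw p (\<lambda>a c. Cs x (\<lambda>y x0. f (a * y * S' d) (ac c x0))))
    = Sw h (\<lambda>a w. Sw w (\<lambda>c d. Cs x (\<lambda>y x0. f (a * y * S' d) (ac c x0))))"
    by (rule Sw_coassoc) (intro L l2)+
  then show ?thesis by (simp add: Cs_act assms)
qed

text \<open>
  Here the factor \<open>S\<^sup>-\<^sup>1(h\<^sub>(\<^sub>3\<^sub>))\<close> of the anti-Yetter-Drinfeld condition meets \<open>h\<^sub>(\<^sub>1\<^sub>)\<close>, since \<open>\<tau>\<^sub>c\<close> moves the first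
  factor to the last position.
\<close>

lemma inv_form_tau_c: "inv_form (Suc n) F \<Longrightarrow> inv_form (Suc n) (tau_c_form F)"
proof -
  assume F: "inv_form (Suc n) F"
  note F1 = inv_formD(1)[OF F]
  note L = xforms atoms[OF F1]
  show ?thesis unfolding inv_form_def
  proof (intro conjI allI impI)
    fix h :: 'h and l :: "'h list" and x assume l: "length l = Suc n"
    then obtain g gs where g: "l = g # gs" "length gs = n" by (auto simp: length_Suc_conv)
    have A: "Cs (ac c x) (\<lambda>y x0. F (l @ [y * (a * g)]) x0) = Sw c (\<lambda>c' c3. Sw c' (\<lambda>c1 c2.
        Cs x (\<lambda>y x0. F (l @ [c1 * (y * (S' c3 * (a * g)))]) (ac c2 x0))))" for a c l
      by (subst Cs_act') ((intro L)+, simp add: mult.assoc)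
    \<comment> \<open>The component under S' is pulled out of the diagonal action as b2. The
      component c1 then completes the action of b1 on the list with its new last factor, to which
      the invariance of F applies in C.\<close>
    have B: "sm (dg b gs) (\<lambda>l c. Sw c (\<lambda>c' c3. Sw c' (\<lambda>c1 c2.
        Cs x (\<lambda>y x0. F (l @ [c1 * (y * (S' c3 * (a * g)))]) (ac c2 x0)))))
      = Sw b (\<lambda>b1 b2. sm (dg b1 gs) (\<lambda>l c. Sw c (\<lambda>c1 c2.
        Cs x (\<lambda>y x0. F (l @ [c1 * (y * (S' b2 * (a * g)))]) (ac c2 x0)))))" for a b
      by (rule dg_comodule) (intro L)+
    have C: "sm (dg b1 gs) (\<lambda>l c. Sw c (\<lambda>c1 c2. Cs x (\<lambda>y x0. F (l @ [c1 * (y * (S' b2 * (a * g)))]) (ac c2 x0))))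
      = \<epsilon> b1 * Cs x (\<lambda>y x0. F (gs @ [y * (S' b2 * (a * g))]) x0)" for a b1 b2
    proof -
      have "sm (dg b1 gs) (\<lambda>l c. Sw c (\<lambda>c1 c2. Cs x (\<lambda>y x0. F (l @ [c1 * (y * (S' b2 * (a * g)))]) (ac c2 x0))))
        = Cs x (\<lambda>y x0. sm (dg b1 (gs @ [y * (S' b2 * (a * g))])) (\<lambda>l c. F l (ac c x0)))"
      proof -
        have "sm (dg b1 gs) (\<lambda>l c. Sw c (\<lambda>c1 c2. Cs x (\<lambda>y x0. F (l @ [c1 * (y * (S' b2 * (a * g)))]) (ac c2 x0))))
          = sm (dg b1 gs) (\<lambda>l c. Cs x (\<lambda>y x0. Sw c (\<lambda>c1 c2. F (l @ [c1 * (y * (S' b2 * (a * g)))]) (ac c2 x0))))"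
          by (intro sm_cong sm_swap)
        also have "\<dots> = Cs x (\<lambda>y x0. sm (dg b1 gs) (\<lambda>l c. Sw c (\<lambda>c1 c2. F (l @ [c1 * (y * (S' b2 * (a * g)))]) (ac c2 x0))))"
          by (rule sm_swap)
        finally show ?thesis unfolding dg_snoc .
      qed
      also have "\<dots> = Cs x (\<lambda>y x0. \<epsilon> b1 * F (gs @ [y * (S' b2 * (a * g))]) x0)"
        by (intro sm_cong inv_formD(2)[OF F]) (simp add: g)
      finally show ?thesis by (simp add: sm_scale)
    qed
    have "sm (dg h l) (\<lambda>l' c. tau_c_form F l' (ac c x))
      = Sw h (\<lambda>a b. Sw b (\<lambda>b1 b2. \<epsilon> b1 * Cs x (\<lambda>y x0. F (gs @ [y * (S' b2 * (a * g))]) x0)))"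
      by (simp add: g A B C)
    also have "\<dots> = Sw h (\<lambda>a b. Cs x (\<lambda>y x0. F (gs @ [y * (S' b * (a * g))]) x0))"
      by (intro sm_cong Sw_counit) (intro L)
    also have "\<dots> = Sw h (\<lambda>a b. Cs x (\<lambda>y x0. F (gs @ [y * (S' b * a * g)]) x0))"
      by (simp add: mult.assoc)
    also have "\<dots> = \<epsilon> h * Cs x (\<lambda>y x0. F (gs @ [y * (1 * g)]) x0)"
      by (rule Sw_antipode_inv(1)[where f = "\<lambda>w. Cs x (\<lambda>y x0. F (gs @ [y * (w * g)]) x0)"]) (intro L)
    finally show "sm (dg h l) (\<lambda>l' c. tau_c_form F l' (ac c x)) = \<epsilon> h * tau_c_form F l x"
      by (simp add: g)
  qed (rule mlin_tau_c_form[OF F1])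
qed

text \<open>Acting by h before applying the antipode to the first factor produces S(h1 g) h2 = S(g)
  S(h1) h2, which collapses to \<epsilon>(h) S(g).\<close>

lemma inv_form_pi: "mlin sX F \<Longrightarrow> inv_form (Suc m) (pi_form F)"
proof -
  assume F: "mlin sX F"
  note L = xforms atoms[OF F]
  show ?thesis unfolding inv_form_def
  proof (intro conjI allI impI)
    fix h :: 'h and l :: "'h list" and x assume l: "length l = Suc m"
    then obtain g gs where g: "l = g # gs" by (auto simp: length_Suc_conv)
    have 1: "sm (dg b gs) (\<lambda>l c. sm (dg w l) (\<lambda>l' d. F l' (ac (d * c) x))) = sm (dg (w * b) gs) (\<lambda>l c. F l (ac c x))"
      for b w by (rule dg_dg) (intro L)
    have "sm (dg h l) (\<lambda>l' c. pi_form F l' (ac c x)) = Sw h (\<lambda>a b. sm (dg (S g * (S a * b)) gs) (\<lambda>l c. F l (ac c x)))"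
      by (simp add: g pi_form_def act_mult[symmetric] 1 antipode_mult mult.assoc)
    also have "\<dots> = \<epsilon> h * sm (dg (S g * 1) gs) (\<lambda>l c. F l (ac c x))"
      by (rule Sw_antipode(1)[where f = "\<lambda>w. sm (dg (S g * w) gs) (\<lambda>l c. F l (ac c x))"]) (intro L)
    finally show "sm (dg h l) (\<lambda>l' c. pi_form F l' (ac c x)) = \<epsilon> h * pi_form F l x"
      by (simp add: g pi_form_def)
  qed (rule mlin_forms(4)[OF F])
qed

lemma pi_map_WW: "u \<in> WW n \<Longrightarrow> pi_map n u = 0"
  by (rule sp_eqI[of _ n])
    (use WW_sp[of n] in \<open>auto simp: dualD(3)[OF dual_pi_map] inv_form_WW[OF _ inv_form_pi] sp_0
      intro!: dualD(2)[OF dual_pi_map]\<close>)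

text \<open>The tensor g1 \<otimes> g2 \<alpha>(w) is sent to S(g1) g2 \<alpha>(w), and the antipode
  leaves \<epsilon>(g) \<alpha>(w).\<close>

lemma pi_alpha:
  assumes "u \<in> sp (Suc n)"
  shows "pi_map n (alpha H M n u) = al_map n (counit0 n u)"
proof (rule dual_eqI[OF dual_comp[OF dual_alpha dual_pi_map] dual_comp[OF dual_counit0 dual_al_map] assms])
  fix F :: "'h list \<Rightarrow> 'x \<Rightarrow> 'k" and l :: "'h list" and x
  assume F: "mlin sX F" and l: "length l = Suc n"
  note L = xforms atoms[OF F]
  obtain g hs where g: "l = g # hs" using l by (auto simp: length_Suc_conv)
  have 1: "sm (dg b l) (\<lambda>l' c. sm (dg (S a) l') (\<lambda>l'' d. F l'' (ac (d * (c * p)) x)))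
    = sm (dg (S a * b) l) (\<lambda>l c. F l (ac (c * p) x))" for a b l p
    using dg_dg[of "\<lambda>l c. F l (ac (c * p) x)" b l "S a"] by (simp add: mult.assoc L)
  have "al_form (pi_form F) l x = Sw g (\<lambda>a b. sm (al hs) (\<lambda>l p. sm (dg (S a * b) l) (\<lambda>l c. F l (ac (c * p) x))))"
    by (simp add: al_form_def pi_form_def g act_mult[symmetric] 1)
  also have "\<dots> = \<epsilon> g * sm (al hs) (\<lambda>l p. sm (dg 1 l) (\<lambda>l c. F l (ac (c * p) x)))"
    by (rule Sw_antipode(1)[where f = "\<lambda>w. sm (al hs) (\<lambda>l p. sm (dg w l) (\<lambda>l c. F l (ac (c * p) x)))"]) (intro L)
  also have "sm (al hs) (\<lambda>l p. sm (dg 1 l) (\<lambda>l c. F l (ac (c * p) x))) = sm (al hs) (\<lambda>l p. F l (ac (1 * p) x))"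
    by (intro sm_cong dg_1) (intro L)
  finally show "al_form (pi_form F) l x = counit0_form (al_form F) l x"
    by (simp add: g counit0_form_def al_form_def)
qed

text \<open>The tensor g \<otimes> u is the diagonal action of g1 on 1 \<otimes> S(g2) u, hence
  congruent to \<epsilon>(g1) times that tensor.\<close>

lemma one_pi:
  assumes u: "u \<in> sp (Suc n)"
  shows "one_map n (pi_map n u) - u \<in> WW n"
proof (rule WW_I)
  have p: "pi_map n u \<in> sp n" by (rule dualD(2)[OF dual_pi_map u])
  show "one_map n (pi_map n u) - u \<in> sp (Suc n)" by (intro sp_diff dualD(2)[OF dual_one_map] p u)
  fix F assume F: "inv_form (Suc n) F"
  note F1 = inv_formD(1)[OF F]
  note L = xforms atoms[OF F1]
  have F2: "mlin sX (\<lambda>l. F (1 # l))" by (intro L)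
  have "one_map n (pi_map n u) F = u (pi_form (\<lambda>l. F (1 # l)))"
    by (simp add: dualD(3)[OF dual_one_map p F1] dualD(3)[OF dual_pi_map u F2])
  also have "\<dots> = u F"
  proof (rule sp_cong[OF u mlin_forms(4)[OF F2] F1])
    fix l :: "'h list" and x assume "length l = Suc n"
    then obtain g gs where g: "l = g # gs" "length gs = n" by (auto simp: length_Suc_conv)
    have 1: "sm (dg b gs) (\<lambda>l c. sm (dg a l) (\<lambda>l' d. F (p # l') (ac (d * c) x))) = sm (dg (a * b) gs) (\<lambda>l c. F (p # l) (ac c x))"
      for a b p by (rule dg_dg) (intro L)
    have "pi_form (\<lambda>l. F (1 # l)) l x = Sw g (\<lambda>a b. \<epsilon> a * sm (dg (S b) gs) (\<lambda>l c. F (1 # l) (ac c x)))"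
      unfolding pi_form_def g by (simp, rule Sw_counit(1)[symmetric]) (intro L)
    also have "\<dots> = Sw g (\<lambda>a b. sm (dg (S b) gs) (\<lambda>l c. \<epsilon> a * F (1 # l) (ac c x)))"
      by (simp add: sm_scale)
    also have "\<dots> = Sw g (\<lambda>a b. sm (dg (S b) gs) (\<lambda>l c. sm (dg a (1 # l)) (\<lambda>l' d. F l' (ac d (ac c x)))))"
      by (intro sm_cong inv_formD(2)[OF F, symmetric]) (auto dest!: length_dg simp: g)
    also have "\<dots> = Sw g (\<lambda>a b. Sw a (\<lambda>p q. sm (dg (q * S b) gs) (\<lambda>l c. F (p # l) (ac c x))))"
      by (simp add: act_mult[symmetric]) (subst sm_swap, simp add: 1)
    also have "\<dots> = sm (dg 1 gs) (\<lambda>l c. F (g # l) (ac c x))"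
      by (rule Sw_antipode_middle(2)[where f = "\<lambda>p w. sm (dg w gs) (\<lambda>l c. F (p # l) (ac c x))"]) (intro L)+
    also have "\<dots> = F (g # gs) (ac 1 x)" by (rule dg_1) (intro L)
    finally show "pi_form (\<lambda>l. F (1 # l)) l x = F l x" by (simp add: g)
  qed
  finally show "(one_map n (pi_map n u) - u) F = 0" by simp
qed


subsection \<open>The comparison map is bijective modulo the relations\<close>

text \<open>Coassociativity of the right coaction on the H-factors and X. The H-factors are covered
  by \<open>pl_comodule\<close>; on X the antipode reverses the coproduct and so turns the left
  coaction into a right one.\<close>

lemma coact_form_coassoc:
  assumes l1: "\<And>q q'. mlin sX (\<lambda>l x. W l x q' q)" and l2: "\<And>l x q. lin sH (*) (\<lambda>q'. W l x q' q)"
    and l3: "\<And>l x q'. lin sH (*) (\<lambda>q. W l x q' q)"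
  shows "coact_form (\<lambda>l x q. coact_form (\<lambda>l x q'. W l x q' q) l x) l x
    = coact_form (\<lambda>l x q. Sw q (\<lambda>a b. W l x a b)) l x"
proof -
  have m1: "mlin t (\<lambda>l c. W l x (g c) q)" if "lin t sH g" for t g x q
    using that l2[of _ x q] mlin_slot[OF l1 lin_ident] by (auto simp: mlin_def lin_def)
  note L = xforms atoms[OF l1] lin_comp[OF _ l2] lin_comp[OF _ l3] m1
  have "coact_form (\<lambda>l x q. coact_form (\<lambda>l x q'. W l x q' q) l x) l x
    = Cs x (\<lambda>y x0. Cs x0 (\<lambda>z x1. sm (pl l) (\<lambda>l q. sm (pl l) (\<lambda>l' q'. W l' x1 (q' * S z) (q * S y)))))"
  proof -
    have "coact_form (\<lambda>l x q. coact_form (\<lambda>l x q'. W l x q' q) l x) l x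
      = sm (pl l) (\<lambda>l q. Cs x (\<lambda>y x0. Cs x0 (\<lambda>z x1. sm (pl l) (\<lambda>l' q'. W l' x1 (q' * S z) (q * S y)))))"
      unfolding coact_form_def by (intro sm_cong sm_swap)
    also have "\<dots> = Cs x (\<lambda>y x0. sm (pl l) (\<lambda>l q. Cs x0 (\<lambda>z x1. sm (pl l) (\<lambda>l' q'. W l' x1 (q' * S z) (q * S y)))))"
      by (rule sm_swap)
    also have "\<dots> = Cs x (\<lambda>y x0. Cs x0 (\<lambda>z x1. sm (pl l) (\<lambda>l q. sm (pl l) (\<lambda>l' q'. W l' x1 (q' * S z) (q * S y)))))"
      by (intro sm_cong sm_swap)
    finally show ?thesis .
  qed
  also have "\<dots> = Cs x (\<lambda>y x0. Cs x0 (\<lambda>z x1. sm (pl l) (\<lambda>l q. Sw q (\<lambda>a b. W l x1 (a * S z) (b * S y)))))"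
    by (intro sm_cong pl_comodule) (intro L)+
  also have "\<dots> = Cs x (\<lambda>y x0. Sw y (\<lambda>c d. sm (pl l) (\<lambda>l q. Sw q (\<lambda>a b. W l x0 (a * S d) (b * S c)))))"
    by (rule Cs_coassoc[symmetric]) (intro L)+
  also have "\<dots> = Cs x (\<lambda>y x0. sm (pl l) (\<lambda>l q. Sw q (\<lambda>a b. Sw y (\<lambda>c d. W l x0 (a * S d) (b * S c)))))"
    by (intro sm_cong, subst sm_swap, intro sm_cong, rule sm_swap)
  also have "\<dots> = Cs x (\<lambda>y x0. sm (pl l) (\<lambda>l q. Sw (q * S y) (\<lambda>a b. W l x0 a b)))"
  proof (intro sm_cong)
    fix y x0 l q
    have "Sw (q * S y) (\<lambda>a b. W l x0 a b) = Sw q (\<lambda>a b. Sw (S y) (\<lambda>c d. W l x0 (a * c) (b * d)))"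
      by (rule Sw_mult) (intro L)+
    also have "\<dots> = Sw q (\<lambda>a b. Sw y (\<lambda>c d. W l x0 (a * S d) (b * S c)))"
      by (intro sm_cong Sw_antipode_apply) (intro L)+
    finally show "Sw q (\<lambda>a b. Sw y (\<lambda>c d. W l x0 (a * S d) (b * S c))) = Sw (q * S y) (\<lambda>a b. W l x0 a b)" by simp
  qed
  also have "\<dots> = coact_form (\<lambda>l x q. Sw q (\<lambda>a b. W l x a b)) l x"
    unfolding coact_form_def by (rule sm_swap)
  finally show ?thesis .
qed

text \<open>If q is the coaction component of w, coacting once more on S'(q) \<otimes> w gives, by
  coassociativity, the first factor S'(q3) and the component S'(q2) q1, which cancels to 1.\<close>

lemma sec_map_coinvariants:
  assumes w: "w \<in> sp n"
  shows "sec_map n w \<in> CC n"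
proof -
  have s: "sec_map n w \<in> sp (Suc n)" by (rule dualD(2)[OF dual_sec_map w])
  have "sec_map n w (coact_form G) = sec_map n w (\<lambda>l x. G l x 1)" if G: "tri G" for G
  proof -
    note L = xforms tri_atoms[OF G]
    define W where "W = (\<lambda>l x q' q. Sw q (\<lambda>c d. G (S' d # l) x (S' c * q')))"
    have W: "mlin sX (\<lambda>l x. W l x q' q)" "lin sH (*) (\<lambda>q'. W l x q' q)" "lin sH (*) (\<lambda>q. W l x q' q)" for q q' l x
      unfolding W_def by (intro L)+
    have 1: "coact_form G (S' q # l) x = coact_form (\<lambda>l x q'. W l x q' q) l x" for q l x
    proof -
      have "coact_form G (S' q # l) x = Sw (S' q) (\<lambda>a b. sm (pl l) (\<lambda>l q'. Cs x (\<lambda>y x0. G (a # l) x0 (b * q' * S y))))"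
        by (simp add: coact_form_def)
      also have "\<dots> = Sw q (\<lambda>c d. sm (pl l) (\<lambda>l q'. Cs x (\<lambda>y x0. G (S' d # l) x0 (S' c * q' * S y))))"
        by (rule Sw_antipode_inv_apply) (intro L)+
      also have "\<dots> = sm (pl l) (\<lambda>l q'. Cs x (\<lambda>y x0. W l x0 (q' * S y) q))"
        unfolding W_def by (subst sm_swap, intro sm_cong, subst sm_swap) (simp add: mult.assoc)
      finally show ?thesis by (simp add: coact_form_def)
    qed
    have 2: "Sw q (\<lambda>a b. W l x a b) = G (S' q # l) x 1" for q l x
    proof -
      have "Sw q (\<lambda>a b. W l x a b) = Sw q (\<lambda>e d. Sw e (\<lambda>a c. G (S' d # l) x (S' c * a)))"
        unfolding W_def by (rule Sw_coassoc[symmetric]) (intro L)+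
      also have "\<dots> = Sw q (\<lambda>e d. \<epsilon> e * G (S' d # l) x 1)"
        by (intro sm_cong Sw_antipode_inv) (intro L)
      also have "\<dots> = G (S' q # l) x 1" by (rule Sw_counit) (intro L)
      finally show ?thesis .
    qed
    have "sec_map n w (coact_form G) = w (sec_form (coact_form G))"
      by (rule dualD(3)[OF dual_sec_map w mlin_coact_form[OF G]])
    also have "sec_form (coact_form G) = sec_form (\<lambda>l x. G l x 1)"
      unfolding sec_form_def 1 using coact_form_coassoc[of W, OF W] by (simp add: fun_eq_iff 2)
    also have "w \<dots> = sec_map n w (\<lambda>l x. G l x 1)"
      by (rule dualD(3)[OF dual_sec_map w triD(1)[OF G], symmetric])
    finally show ?thesis .
  qed
  then show ?thesis using s by (simp add: coinvariants_iff)
qed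

lemma counit0_sec_map:
  assumes "w \<in> sp n"
  shows "counit0 n (sec_map n w) = w"
proof (rule dual_eqI[OF dual_comp[OF dual_sec_map dual_counit0] dual_id assms])
  fix F :: "'h list \<Rightarrow> 'x \<Rightarrow> 'k" and l :: "'h list" and x
  assume F: "mlin sX F"
  note L = xforms atoms[OF F]
  have "sec_form (counit0_form F) l x = sm (pl l) (\<lambda>l q. \<epsilon> q * Cs x (\<lambda>y x0. \<epsilon> y * F l x0))"
    by (simp add: sec_form_def coact_form_def counit0_form_def sm_scale mult.assoc)
  also have "\<dots> = sm (pl l) (\<lambda>l q. \<epsilon> q * F l x)"
    by (intro sm_cong arg_cong[of _ _ "(*) _"] Cs_counit) (intro L)
  also have "\<dots> = F l x" by (rule pl_counit[OF F])
  finally show "sec_form (counit0_form F) l x = F l x" .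
qed

lemma sec_map_counit0:
  assumes v: "v \<in> CC n"
  shows "sec_map n (counit0 n v) = v"
proof (rule sp_eqI[of _ "Suc n"])
  have v1: "v \<in> sp (Suc n)" and v2: "\<And>G. tri G \<Longrightarrow> v (coact_form G) = v (\<lambda>l x. G l x 1)"
    using v by (auto simp: coinvariants_iff)
  show "v \<in> sp (Suc n)" by (rule v1)
  have c: "counit0 n v \<in> sp n" by (rule dualD(2)[OF dual_counit0 v1])
  show "sec_map n (counit0 n v) \<in> sp (Suc n)" by (rule dualD(2)[OF dual_sec_map c])
  fix F :: "'h list \<Rightarrow> 'x \<Rightarrow> 'k" assume F: "mlin sX F"
  note L = xforms atoms[OF F]
  \<comment> \<open>Multiplying the first factor by S'(q) gives back F at q = 1. On the coaction of
    a tensor with first factor g it produces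
    \<open>S'(g2 q S(y)) g1 = \<epsilon>(g) S'(q S(y))\<close>, which is \<open>sec_map\<close>
    after the counit. Coinvariance equates the two.\<close>
  define G where "G = (\<lambda>l x q. if l = [] then 0 else F (S' q * hd l # tl l) x)"
  have "mlin sX (\<lambda>l x. G l x q)" for q
    by (rule mlin_Cons; simp add: G_def; (intro L)?)
  moreover have "lin sH (*) (G l x)" for l x
    unfolding G_def by (cases "l = []"; simp; (intro L)?)
  ultimately have G: "tri G" by (simp add: tri_def)
  have "sec_map n (counit0 n v) F = v (counit0_form (sec_form F))"
    by (simp add: dualD(3)[OF dual_sec_map c F] dualD(3)[OF dual_counit0 v1 mlin_forms(5)[OF F]])
  also have "\<dots> = v (coact_form G)"
  proof (rule sp_cong[OF v1 mlin_counit0_form[OF mlin_forms(5)[OF F]] mlin_coact_form[OF G]])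
    fix l :: "'h list" and x assume "length l = Suc n"
    then obtain g hs where g: "l = g # hs" by (auto simp: length_Suc_conv)
    have "coact_form G l x = Sw g (\<lambda>a b. sm (pl hs) (\<lambda>l q. Cs x (\<lambda>y x0. F (S' (q * S y) * (S' b * a) # l) x0)))"
      by (simp add: g coact_form_def G_def antipode_inv_mult mult.assoc)
    also have "\<dots> = \<epsilon> g * sm (pl hs) (\<lambda>l q. Cs x (\<lambda>y x0. F (S' (q * S y) * 1 # l) x0))"
      by (rule Sw_antipode_inv(1)[where f = "\<lambda>w. sm (pl hs) (\<lambda>l q. Cs x (\<lambda>y x0. F (S' (q * S y) * w # l) x0))"]) (intro L)
    also have "\<dots> = counit0_form (sec_form F) l x"
      by (simp add: g counit0_form_def sec_form_def coact_form_def)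
    finally show "counit0_form (sec_form F) l x = coact_form G l x" by simp
  qed
  also have "\<dots> = v (\<lambda>l x. G l x 1)" by (rule v2[OF G])
  also have "\<dots> = v F"
    by (rule sp_cong[OF v1 triD(1)[OF G] F]) (auto simp: G_def length_Suc_conv)
  finally show "sec_map n (counit0 n v) F = v F" .
qed

text \<open>
  Modulo the relations, \<open>\<tau>\<^sub>c(a\<^sub>(\<^sub>1\<^sub>) \<otimes> a\<^sub>(\<^sub>2\<^sub>) u) \<equiv> \<epsilon>(a) \<tau>\<^sub>c(1 \<otimes> u)\<close>.  The form \<open>G\<close> below is \<open>\<alpha>\<close> followed by \<open>F\<close>, with
  \<open>S\<^sup>-\<^sup>1\<close> of the coaction component multiplied into the last factor from the right.
\<close>

lemma tau_c_alpha_tau_a: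
  assumes v: "v \<in> CC n"
  shows "tc n (alpha H M n (ta n v)) - alpha H M n v \<in> WW n"
proof (rule WW_I)
  have v1: "v \<in> sp (Suc n)" and v2: "\<And>G. tri G \<Longrightarrow> v (coact_form G) = v (\<lambda>l x. G l x 1)"
    using v by (auto simp: coinvariants_iff)
  note d = dual_comp[OF dual_comp[OF dual_tau_a[of n] dual_alpha] dual_tau_c]
  show "tc n (alpha H M n (ta n v)) - alpha H M n v \<in> sp (Suc n)"
    by (intro sp_diff dualD(2)[OF d] dualD(2)[OF dual_alpha] v1)
  fix F assume F0: "inv_form (Suc n) F"
  note F = inv_formD(1)[OF F0]
  note L = xforms atoms[OF F]
  define T where "T = tau_c_form F"
  have T0: "inv_form (Suc n) T" unfolding T_def by (rule inv_form_tau_c[OF F0])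
  note LT = xforms atoms[OF inv_formD(1)[OF T0]]
  define G where "G = (\<lambda>l x q. if l = [] then 0 else
    sm (al (butlast l)) (\<lambda>l' p. Sw (p * last l) (\<lambda>a c. F (l' @ [a * S' q]) (ac c x))))"
  have Gs: "G (l @ [u]) x q = sm (al l) (\<lambda>l' p. Sw (p * u) (\<lambda>a c. F (l' @ [a * S' q]) (ac c x)))" for l u x q
    by (simp add: G_def)
  have "mlin sX (\<lambda>l x. G l x q)" for q
    by (rule mlin_snocI; (unfold Gs)?; (intro L)?) (simp add: G_def lin_zero)
  moreover have "lin sH (*) (G l x)" for l x
    unfolding G_def by (cases "l = []"; simp; (intro L)?)
  ultimately have G: "tri G" by (simp add: tri_def)
  have a: "tau_form (al_form T) (hs @ [h]) x = sm (al hs) (\<lambda>l p. Cs (ac (p * h) x) (\<lambda>y x0. F (l @ [y]) x0))"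
    if hs: "length hs = n" for hs h x
  proof -
    have "tau_form (al_form T) (hs @ [h]) x
      = Sw h (\<lambda>a b. sm (al hs) (\<lambda>l p. sm (dg a (1 # l)) (\<lambda>l' c. T l' (ac c (ac (p * b) x)))))"
      by (simp add: al_form_def act_mult) (intro sm_cong, rule sm_swap)
    also have "\<dots> = Sw h (\<lambda>a b. sm (al hs) (\<lambda>l p. \<epsilon> a * T (1 # l) (ac (p * b) x)))"
      by (intro sm_cong inv_formD(2)[OF T0]) (auto dest!: length_al simp: hs)
    also have "\<dots> = sm (al hs) (\<lambda>l p. Sw h (\<lambda>a b. \<epsilon> a * T (1 # l) (ac (p * b) x)))"
      by (rule sm_swap)
    also have "\<dots> = sm (al hs) (\<lambda>l p. T (1 # l) (ac (p * h) x))"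
      by (intro sm_cong Sw_counit) (intro LT)
    finally show ?thesis by (simp add: T_def)
  qed
  have b: "sm (al hs) (\<lambda>l p. Cs (ac (p * h) x) (\<lambda>y x0. F (l @ [y]) x0)) = coact_form G (hs @ [h]) x" for hs h x
  proof -
    \<comment> \<open>By the anti-Yetter-Drinfeld condition the coaction of (p h) x carries S' of
      the last component of p h. The part p3 coming from p is isolated, since
      \<open>al_comodule\<close> turns it into the coaction component q of the factors in
      \<open>hs\<close>. The result \<open>y S'(w) S'(q)\<close> is S' of q w S(y), the whole
      coaction component, as in G.\<close>
    define \<Psi> where "\<Psi> = (\<lambda>l p' p3. Sw h (\<lambda>u w. Sw (p' * u) (\<lambda>a c. Cs x (\<lambda>y x0.
      F (l @ [a * (y * (S' w * S' p3))]) (ac c x0)))))"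
    have 1: "Cs (ac (p * h) x) (\<lambda>y x0. F (l @ [y]) x0) = Sw p (\<lambda>p' p3. \<Psi> l p' p3)" for l p
    proof -
      have "Cs (ac (p * h) x) (\<lambda>y x0. F (l @ [y]) x0)
        = Sw (p * h) (\<lambda>r d. Sw r (\<lambda>a c. Cs x (\<lambda>y x0. F (l @ [a * y * S' d]) (ac c x0))))"
        by (rule Cs_act') (intro L)+
      also have "\<dots> = Sw p (\<lambda>p' p3. Sw h (\<lambda>u w. Sw (p' * u) (\<lambda>a c. Cs x (\<lambda>y x0. F (l @ [a * y * S' (p3 * w)]) (ac c x0)))))"
        by (rule Sw_mult) (intro L)+
      finally show ?thesis by (simp add: \<Psi>_def antipode_inv_mult mult.assoc)
    qed
    have "sm (al hs) (\<lambda>l p. Sw p (\<lambda>p' p3. \<Psi> l p' p3)) = sm (pl hs) (\<lambda>l0 q. sm (al l0) (\<lambda>l p. \<Psi> l p q))"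
      by (rule al_comodule) (unfold \<Psi>_def, (intro L)+)
    also have "\<dots> = sm (pl hs) (\<lambda>l0 q. Sw h (\<lambda>u w. Cs x (\<lambda>y x0. sm (al l0) (\<lambda>l p. Sw (p * u) (\<lambda>a c.
        F (l @ [a * (y * (S' w * S' q))]) (ac c x0))))))"
    proof (intro sm_cong)
      fix l0 q
      have "sm (al l0) (\<lambda>l p. \<Psi> l p q) = Sw h (\<lambda>u w. sm (al l0) (\<lambda>l p. Sw (p * u) (\<lambda>a c. Cs x (\<lambda>y x0.
          F (l @ [a * (y * (S' w * S' q))]) (ac c x0)))))"
        unfolding \<Psi>_def by (rule sm_swap)
      also have "\<dots> = Sw h (\<lambda>u w. sm (al l0) (\<lambda>l p. Cs x (\<lambda>y x0. Sw (p * u) (\<lambda>a c.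
          F (l @ [a * (y * (S' w * S' q))]) (ac c x0)))))"
        by (intro sm_cong sm_swap)
      also have "\<dots> = Sw h (\<lambda>u w. Cs x (\<lambda>y x0. sm (al l0) (\<lambda>l p. Sw (p * u) (\<lambda>a c.
          F (l @ [a * (y * (S' w * S' q))]) (ac c x0)))))"
        by (intro sm_cong sm_swap)
      finally show "sm (al l0) (\<lambda>l p. \<Psi> l p q) = Sw h (\<lambda>u w. Cs x (\<lambda>y x0. sm (al l0) (\<lambda>l p. Sw (p * u) (\<lambda>a c.
          F (l @ [a * (y * (S' w * S' q))]) (ac c x0)))))" .
    qed
    also have "\<dots> = coact_form G (hs @ [h]) x"
      unfolding coact_form_def pl_snoc Gs
      by (simp add: antipode_inv_mult mult.assoc)
    finally show ?thesis by (simp add: 1)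
  qed
  have c: "G (hs @ [h]) x 1 = al_form F (hs @ [h]) x" for hs h x
  proof -
    have "al_form F (hs @ [h]) x = sm (al hs) (\<lambda>l p. Sw p (\<lambda>p1 p2. Sw h (\<lambda>h1 h2. F (l @ [p1 * h1]) (ac (p2 * h2) x))))"
      unfolding al_form_def by (rule al_snoc) (intro L)
    also have "\<dots> = sm (al hs) (\<lambda>l p. Sw (p * h) (\<lambda>a c. F (l @ [a]) (ac c x)))"
      by (intro sm_cong Sw_mult[symmetric]) (intro L)+
    finally show ?thesis by (simp add: Gs)
  qed
  have "tc n (alpha H M n (ta n v)) F = v (tau_form (al_form T))"
    unfolding T_def by (rule dualD(3)[OF d v1 F])
  also have "\<dots> = v (coact_form G)"
  proof (rule sp_cong[OF v1 mlin_tau_form[OF mlin_forms(2)[OF inv_formD(1)[OF T0]]] mlin_coact_form[OF G]])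
    fix l :: "'h list" and x assume l: "length l = Suc n"
    then obtain hs h where "l = hs @ [h]" "length hs = n" by (cases l rule: rev_cases) auto
    then show "tau_form (al_form T) l x = coact_form G l x" using a b by simp
  qed
  also have "\<dots> = v (\<lambda>l x. G l x 1)" by (rule v2[OF G])
  also have "\<dots> = v (al_form F)"
  proof (rule sp_cong[OF v1 triD(1)[OF G] mlin_forms(2)[OF F]])
    fix l :: "'h list" and x assume l: "length l = Suc n"
    then show "G l x 1 = al_form F l x" using c by (cases l rule: rev_cases) auto
  qed
  also have "\<dots> = alpha H M n v F" by (rule dualD(3)[OF dual_alpha v1 F, symmetric])
  finally show "(tc n (alpha H M n (ta n v)) - alpha H M n v) F = 0" by simp
qed

lemma alpha_kernel:
  assumes v: "v \<in> CC n" and a: "alpha H M n v \<in> WW n"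
  shows "v = 0"
proof -
  note v1 = coinvariants_sp[OF v]
  have c: "counit0 n v \<in> sp n" by (rule dualD(2)[OF dual_counit0 v1])
  have "al_map n (counit0 n v) = 0" using pi_map_WW[OF a] pi_alpha[OF v1] by simp
  then have "counit0 n v = 0" using al_map_inverse(1)[OF c] dual_0[OF dual_bq_map] by simp
  then show ?thesis using sec_map_counit0[OF v] dual_0[OF dual_sec_map] by simp
qed

section \<open>Congruence modulo the relations and maps that descend to the quotient\<close>

lemma WW_add: "u \<in> WW n \<Longrightarrow> v \<in> WW n \<Longrightarrow> u + v \<in> WW n"
  and WW_diff: "u \<in> WW n \<Longrightarrow> v \<in> WW n \<Longrightarrow> u - v \<in> WW n"
  and WW_scale: "u \<in> WW n \<Longrightarrow> fscale c u \<in> WW n"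
  and WW_0: "0 \<in> WW n"
  using WW_subspace[of n] by (auto simp: fs.subspace_def intro: fs.subspace_diff)

definition cong_mod :: "nat \<Rightarrow> ('k, 'h, 'x) tensor \<Rightarrow> ('k, 'h, 'x) tensor \<Rightarrow> bool" where
  "cong_mod n u v \<longleftrightarrow> u \<in> sp (Suc n) \<and> v \<in> sp (Suc n) \<and> u - v \<in> WW n"

lemma cong_mod_refl: "u \<in> sp (Suc n) \<Longrightarrow> cong_mod n u u"
  by (simp add: cong_mod_def WW_0)

lemma cong_mod_sym: "cong_mod n u v \<Longrightarrow> cong_mod n v u"
  using WW_diff[OF WW_0, of "u - v" n] by (auto simp: cong_mod_def)

lemma cong_mod_trans: "cong_mod n u v \<Longrightarrow> cong_mod n v w \<Longrightarrow> cong_mod n u w"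
  using WW_add[of "u - v" n "v - w"] by (auto simp: cong_mod_def)

lemma alpha_in: "v \<in> CC n \<Longrightarrow> alpha H M n v \<in> sp (Suc n)"
  by (rule dualD(2)[OF dual_alpha coinvariants_sp])

lemma alpha_onto:
  assumes u: "u \<in> sp (Suc n)"
  obtains v where "v \<in> CC n" "cong_mod n (alpha H M n v) u"
proof -
  have p: "pi_map n u \<in> sp n" by (rule dualD(2)[OF dual_pi_map u])
  have b: "bq_map n (pi_map n u) \<in> sp n" by (rule dualD(2)[OF dual_bq_map p])
  let ?v = "sec_map n (bq_map n (pi_map n u))"
  have v: "?v \<in> CC n" by (rule sec_map_coinvariants[OF b])
  have a: "alpha H M n ?v \<in> sp (Suc n)" by (rule alpha_in[OF v])
  have "pi_map n (alpha H M n ?v) = pi_map n u"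
    by (simp add: pi_alpha coinvariants_sp[OF v] counit0_sec_map[OF b] al_map_inverse(2)[OF p])
  then have "alpha H M n ?v - u \<in> WW n"
    using WW_diff[OF one_pi[OF u] one_pi[OF a]] by simp
  then show thesis using that[OF v] a u by (simp add: cong_mod_def)
qed

definition descends :: "nat \<Rightarrow> nat \<Rightarrow> (('k, 'h, 'x) tensor \<Rightarrow> ('k, 'h, 'x) tensor) \<Rightarrow> bool" where
  "descends n m f \<longleftrightarrow> (\<exists>P. dual (Suc n) (Suc m) f P) \<and> (\<forall>u\<in>WW n. f u \<in> WW m)"

lemma descends_cong_mod:
  assumes "descends n m f" "cong_mod n u v"
  shows "cong_mod m (f u) (f v)"
proof -
  obtain P where P: "dual (Suc n) (Suc m) f P" using assms by (auto simp: descends_def)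
  have "f (u - v) \<in> WW m" using assms by (auto simp: descends_def cong_mod_def)
  then show ?thesis using assms(2) dualD(2)[OF P] dual_diff[OF P, of u v] by (simp add: cong_mod_def)
qed

lemma descends_comp: "descends n m f \<Longrightarrow> descends m r g \<Longrightarrow> descends n r (\<lambda>u. g (f u))"
  unfolding descends_def using dual_comp[of "Suc n" "Suc m" f _ "Suc r" g] by auto

lemma descends_fun_cong:
  assumes "descends n m f" "\<And>u. u \<in> sp (Suc n) \<Longrightarrow> f u = g u"
  shows "descends n m g"
proof -
  obtain P where P: "dual (Suc n) (Suc m) f P" and f: "\<And>u. u \<in> WW n \<Longrightarrow> f u \<in> WW m"
    using assms(1) by (auto simp: descends_def)
  have "g u \<in> WW m" if "u \<in> WW n" for u
    using f[OF that] assms(2)[of u] WW_sp[of n] that by auto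
  then show ?thesis using dual_fun_cong[OF P assms(2)] by (auto simp: descends_def)
qed

text \<open>Dual formulation: the relations are cut out by the invariant forms, so a map preserves
  relations when its transpose preserves invariance.\<close>

lemma descendsI:
  assumes f: "dual (Suc n) (Suc m) f P" and inv: "\<And>F. inv_form (Suc m) F \<Longrightarrow> inv_form (Suc n) (P F)"
  shows "descends n m f"
  unfolding descends_def
proof (intro conjI ballI exI[of _ P] f)
  fix u assume u: "u \<in> WW n"
  then have u': "u \<in> sp (Suc n)" using WW_sp by blast
  show "f u \<in> WW m"
    by (rule WW_I) (simp_all add: dualD[OF f] u' inv_formD(1) inv_form_WW[OF u inv])
qed

lemma descends_tau_c: "descends n n (tc n)"
  by (rule descendsI[OF dual_tau_c inv_form_tau_c])

lemma descends_coface0: "descends n (Suc n) (coface0 H M n)"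
  by (rule descendsI[OF dual_coface0 inv_form_split])

lemma descends_counit0: "descends (Suc n) n (counit0 (Suc n))"
  by (rule descendsI[OF dual_counit0 inv_form_counit0])

text \<open>
  Injectivity of \<open>\<tau>\<^sub>c\<close> modulo the relations follows from the bijectivity of \<open>q \<alpha>\<close> and of \<open>\<tau>\<^sub>a\<close>.
\<close>

lemma descends_tau_c_inv: "descends n n (tau_c_inv n)"
  unfolding descends_def
proof (intro conjI ballI exI[of _ tau_c_inv_form] dual_tau_c_inv)
  fix u assume u: "u \<in> WW n"
  then have u': "u \<in> sp (Suc n)" using WW_sp by blast
  have w: "tau_c_inv n u \<in> sp (Suc n)" by (rule dualD(2)[OF dual_tau_c_inv u'])
  \<comment> \<open>The preimage under \<open>tc\<close> is congruent to \<alpha>(v) for a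
    coinvariant v. Then \<alpha> of the inverse rotation of v is congruent to \<open>tc\<close> of
    \<alpha>(v), hence to u and to 0; the trivial kernel gives v = 0, and the preimage is a
    relation.\<close>
  obtain v where v: "v \<in> CC n" "cong_mod n (alpha H M n v) (tau_c_inv n u)" using alpha_onto[OF w] by blast
  have i: "tau_a_inv n v \<in> CC n" by (rule tau_a_inv_coinvariants[OF v(1)])
  have "cong_mod n (tc n (alpha H M n v)) u"
    using descends_cong_mod[OF descends_tau_c v(2)] tau_c_inverse(2)[OF u'] by simp
  then have "tc n (alpha H M n v) \<in> WW n" using WW_add[of "tc n (alpha H M n v) - u" n u] u by (simp add: cong_mod_def)
  moreover have "tc n (alpha H M n v) - alpha H M n (tau_a_inv n v) \<in> WW n"
    using tau_c_alpha_tau_a[OF i] tau_a_inverse(2)[OF coinvariants_sp[OF v(1)]] by simp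
  ultimately have "alpha H M n (tau_a_inv n v) \<in> WW n"
    using WW_diff[of "tc n (alpha H M n v)" n "tc n (alpha H M n v) - alpha H M n (tau_a_inv n v)"] by simp
  then have "tau_a_inv n v = 0" by (rule alpha_kernel[OF i])
  then have "v = 0" using tau_a_inverse(2)[OF coinvariants_sp[OF v(1)]] dual_0[OF dual_tau_a, of n] by simp
  then have "cong_mod n 0 (tau_c_inv n u)" using v(2) dual_0[OF dual_alpha] by simp
  then show "tau_c_inv n u \<in> WW n" using cong_mod_sym[of n 0 "tau_c_inv n u"] by (simp add: cong_mod_def)
qed

end


section \<open>The isomorphism of cyclic modules\<close>

text \<open>Since N is not known to be a group in advance, compatibility with zero is assumed of f
  and cannot be deduced from additivity.\<close>

lemma module_transport:
  fixes R (structure)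
  assumes M: "Module.module R M" and f: "bij_betw f (carrier M) (carrier N)"
    and add: "\<And>u v. u \<in> carrier M \<Longrightarrow> v \<in> carrier M \<Longrightarrow> f (u \<oplus>\<^bsub>M\<^esub> v) = f u \<oplus>\<^bsub>N\<^esub> f v"
    and smult: "\<And>c v. c \<in> carrier R \<Longrightarrow> v \<in> carrier M \<Longrightarrow> f (c \<odot>\<^bsub>M\<^esub> v) = c \<odot>\<^bsub>N\<^esub> f v"
    and zero: "f \<zero>\<^bsub>M\<^esub> = \<zero>\<^bsub>N\<^esub>"
  shows "Module.module R N"
proof -
  interpret M: Module.module R M by fact
  have N: "carrier N = f ` carrier M" using f by (simp add: bij_betw_def)
  show ?thesis
  proof (rule moduleI[OF M.is_cring abelian_groupI])
    show "\<exists>y\<in>carrier N. y \<oplus>\<^bsub>N\<^esub> x = \<zero>\<^bsub>N\<^esub>" if x: "x \<in> carrier N" for x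
    proof -
      obtain v where v: "v \<in> carrier M" "x = f v" using x N by auto
      have "f (\<ominus>\<^bsub>M\<^esub> v) \<oplus>\<^bsub>N\<^esub> x = \<zero>\<^bsub>N\<^esub>"
        using v add[of "\<ominus>\<^bsub>M\<^esub> v" v] by (simp add: M.l_neg zero)
      then show ?thesis using v N by auto
    qed
  qed (auto simp: N add[symmetric] smult[symmetric] zero[symmetric] M.a_ac M.smult_l_distr
      M.smult_r_distr M.smult_assoc1)
qed

lemma mod_hom_transport:
  assumes M: "Module.module R M" and g: "g \<in> mod_hom R M M'"
    and f: "f ` carrier M = carrier N" and f': "f' ` carrier M' \<subseteq> carrier N'"
    and add: "\<And>u v. u \<in> carrier M \<Longrightarrow> v \<in> carrier M \<Longrightarrow> f (u \<oplus>\<^bsub>M\<^esub> v) = f u \<oplus>\<^bsub>N\<^esub> f v"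
      "\<And>u v. u \<in> carrier M' \<Longrightarrow> v \<in> carrier M' \<Longrightarrow> f' (u \<oplus>\<^bsub>M'\<^esub> v) = f' u \<oplus>\<^bsub>N'\<^esub> f' v"
    and smult: "\<And>c v. c \<in> carrier R \<Longrightarrow> v \<in> carrier M \<Longrightarrow> f (c \<odot>\<^bsub>M\<^esub> v) = c \<odot>\<^bsub>N\<^esub> f v"
      "\<And>c v. c \<in> carrier R \<Longrightarrow> v \<in> carrier M' \<Longrightarrow> f' (c \<odot>\<^bsub>M'\<^esub> v) = c \<odot>\<^bsub>N'\<^esub> f' v"
    and comm: "\<And>v. v \<in> carrier M \<Longrightarrow> g' (f v) = f' (g v)"
  shows "g' \<in> mod_hom R N N'"
proof -
  interpret M: Module.module R M by fact
  have g1: "\<And>v. v \<in> carrier M \<Longrightarrow> g v \<in> carrier M'"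
    "\<And>u v. u \<in> carrier M \<Longrightarrow> v \<in> carrier M \<Longrightarrow> g (u \<oplus>\<^bsub>M\<^esub> v) = g u \<oplus>\<^bsub>M'\<^esub> g v"
    "\<And>c v. c \<in> carrier R \<Longrightarrow> v \<in> carrier M \<Longrightarrow> g (c \<odot>\<^bsub>M\<^esub> v) = c \<odot>\<^bsub>M'\<^esub> g v"
    using g by (auto simp: mod_hom_def)
  show ?thesis
    unfolding mod_hom_def f[symmetric] using f'
    by (auto simp: comm g1 add[symmetric] smult[symmetric] image_subset_iff)
qed

text \<open>For the target only formulas are given. Every element is a value of f, and f commutes
  with the operations, so each cyclic identity is the image of the identity in the source.\<close>

lemma cyclic_module_transport:
  assumes Z: "cyclic_module R Z"
    and bij: "\<And>n. bij_betw (f n) (carrier (obj Z n)) (carrier (obj Z' n))"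
    and add: "\<And>n u v. u \<in> carrier (obj Z n) \<Longrightarrow> v \<in> carrier (obj Z n) \<Longrightarrow>
        f n (u \<oplus>\<^bsub>obj Z n\<^esub> v) = f n u \<oplus>\<^bsub>obj Z' n\<^esub> f n v"
    and smult: "\<And>n c v. c \<in> carrier R \<Longrightarrow> v \<in> carrier (obj Z n) \<Longrightarrow>
        f n (c \<odot>\<^bsub>obj Z n\<^esub> v) = c \<odot>\<^bsub>obj Z' n\<^esub> f n v"
    and zero: "\<And>n. f n \<zero>\<^bsub>obj Z n\<^esub> = \<zero>\<^bsub>obj Z' n\<^esub>"
    and face: "\<And>n j v. 1 \<le> n \<Longrightarrow> j \<le> n \<Longrightarrow> v \<in> carrier (obj Z n) \<Longrightarrow> face Z' n j (f n v) = f (n - 1) (face Z n j v)"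
    and degen: "\<And>n j v. j \<le> n \<Longrightarrow> v \<in> carrier (obj Z n) \<Longrightarrow> degen Z' n j (f n v) = f (n + 1) (degen Z n j v)"
    and tau: "\<And>n v. v \<in> carrier (obj Z n) \<Longrightarrow> tau Z' n (f n v) = f n (tau Z n v)"
  shows "cyclic_module_iso R Z Z' f"
proof -
  have C': "carrier (obj Z' n) = f n ` carrier (obj Z n)" for n using bij[of n] by (simp add: bij_betw_def)
  have pc: "para_cyclic_module R Z" and sm: "simplicial_module R Z"
    using Z by (auto simp: cyclic_module_def para_cyclic_module_def)
  note S = sm[unfolded simplicial_module_def]
  note S1 = S[THEN conjunct1, rule_format]
    and S2 = S[THEN conjunct2, THEN conjunct1, rule_format]
    and S3 = S[THEN conjunct2, THEN conjunct2, THEN conjunct1, rule_format]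
    and S4 = S[THEN conjunct2, THEN conjunct2, THEN conjunct2, THEN conjunct1, rule_format]
    and S5 = S[THEN conjunct2, THEN conjunct2, THEN conjunct2, THEN conjunct2, THEN conjunct1, rule_format]
    and S6 = S[THEN conjunct2, THEN conjunct2, THEN conjunct2, THEN conjunct2, THEN conjunct2, THEN conjunct1, rule_format]
    and S7 = S[THEN conjunct2, THEN conjunct2, THEN conjunct2, THEN conjunct2, THEN conjunct2, THEN conjunct2, THEN conjunct1, rule_format]
    and S8 = S[THEN conjunct2, THEN conjunct2, THEN conjunct2, THEN conjunct2, THEN conjunct2, THEN conjunct2, THEN conjunct2, rule_format]
  note P = pc[unfolded para_cyclic_module_def]
  note P2 = P[THEN conjunct2, THEN conjunct1, rule_format]
    and P3 = P[THEN conjunct2, THEN conjunct2, THEN conjunct1, rule_format]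
    and P4 = P[THEN conjunct2, THEN conjunct2, THEN conjunct2, THEN conjunct1, rule_format]
    and P5 = P[THEN conjunct2, THEN conjunct2, THEN conjunct2, THEN conjunct2, THEN conjunct1, rule_format]
    and P6 = P[THEN conjunct2, THEN conjunct2, THEN conjunct2, THEN conjunct2, THEN conjunct2, rule_format]
  note mZ = S1
  have hf: "face Z n j \<in> mod_hom R (obj Z n) (obj Z (n - 1))" if "1 \<le> n" "j \<le> n" for n j
    using S2 that by blast
  have hd: "degen Z n j \<in> mod_hom R (obj Z n) (obj Z (n + 1))" if "j \<le> n" for n j
    using S3 that by blast
  note ht = P2[THEN conjunct1] and bt = P2[THEN conjunct2]
  have cf: "face Z n j v \<in> carrier (obj Z (n - 1))" if "1 \<le> n" "j \<le> n" "v \<in> carrier (obj Z n)" for n j v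
    using hf[OF that(1,2)] that(3) by (auto simp: mod_hom_def)
  have cd: "degen Z n j v \<in> carrier (obj Z (n + 1))" if "j \<le> n" "v \<in> carrier (obj Z n)" for n j v
    using hd[OF that(1)] that(2) by (auto simp: mod_hom_def)
  have ct: "tau Z n v \<in> carrier (obj Z n)" if "v \<in> carrier (obj Z n)" for n v
    using ht[of n] that by (auto simp: mod_hom_def)
  note cl = cf cd ct
  have im: "f n ` carrier (obj Z n) = carrier (obj Z' n)" "f n ` carrier (obj Z n) \<subseteq> carrier (obj Z' n)" for n
    by (simp_all add: C')
  have mZ': "Module.module R (obj Z' n)" for n
    by (rule module_transport[OF mZ bij add smult zero])
  have hf': "face Z' n j \<in> mod_hom R (obj Z' n) (obj Z' (n - 1))" if "1 \<le> n" "j \<le> n" for n j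
    by (rule mod_hom_transport[OF mZ hf[OF that] im(1) im(2)]) (use that in \<open>auto simp: add smult face\<close>)
  have hd': "degen Z' n j \<in> mod_hom R (obj Z' n) (obj Z' (n + 1))" if "j \<le> n" for n j
    by (rule mod_hom_transport[OF mZ hd[OF that] im(1) im(2)]) (use that in \<open>auto simp: add smult degen\<close>)
  have ht': "tau Z' n \<in> mod_hom R (obj Z' n) (obj Z' n)" for n
    by (rule mod_hom_transport[OF mZ ht im(1) im(2)]) (auto simp: add smult tau)
  have bt': "bij_betw (tau Z' n) (carrier (obj Z' n)) (carrier (obj Z' n))" for n
  proof -
    have "inj_on (tau Z' n) (carrier (obj Z' n))"
    proof (rule inj_onI)
      fix x y assume "x \<in> carrier (obj Z' n)" "y \<in> carrier (obj Z' n)" and e: "tau Z' n x = tau Z' n y"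
      then obtain u v where u: "u \<in> carrier (obj Z n)" "x = f n u" and v: "v \<in> carrier (obj Z n)" "y = f n v"
        by (auto simp: C')
      have "f n (tau Z n u) = f n (tau Z n v)" using e u v by (simp add: tau)
      then have "tau Z n u = tau Z n v" using bij[of n] ct u v by (auto simp: bij_betw_def dest!: inj_onD)
      then have "u = v" using bt[of n] u v by (auto simp: bij_betw_def dest!: inj_onD)
      then show "x = y" using u v by simp
    qed
    moreover have "tau Z' n ` f n ` carrier (obj Z n) = f n ` tau Z n ` carrier (obj Z n)"
      unfolding image_image by (rule image_cong) (auto simp: tau)
    ultimately show ?thesis using bt[of n] by (simp add: bij_betw_def C')
  qed
  have simp': "simplicial_module R Z'"
    unfolding simplicial_module_def C'
  proof (intro conjI allI ballI impI mZ')
    show "face Z' (n - 1) i (face Z' n j w) = face Z' (n - 1) (j - 1) (face Z' n i w)"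
      if w: "w \<in> f n ` carrier (obj Z n)" and ij: "2 \<le> n \<and> i < j \<and> j \<le> n" for n i j w
    proof -
      obtain v where v: "v \<in> carrier (obj Z n)" "w = f n v" using w by blast
      have "face Z (n - 1) i (face Z n j v) = face Z (n - 1) (j - 1) (face Z n i v)"
        by (rule S4[OF v(1) ij])
      moreover have "1 \<le> n" "1 \<le> n - 1" "i \<le> n" "i \<le> n - 1" "j - 1 \<le> n - 1" "j \<le> n" using ij by auto
      ultimately show ?thesis using v face[of n] face[of "n - 1"] cf[of n] by simp
    qed
    show "degen Z' (n + 1) i (degen Z' n j w) = degen Z' (n + 1) (j + 1) (degen Z' n i w)"
      if w: "w \<in> f n ` carrier (obj Z n)" and ij: "i \<le> j \<and> j \<le> n" for n i j w
    proof -
      obtain v where v: "v \<in> carrier (obj Z n)" "w = f n v" using w by blast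
      have "degen Z (n + 1) i (degen Z n j v) = degen Z (n + 1) (j + 1) (degen Z n i v)"
        by (rule S5[OF v(1) ij])
      then show ?thesis using v ij degen[of _ n] degen[of _ "n + 1"] cd[of _ n] by simp
    qed
    show "face Z' (n + 1) i (degen Z' n j w) = degen Z' (n - 1) (j - 1) (face Z' n i w)"
      if w: "w \<in> f n ` carrier (obj Z n)" and ij: "i < j \<and> j \<le> n" for n i j w
    proof -
      obtain v where v: "v \<in> carrier (obj Z n)" "w = f n v" using w by blast
      have "face Z (n + 1) i (degen Z n j v) = degen Z (n - 1) (j - 1) (face Z n i v)"
        by (rule S6[OF v(1) ij])
      moreover have "j - Suc 0 \<le> n - Suc 0" using ij by auto
      ultimately show ?thesis
        using v ij degen[of _ n] degen[of "j - 1" "n - 1" "face Z n i v"] cd[of _ n] face[of n] cf[of n] face[of "n + 1"] by simp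
    qed
    show "face Z' (n + 1) j (degen Z' n j w) = w" "face Z' (n + 1) (j + 1) (degen Z' n j w) = w"
      if w: "w \<in> f n ` carrier (obj Z n)" and ij: "j \<le> n" for n j w
    proof -
      obtain v where v: "v \<in> carrier (obj Z n)" "w = f n v" using w by blast
      have "face Z (n + 1) j (degen Z n j v) = v" "face Z (n + 1) (j + 1) (degen Z n j v) = v"
        using S7[OF v(1) ij] by simp_all
      then show "face Z' (n + 1) j (degen Z' n j w) = w" "face Z' (n + 1) (j + 1) (degen Z' n j w) = w"
        using v ij degen[of _ n] cd[of _ n] face[of "n + 1"] by simp_all
    qed
    show "face Z' (n + 1) i (degen Z' n j w) = degen Z' (n - 1) j (face Z' n (i - 1) w)"
      if w: "w \<in> f n ` carrier (obj Z n)" and ij: "j + 1 < i \<and> i \<le> n + 1" for n i j w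
    proof -
      obtain v where v: "v \<in> carrier (obj Z n)" "w = f n v" using w by blast
      have "face Z (n + 1) i (degen Z n j v) = degen Z (n - 1) j (face Z n (i - 1) v)"
        by (rule S8[OF v(1) ij])
      moreover have "j \<le> n - Suc 0" "i - Suc 0 \<le> n" using ij by auto
      ultimately show ?thesis
        using v ij degen[of _ n] degen[of j "n - 1" "face Z n (i - 1) v"] cd[of _ n] face[of n] cf[of n] face[of "n + 1"] by simp
    qed
  qed (use hf' hd' in \<open>auto simp: C'\<close>)
  have pc': "para_cyclic_module R Z'"
    unfolding para_cyclic_module_def C'
  proof (intro conjI allI ballI impI simp' ht')
    show "bij_betw (tau Z' n) (f n ` carrier (obj Z n)) (f n ` carrier (obj Z n))" for n
      using bt'[of n] by (simp add: C')
    show "face Z' n j (tau Z' n w) = tau Z' (n - 1) (face Z' n (j - 1) w)"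
      if w: "w \<in> f n ` carrier (obj Z n)" and ij: "1 \<le> j \<and> j \<le> n" for n j w
    proof -
      obtain v where v: "v \<in> carrier (obj Z n)" "w = f n v" using w by blast
      have "face Z n j (tau Z n v) = tau Z (n - 1) (face Z n (j - 1) v)"
        by (rule P3[OF v(1) ij])
      moreover have "1 \<le> n" "j - Suc 0 \<le> n" using ij by auto
      ultimately show ?thesis using v ij face[of n] cf[of n] by (simp add: tau ct)
    qed
    show "degen Z' n j (tau Z' n w) = tau Z' (n + 1) (degen Z' n (j - 1) w)"
      if w: "w \<in> f n ` carrier (obj Z n)" and ij: "1 \<le> j \<and> j \<le> n" for n j w
    proof -
      obtain v where v: "v \<in> carrier (obj Z n)" "w = f n v" using w by blast
      have "degen Z n j (tau Z n v) = tau Z (n + 1) (degen Z n (j - 1) v)"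
        by (rule P4[OF v(1) ij])
      moreover have "j - Suc 0 \<le> n" using ij by auto
      ultimately show ?thesis using v ij degen[of _ n] cd[of _ n] tau[of _ "n + 1"] tau[of _ n] ct[of _ n] by simp
    qed
    show "face Z' n 0 (tau Z' n w) = face Z' n n w"
      if w: "w \<in> f n ` carrier (obj Z n)" and ij: "1 \<le> n" for n w
    proof -
      obtain v where v: "v \<in> carrier (obj Z n)" "w = f n v" using w by blast
      have "face Z n 0 (tau Z n v) = face Z n n v"
        by (rule P5[OF v(1) ij])
      then show ?thesis using v ij by (simp add: face tau cl)
    qed
    show "degen Z' n 0 (tau Z' n w) = tau Z' (n + 1) (tau Z' (n + 1) (degen Z' n n w))"
      if w: "w \<in> f n ` carrier (obj Z n)" for n w
    proof -
      obtain v where v: "v \<in> carrier (obj Z n)" "w = f n v" using w by blast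
      have "degen Z n 0 (tau Z n v) = tau Z (n + 1) (tau Z (n + 1) (degen Z n n v))"
        by (rule P6[OF v(1)])
      then show ?thesis
        using v degen[of _ n] cd[of _ n] tau[of _ "n + 1"] tau[of _ n] ct[of _ n] ct[of _ "n + 1"] by simp
    qed
  qed
  have it: "(tau Z' n ^^ m) (f n v) = f n ((tau Z n ^^ m) v) \<and> (tau Z n ^^ m) v \<in> carrier (obj Z n)"
    if v: "v \<in> carrier (obj Z n)" for n m v
    by (induction m) (auto simp: v tau ct)
  have "cyclic_module R Z'"
    unfolding cyclic_module_def C'
  proof (intro conjI allI ballI pc')
    fix n w assume "w \<in> f n ` carrier (obj Z n)"
    then obtain v where v: "v \<in> carrier (obj Z n)" "w = f n v" by blast
    have "(tau Z n ^^ (n + 1)) v = v" using Z v unfolding cyclic_module_def by blast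
    then show "(tau Z' n ^^ (n + 1)) w = w" using it[OF v(1), of "n + 1"] v(2) by metis
  qed
  moreover have "f n \<in> mod_hom R (obj Z n) (obj Z' n)" for n
    by (auto simp: mod_hom_def C' add smult)
  ultimately show ?thesis
    unfolding cyclic_module_iso_def using Z bij by (auto simp: face degen tau)
qed

lemma subspace_module_module:
  assumes V: "module.subspace (fscale :: 'k::field \<Rightarrow> ('i \<Rightarrow> 'k) \<Rightarrow> _) V"
  shows "Module.module (ring_of_type_algebra :: 'k ring) (subspace_module V)"
proof -
  interpret fs: vector_space "fscale :: 'k \<Rightarrow> ('i \<Rightarrow> 'k) \<Rightarrow> _" by (rule vector_space_fscale)
  note V' = fs.subspace_add[OF V] fs.subspace_0[OF V] fs.subspace_scale[OF V] fs.subspace_neg[OF V]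
  show ?thesis
  proof (rule moduleI[OF cring_from_type_algebra abelian_groupI])
    show "\<exists>y\<in>carrier (subspace_module V). y \<oplus>\<^bsub>subspace_module V\<^esub> x = \<zero>\<^bsub>subspace_module V\<^esub>"
      if "x \<in> carrier (subspace_module V)" for x
      using that V'(4)[of x] by (auto simp: subspace_module_def intro!: bexI[of _ "- x"])
  qed (auto simp: subspace_module_def ring_of_type_algebra_def V' fs.scale_left_distrib fs.scale_right_distrib add.commute add.assoc)
qed


context ayd_module
begin

interpretation fs: vector_space "fscale :: 'k \<Rightarrow> ('i \<Rightarrow> 'k) \<Rightarrow> _"
  by (rule vector_space_fscale)

abbreviation "R \<equiv> (ring_of_type_algebra :: 'k ring)"

lemma CC_subspace: "module.subspace fscale (CC n)"
  by (auto simp: fs.subspace_def coinvariants_iff sp_0 sp_add sp_scale fscale_apply)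

lemma carrier_subspace_module [simp]: "carrier (subspace_module V) = V"
  by (simp add: subspace_module_def)

lemma mod_hom_dual:
  assumes f: "dual (Suc n) m f P" and u: "\<And>u. u \<in> CC n \<Longrightarrow> f u \<in> CC m'"
  shows "f \<in> mod_hom R (subspace_module (CC n)) (subspace_module (CC m'))"
  using u dual_add[OF f] dual_scale[OF f] coinvariants_sp
  by (auto simp: mod_hom_def subspace_module_def)

lemma CMa_simps:
  "obj (CMa H M) n = subspace_module (CC n)" "face (CMa H M) = da" "degen (CMa H M) = sa" "tau (CMa H M) = ta"
  by (simp_all add: CMa_def Ta_def)

lemma cyclic_module_CMa: "cyclic_module R (CMa H M)"
proof -
  have simplicial: "simplicial_module R (CMa H M)"
    unfolding simplicial_module_def CMa_simps carrier_subspace_module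
  proof (intro conjI allI ballI impI)
    show "Module.module R (subspace_module (CC n))" for n
      by (rule subspace_module_module[OF CC_subspace])
    show "da n j \<in> mod_hom R (subspace_module (CC n)) (subspace_module (CC (n - 1)))" if nj: "1 \<le> n \<and> j \<le> n" for n j
    proof -
      obtain m where m: "n = Suc m" using nj by (cases n) auto
      show ?thesis
      proof (cases "j = n")
        case True
        show ?thesis unfolding True m
          by (rule mod_hom_dual[OF dual_face_a_last]) (auto intro: face_a_coinvariants)
      next
        case False
        then show ?thesis using nj unfolding m
          by (intro mod_hom_dual[OF dual_face_a]) (auto intro: face_a_coinvariants)
      qed
    qed
    show "sa n j \<in> mod_hom R (subspace_module (CC n)) (subspace_module (CC (n + 1)))" if "j \<le> n" for n j
      using mod_hom_dual[OF dual_degen_a[OF that], of "Suc n"] that by (simp add: degen_a_coinvariants)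
    fix n i j v assume v: "v \<in> CC n"
    show "da (n - 1) i (da n j v) = da (n - 1) (j - 1) (da n i v)" if ij: "2 \<le> n \<and> i < j \<and> j \<le> n"
    proof -
      have "n = Suc (Suc (n - 2))" using ij by arith
      then obtain m where "n = Suc (Suc m)" by blast
      then show ?thesis using face_face[of i j m v] coinvariants_sp[OF v] ij by simp
    qed
    show "sa (n + 1) i (sa n j v) = sa (n + 1) (j + 1) (sa n i v)" if "i \<le> j \<and> j \<le> n"
      using degen_degen[of i j n v] that coinvariants_sp[OF v] by simp
    show "da (n + 1) i (sa n j v) = sa (n - 1) (j - 1) (da n i v)" if ij: "i < j \<and> j \<le> n"
    proof -
      obtain m where "n = Suc m" using ij by (cases n) auto
      then show ?thesis using face_degen_less[of i j m v] coinvariants_sp[OF v] ij by simp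
    qed
    show "da (n + 1) j (sa n j v) = v" "da (n + 1) (j + 1) (sa n j v) = v" if "j \<le> n"
      using face_degen_eq[of j n v] face_degen_Suc[of j n v] that coinvariants_sp[OF v] by simp_all
    show "da (n + 1) i (sa n j v) = sa (n - 1) j (da n (i - 1) v)" if ij: "j + 1 < i \<and> i \<le> n + 1"
    proof -
      obtain m where "n = Suc m" using ij by (cases n) auto
      then show ?thesis using face_degen_greater[of j i m v] coinvariants_sp[OF v] ij by simp
    qed
  qed
  show ?thesis
    unfolding cyclic_module_def para_cyclic_module_def CMa_simps carrier_subspace_module
  proof (intro conjI allI ballI impI simplicial)
    show "bij_betw (ta n) (CC n) (CC n)" for n
      by (rule bij_betw_byWitness[of _ "tau_a_inv n"])
        (auto simp: tau_a_inverse coinvariants_sp tau_a_coinvariants tau_a_inv_coinvariants)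
    show "ta n \<in> mod_hom R (subspace_module (CC n)) (subspace_module (CC n))" for n
      by (rule mod_hom_dual[OF dual_tau_a tau_a_coinvariants])
    fix n j v assume v: "v \<in> CC n"
    show "da n j (ta n v) = ta (n - 1) (da n (j - 1) v)" if j: "1 \<le> j \<and> j \<le> n"
    proof -
      obtain m i where "n = Suc m" "j = Suc i" using j by (cases n; cases j) auto
      then show ?thesis using face_tau[of i m v] coinvariants_sp[OF v] j by simp
    qed
    show "sa n j (ta n v) = ta (n + 1) (sa n (j - 1) v)" if j: "1 \<le> j \<and> j \<le> n"
    proof -
      obtain i where "j = Suc i" using j by (cases j) auto
      then show ?thesis using degen_tau[of i n v] coinvariants_sp[OF v] j by simp
    qed
    show "da n 0 (ta n v) = da n n v" if n: "1 \<le> n"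
    proof -
      obtain m where "n = Suc m" using n by (cases n) auto
      then show ?thesis using face0_tau[of v m] coinvariants_sp[OF v] by simp
    qed
    show "sa n 0 (ta n v) = ta (n + 1) (ta (n + 1) (sa n n v))"
      using degen0_tau[of v n] coinvariants_sp[OF v] by simp
    show "(ta n ^^ (n + 1)) v = v"
      using tau_a_order[OF v] by simp
  qed
qed

section \<open>Cosets of the relations and the quotient module\<close>

definition coset :: "nat \<Rightarrow> ('k, 'h, 'x) tensor \<Rightarrow> ('k, 'h, 'x) tensor set" where
  "coset n u = {x. x - u \<in> WW n}"

lemma quot_proj_eq: "quot_proj H M n v = coset n v"
proof -
  have "quot_proj H M n v = (\<lambda>w. w + v) ` WW n"
    by (auto simp: quot_proj_def a_r_coset_def' Tc_def subspace_module_def)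
  also have "\<dots> = coset n v"
  proof -
    have "x \<in> (\<lambda>w. w + v) ` WW n" if "x - v \<in> WW n" for x
      using that by (rule image_eqI[rotated]) simp
    moreover have "(\<lambda>w. w + v) ` WW n \<subseteq> {x. x - v \<in> WW n}" by auto
    ultimately show ?thesis unfolding coset_def by blast
  qed
  finally show ?thesis .
qed

lemma coset_eqI:
  assumes "u - v \<in> WW n"
  shows "coset n u = coset n v"
proof -
  have "x - v \<in> WW n" if "x - u \<in> WW n" for x using WW_add[OF that assms] by simp
  moreover have "x - u \<in> WW n" if "x - v \<in> WW n" for x using WW_diff[OF that assms] by simp
  ultimately show ?thesis unfolding coset_def by blast
qed

lemma coset_eqD:
  assumes "coset n u = coset n v"
  shows "u - v \<in> WW n"
proof -
  have "u \<in> coset n u" by (simp add: coset_def WW_0)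
  then have "u \<in> coset n v" unfolding assms .
  then show ?thesis by (simp add: coset_def)
qed

lemma mem_set_add: "x \<in> set_add (subspace_module V) A B \<longleftrightarrow> (\<exists>a\<in>A. \<exists>b\<in>B. x = a + b)"
  by (auto simp: set_add_def' subspace_module_def)

lemma coset_add: "set_add (subspace_module V) (coset n u) (coset n v) = coset n (u + v)"
proof -
  have "x \<in> set_add (subspace_module V) (coset n u) (coset n v) \<longleftrightarrow> x \<in> coset n (u + v)" for x
  proof
    assume "x \<in> set_add (subspace_module V) (coset n u) (coset n v)"
    then obtain a b where "a - u \<in> WW n" "b - v \<in> WW n" "x = a + b"
      by (auto simp: mem_set_add coset_def)
    then show "x \<in> coset n (u + v)" using WW_add[of "a - u" n "b - v"] by (simp add: coset_def algebra_simps)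
  next
    assume "x \<in> coset n (u + v)"
    then have "x - v \<in> coset n u" "v \<in> coset n v" using WW_0 by (simp_all add: coset_def algebra_simps)
    then show "x \<in> set_add (subspace_module V) (coset n u) (coset n v)"
      unfolding mem_set_add by (intro bexI[where x = "x - v"] bexI[where x = v]) simp_all
  qed
  then show ?thesis by blast
qed

lemma WW_coset: "WW n = coset n 0"
  by (simp add: coset_def)

text \<open>Serves both scalar multiplication and induced maps: the image of a coset lies in one
  coset but can be smaller, for the scalar 0 even a single point, and adding the relations restores
  the whole coset.\<close>

lemma WW_set_add:
  assumes "\<And>x. x \<in> A \<Longrightarrow> x - u \<in> WW n" and "a \<in> A"
  shows "set_add (subspace_module V) (WW n) A = coset n u"
proof -
  have "x \<in> set_add (subspace_module V) (WW n) A \<longleftrightarrow> x \<in> coset n u" for x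
  proof
    assume "x \<in> set_add (subspace_module V) (WW n) A"
    then obtain w b where "w \<in> WW n" "b \<in> A" "x = w + b"
      by (auto simp: mem_set_add)
    then show "x \<in> coset n u" using WW_add[of w n "b - u"] assms(1)[of b] by (simp add: coset_def algebra_simps)
  next
    assume "x \<in> coset n u"
    then have "x - a \<in> WW n" using WW_diff[of "x - u" n "a - u"] assms by (simp add: coset_def)
    then show "x \<in> set_add (subspace_module V) (WW n) A"
      using assms(2) unfolding mem_set_add by (intro bexI[where x = "x - a"] bexI[where x = a]) simp_all
  qed
  then show ?thesis by blast
qed

lemma quot_module_simps:
  "carrier (quot_module (subspace_module V) (WW n)) = coset n ` V"
  "coset n u \<oplus>\<^bsub>quot_module (subspace_module V) (WW n)\<^esub> coset n v = coset n (u + v)"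
  "c \<odot>\<^bsub>quot_module (subspace_module V) (WW n)\<^esub> coset n u = coset n (fscale c u)"
  "\<zero>\<^bsub>quot_module (subspace_module V) (WW n)\<^esub> = coset n 0"
proof -
  have "WW n +>\<^bsub>subspace_module V\<^esub> v = coset n v" for v
    using quot_proj_eq[of n v] by (simp add: quot_proj_def a_r_coset_def' Tc_def subspace_module_def)
  then show "carrier (quot_module (subspace_module V) (WW n)) = coset n ` V"
    by (auto simp: quot_module_def A_RCOSETS_def')
  show "coset n u \<oplus>\<^bsub>quot_module (subspace_module V) (WW n)\<^esub> coset n v = coset n (u + v)"
    by (simp add: quot_module_def coset_add)
  have "WW n <+>\<^bsub>subspace_module V\<^esub> fscale c ` coset n u = coset n (fscale c u)"
    by (rule WW_set_add[of _ _ _ "fscale c u"])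
      (auto simp: coset_def WW_0 fs.scale_right_diff_distrib[symmetric] intro: WW_scale)
  then show "c \<odot>\<^bsub>quot_module (subspace_module V) (WW n)\<^esub> coset n u = coset n (fscale c u)"
    by (simp add: quot_module_def subspace_module_def)
  show "\<zero>\<^bsub>quot_module (subspace_module V) (WW n)\<^esub> = coset n 0"
    by (simp add: quot_module_def WW_coset)
qed

lemma descends_quot_map:
  assumes f: "descends n m f" and u: "u \<in> sp (Suc n)"
  shows "quot_map (subspace_module V) (WW m) f (coset n u) = coset m (f u)"
  unfolding quot_map_def
proof (rule WW_set_add)
  show "f u \<in> f ` coset n u" by (auto simp: coset_def WW_0)
  fix x assume "x \<in> f ` coset n u"
  then obtain a where a: "a - u \<in> WW n" "x = f a" by (auto simp: coset_def)
  have "(a - u) + u \<in> sp (Suc n)" using a(1) u WW_sp by (intro sp_add) auto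
  then show "x - f u \<in> WW m" using descends_cong_mod[OF f, of a u] a u by (simp add: cong_mod_def)
qed

text \<open>On the quotient g' corresponds to g under q \<alpha>. The relation is closed under
  composition, so conjugates under the rotations need no computation of their own.\<close>

definition induces :: "nat \<Rightarrow> nat \<Rightarrow> (('k, 'h, 'x) tensor \<Rightarrow> ('k, 'h, 'x) tensor) \<Rightarrow>
    (('k, 'h, 'x) tensor \<Rightarrow> ('k, 'h, 'x) tensor) \<Rightarrow> bool" where
  "induces n m g g' \<longleftrightarrow> descends n m g' \<and>
     (\<forall>v\<in>CC n. g v \<in> CC m \<and> cong_mod m (g' (alpha H M n v)) (alpha H M m (g v)))"

lemma inducesD:
  assumes "induces n m g g'"
  shows "descends n m g'" "v \<in> CC n \<Longrightarrow> g v \<in> CC m"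
    "v \<in> CC n \<Longrightarrow> cong_mod m (g' (alpha H M n v)) (alpha H M m (g v))"
  using assms by (simp_all add: induces_def)

lemma induces_comp:
  assumes g: "induces n m g g'" and h: "induces m r h h'"
  shows "induces n r (\<lambda>v. h (g v)) (\<lambda>v. h' (g' v))"
  unfolding induces_def
proof (intro conjI ballI descends_comp[OF inducesD(1)[OF g] inducesD(1)[OF h]])
  fix v assume v: "v \<in> CC n"
  show "h (g v) \<in> CC r" by (intro inducesD(2)[OF h] inducesD(2)[OF g] v)
  show "cong_mod r (h' (g' (alpha H M n v))) (alpha H M r (h (g v)))"
    by (rule cong_mod_trans[OF descends_cong_mod[OF inducesD(1)[OF h] inducesD(3)[OF g v]]
          inducesD(3)[OF h inducesD(2)[OF g v]]])
qed

lemma induces_funpow: "induces n n g g' \<Longrightarrow> induces n n (g ^^ j) (g' ^^ j)"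
proof (induction j)
  case 0
  have "descends n n (\<lambda>u. u)" unfolding descends_def using dual_id by blast
  then have "induces n n (\<lambda>u. u) (\<lambda>u. u)" by (simp add: induces_def cong_mod_refl alpha_in)
  then show ?case by (simp add: id_def)
next
  case (Suc j)
  from induces_comp[OF Suc.IH[OF Suc.prems] Suc.prems] show ?case by (simp add: o_def)
qed

lemma induces_cong:
  assumes "induces n m g g'" "\<And>v. v \<in> CC n \<Longrightarrow> g v = h v" "\<And>u. u \<in> sp (Suc n) \<Longrightarrow> g' u = h' u"
  shows "induces n m h h'"
  unfolding induces_def
proof (intro conjI ballI)
  have d: "descends n m g'" using assms(1) by (simp add: induces_def)
  show "descends n m h'" by (rule descends_fun_cong[OF d assms(3)])
  fix v assume v: "v \<in> CC n"
  show "h v \<in> CC m" "cong_mod m (h' (alpha H M n v)) (alpha H M m (h v))"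
    using assms(1) v unfolding assms(2)[OF v, symmetric] assms(3)[OF alpha_in[OF v], symmetric]
    by (simp_all add: induces_def)
qed

abbreviation "ti n \<equiv> inv_into (T_space H M n) (tc n)"

text \<open>Obtained from the congruence \<open>tau_c_alpha_tau_a\<close> by applying the inverse of
  \<open>tc\<close>, which respects congruence by \<open>descends_tau_c_inv\<close>.\<close>

lemma induces_tau: "induces n n (ta n) (ti n)"
proof (rule induces_cong)
  have "cong_mod n (tau_c_inv n (alpha H M n v)) (alpha H M n (ta n v))" if v: "v \<in> CC n" for v
  proof -
    have a: "alpha H M n (ta n v) \<in> sp (Suc n)" by (rule alpha_in[OF tau_a_coinvariants[OF v]])
    have "cong_mod n (tc n (alpha H M n (ta n v))) (alpha H M n v)"
      using tau_c_alpha_tau_a[OF v] a by (simp add: cong_mod_def alpha_in[OF v] dualD(2)[OF dual_tau_c])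
    from descends_cong_mod[OF descends_tau_c_inv this] show ?thesis
      unfolding tau_c_inverse(1)[OF a] by (rule cong_mod_sym)
  qed
  then show "induces n n (ta n) (tau_c_inv n)"
    by (simp add: induces_def descends_tau_c_inv tau_a_coinvariants)
qed (simp_all add: inv_into_tau_c)

lemma induces_tau_inv: "induces n n (tau_a_inv n) (tc n)"
  unfolding induces_def
proof (intro conjI ballI descends_tau_c tau_a_inv_coinvariants)
  fix v assume v: "v \<in> CC n"
  have i: "tau_a_inv n v \<in> CC n" by (rule tau_a_inv_coinvariants[OF v])
  show "cong_mod n (tc n (alpha H M n v)) (alpha H M n (tau_a_inv n v))"
    using tau_c_alpha_tau_a[OF i] tau_a_inverse(2)[OF coinvariants_sp[OF v]]
    by (simp add: cong_mod_def alpha_in[OF v] alpha_in[OF i] dualD(2)[OF dual_tau_c])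
qed

text \<open>The face of index 1 is the face of index 0 conjugated by \<open>ta\<close>, and the
  codegeneracy of index 0 is \<open>counit0\<close> conjugated by the inverse of \<open>tc\<close>.
  The two conjugations correspond, because q \<alpha> turns \<open>ta\<close> into that
  inverse.\<close>

lemma induces_codegen0: "induces (Suc n) n (da (Suc n) (Suc 0)) (codegen0 H M (Suc n))"
proof (rule induces_cong)
  have "induces (Suc n) n (da (Suc n) 0) (counit0 (Suc n))"
    unfolding induces_def
  proof (intro conjI ballI descends_counit0 face0_coinvariants)
    fix v assume v: "v \<in> CC (Suc n)"
    show "cong_mod n (counit0 (Suc n) (alpha H M (Suc n) v)) (alpha H M n (da (Suc n) 0 v))"
      using cong_mod_refl[OF alpha_in[OF face0_coinvariants[OF v]]] counit0_alpha[OF coinvariants_sp[OF v]] by simp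
  qed
  from induces_comp[OF induces_comp[OF induces_tau_inv this] induces_tau]
  show "induces (Suc n) n (\<lambda>v. ta n (da (Suc n) 0 (tau_a_inv (Suc n) v))) (\<lambda>u. ti n (counit0 (Suc n) (tc (Suc n) u)))" .
  show "ta n (da (Suc n) 0 (tau_a_inv (Suc n) v)) = da (Suc n) (Suc 0) v" if "v \<in> CC (Suc n)" for v
    by (simp add: face_a_conj coinvariants_sp[OF that])
  show "ti n (counit0 (Suc n) (tc (Suc n) u)) = codegen0 H M (Suc n) u" if u: "u \<in> sp (Suc (Suc n))" for u
    using dualD(2)[OF dual_codegen0 u]
    by (simp add: counit0_tau_c[OF u] inv_into_tau_c dualD(2)[OF dual_tau_c] tau_c_inverse)
qed

lemma induces_coface0: "induces n (Suc n) (sa n 0) (coface0 H M n)"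
  unfolding induces_def
proof (intro conjI ballI descends_coface0 degen0_coinvariants)
  fix v assume v: "v \<in> CC n"
  show "cong_mod (Suc n) (coface0 H M n (alpha H M n v)) (alpha H M (Suc n) (sa n 0 v))"
    using cong_mod_refl[OF alpha_in[OF degen0_coinvariants[OF v]]] coface0_alpha[OF coinvariants_sp[OF v]] by simp
qed

text \<open>The codegeneracy of index i is conjugate to that of index 0, which is the dual face of
  index 1; the iteration therefore starts from the face of index 1 and ends at index i + 1.\<close>

lemma face_a_iterate:
  "i \<le> n \<Longrightarrow> v \<in> CC (Suc n) \<Longrightarrow>
    (ta n ^^ i) (da (Suc n) (Suc 0) ((tau_a_inv (Suc n) ^^ i) v)) = da (Suc n) (Suc i) v"
proof (induction i arbitrary: v)
  case (Suc i)
  have "(ta n ^^ Suc i) (da (Suc n) (Suc 0) ((tau_a_inv (Suc n) ^^ Suc i) v))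
    = ta n ((ta n ^^ i) (da (Suc n) (Suc 0) ((tau_a_inv (Suc n) ^^ i) (tau_a_inv (Suc n) v))))"
    by (simp only: funpow.simps(2)[of i "ta n"] funpow_Suc_right[of i "tau_a_inv (Suc n)"] o_apply)
  also have "\<dots> = ta n (da (Suc n) (Suc i) (tau_a_inv (Suc n) v))"
    using Suc by (simp add: tau_a_inv_coinvariants)
  also have "\<dots> = da (Suc n) (Suc (Suc i)) v"
    using Suc.prems by (simp add: face_a_conj coinvariants_sp)
  finally show ?case .
qed simp

lemma degen_a_iterate:
  "v \<in> CC n \<Longrightarrow> (ta (Suc n) ^^ j) (sa n 0 ((tau_a_inv n ^^ j) v)) = sa n j v"
proof (induction j arbitrary: v)
  case (Suc j)
  have "(ta (Suc n) ^^ Suc j) (sa n 0 ((tau_a_inv n ^^ Suc j) v))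
    = ta (Suc n) ((ta (Suc n) ^^ j) (sa n 0 ((tau_a_inv n ^^ j) (tau_a_inv n v))))"
    by (simp only: funpow.simps(2)[of j "ta (Suc n)"] funpow_Suc_right[of j "tau_a_inv n"] o_apply)
  also have "\<dots> = ta (Suc n) (sa n j (tau_a_inv n v))"
    using Suc by (simp add: tau_a_inv_coinvariants)
  also have "\<dots> = sa n (Suc j) v"
    using Suc.prems by (simp add: degen_a_Suc inv_into_tau_a coinvariants_sp)
  finally show ?case .
qed simp

lemma induces_codegen:
  assumes "i \<le> n"
  shows "induces (Suc n) n (da (Suc n) (Suc i)) (codegen_c H M (Suc n) i)"
proof (rule induces_cong)
  show "induces (Suc n) n (\<lambda>v. (ta n ^^ i) (da (Suc n) (Suc 0) ((tau_a_inv (Suc n) ^^ i) v)))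
     (\<lambda>u. (ti n ^^ i) (codegen0 H M (Suc n) ((tc (Suc n) ^^ i) u)))"
    by (rule induces_comp[OF induces_comp[OF induces_funpow[OF induces_tau_inv] induces_codegen0] induces_funpow[OF induces_tau]])
qed (simp_all add: face_a_iterate[OF assms] codegen_c_def)

lemma induces_coface: "induces n (Suc n) (sa n j) (coface_c H M n j)"
proof (rule induces_cong)
  show "induces n (Suc n) (\<lambda>v. (ta (Suc n) ^^ j) (sa n 0 ((tau_a_inv n ^^ j) v)))
     (\<lambda>u. (ti (Suc n) ^^ j) (coface0 H M n ((tc n ^^ j) u)))"
    by (rule induces_comp[OF induces_comp[OF induces_funpow[OF induces_tau_inv] induces_coface0] induces_funpow[OF induces_tau]])
qed (simp_all add: degen_a_iterate coface_c_def)

lemma induces_face: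
  assumes "j \<le> Suc n"
  shows "induces (Suc n) n (da (Suc n) j) (face (cyclic_dual (Tc H M)) (Suc n) j)"
proof (cases j)
  case 0
  \<comment> \<open>The dual face of index 0 is the last codegeneracy after \<open>tc\<close>. It
    matches the last face after the inverse of \<open>ta\<close>, and this is the face of index
    0.\<close>
  have "induces (Suc n) n (\<lambda>v. da (Suc n) (Suc n) (tau_a_inv (Suc n) v)) (\<lambda>u. codegen_c H M (Suc n) n (tc (Suc n) u))"
    by (rule induces_comp[OF induces_tau_inv induces_codegen]) simp
  then show ?thesis
  proof (rule induces_cong)
    show "da (Suc n) (Suc n) (tau_a_inv (Suc n) v) = da (Suc n) j v" if "v \<in> CC (Suc n)" for v
      using face0_tau[OF coinvariants_sp[OF tau_a_inv_coinvariants[OF that]]]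
      by (simp add: 0 tau_a_inverse coinvariants_sp[OF that])
  qed (simp add: 0 cyclic_dual_def Tc_def)
next
  case (Suc i)
  have "face (cyclic_dual (Tc H M)) (Suc n) j = codegen_c H M (Suc n) i"
    by (simp add: Suc cyclic_dual_def Tc_def)
  then show ?thesis using induces_codegen[of i n] assms Suc by simp
qed

lemma cyclic_module_iso_comparison:
  "cyclic_module_iso R (CMa H M) (CMc_dual H M) (\<lambda>n. quot_proj H M n \<circ> alpha H M n)"
proof (rule cyclic_module_transport[OF cyclic_module_CMa])
  let ?f = "\<lambda>n. quot_proj H M n \<circ> alpha H M n"
  have o: "obj (CMc_dual H M) n = quot_module (subspace_module (sp (Suc n))) (WW n)" for n
    by (simp add: CMc_dual_def quot_cyclic_def cyclic_dual_def Tc_def T_space_eq)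
  have fe: "?f n v = coset n (alpha H M n v)" for n v by (simp add: quot_proj_eq)
  note a = dual_add[OF dual_alpha] dual_scale[OF dual_alpha] dual_diff[OF dual_alpha]
  have q: "quot_map (subspace_module V) (WW m) g' (?f n v) = ?f m (g v)"
    if c: "induces n m g g'" and v: "v \<in> CC n" for n m g g' V v
  proof -
    have "quot_map (subspace_module V) (WW m) g' (coset n (alpha H M n v)) = coset m (g' (alpha H M n v))"
      by (rule descends_quot_map) (use c alpha_in[OF v] in \<open>auto simp: induces_def\<close>)
    also have "\<dots> = coset m (alpha H M m (g v))"
      by (rule coset_eqI) (use c v in \<open>auto simp: induces_def cong_mod_def\<close>)
    finally show ?thesis by (simp add: quot_proj_eq)
  qed
  show "bij_betw (?f n) (carrier (obj (CMa H M) n)) (carrier (obj (CMc_dual H M) n))" for n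
    unfolding o quot_module_simps CMa_simps carrier_subspace_module
  proof (rule bij_betwI')
    fix u v assume u: "u \<in> CC n" and v: "v \<in> CC n"
    show "(?f n u = ?f n v) = (u = v)"
    proof
      assume "?f n u = ?f n v"
      then have "alpha H M n u - alpha H M n v \<in> WW n" unfolding fe by (rule coset_eqD)
      then have "alpha H M n (u - v) \<in> WW n" using a(3) coinvariants_sp[OF u] coinvariants_sp[OF v] by simp
      moreover have "u - v \<in> CC n" using u v by (rule fs.subspace_diff[OF CC_subspace])
      ultimately have "u - v = 0" by (rule alpha_kernel[rotated])
      then show "u = v" by simp
    qed simp
  next
    show "?f n v \<in> coset n ` sp (Suc n)" if "v \<in> CC n" for v unfolding fe using alpha_in[OF that] by blast
    fix y assume "y \<in> coset n ` sp (Suc n)"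
    then obtain u where u: "u \<in> sp (Suc n)" "y = coset n u" by blast
    obtain v where v: "v \<in> CC n" "cong_mod n (alpha H M n v) u" using alpha_onto[OF u(1)] by blast
    have "y = ?f n v" unfolding fe u(2) by (rule coset_eqI[symmetric]) (use v(2) in \<open>simp add: cong_mod_def\<close>)
    then show "\<exists>x\<in>CC n. y = ?f n x" using v(1) by blast
  qed
  show "?f n (u \<oplus>\<^bsub>obj (CMa H M) n\<^esub> v) = ?f n u \<oplus>\<^bsub>obj (CMc_dual H M) n\<^esub> ?f n v"
    if "u \<in> carrier (obj (CMa H M) n)" "v \<in> carrier (obj (CMa H M) n)" for n u v
    using that unfolding fe o quot_module_simps
    by (simp add: CMa_simps) (simp add: subspace_module_def a coinvariants_sp)
  show "?f n (c \<odot>\<^bsub>obj (CMa H M) n\<^esub> v) = c \<odot>\<^bsub>obj (CMc_dual H M) n\<^esub> ?f n v"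
    if "c \<in> carrier R" "v \<in> carrier (obj (CMa H M) n)" for n c v
    using that unfolding fe o quot_module_simps
    by (simp add: CMa_simps) (simp add: subspace_module_def a coinvariants_sp)
  show "?f n \<zero>\<^bsub>obj (CMa H M) n\<^esub> = \<zero>\<^bsub>obj (CMc_dual H M) n\<^esub>" for n
    unfolding fe o quot_module_simps by (simp add: CMa_simps subspace_module_def dual_0[OF dual_alpha])
  show "face (CMc_dual H M) n j (?f n v) = ?f (n - 1) (face (CMa H M) n j v)"
    if n: "1 \<le> n" "j \<le> n" and v: "v \<in> carrier (obj (CMa H M) n)" for n j v
  proof -
    obtain m where m: "n = Suc m" using n by (cases n) auto
    have "face (CMc_dual H M) n j = quot_map (subspace_module (T_space H M m)) (WW m) (face (cyclic_dual (Tc H M)) n j)"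
      by (simp add: CMc_dual_def quot_cyclic_def cyclic_dual_def Tc_def m)
    then show ?thesis using q[OF induces_face[of j m], of v] n v by (simp add: CMa_simps m)
  qed
  show "degen (CMc_dual H M) n j (?f n v) = ?f (n + 1) (degen (CMa H M) n j v)"
    if "j \<le> n" and v: "v \<in> carrier (obj (CMa H M) n)" for n j v
  proof -
    have "degen (CMc_dual H M) n j = quot_map (subspace_module (T_space H M (Suc n))) (WW (Suc n)) (coface_c H M n j)"
      by (simp add: CMc_dual_def quot_cyclic_def cyclic_dual_def Tc_def)
    then show ?thesis using q[OF induces_coface[of n j], of v] v by (simp add: CMa_simps)
  qed
  show "tau (CMc_dual H M) n (?f n v) = ?f n (tau (CMa H M) n v)"
    if v: "v \<in> carrier (obj (CMa H M) n)" for n v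
  proof -
    have "tau (CMc_dual H M) n = quot_map (subspace_module (T_space H M n)) (WW n) (ti n)"
      by (simp add: CMc_dual_def quot_cyclic_def cyclic_dual_def Tc_def)
    then show ?thesis using q[OF induces_tau[of n], of v] v by (simp add: CMa_simps)
  qed
qed

end


theorem theorem5p10:
  fixes H :: "('k::field, 'h::ring_1) hopf_data"
    and M :: "('k, 'h, 'x::ab_group_add) hmod_data"
  assumes "hopf_algebra H"
    and "bij (antipode H)"
    and "anti_yetter_drinfeld H M"
    and "stable_hmodule H M"
  shows "cyclic_module_iso (ring_of_type_algebra :: 'k ring) (CMa H M) (CMc_dual H M)
           (\<lambda>n. quot_proj H M n \<circ> alpha H M n)"
proof -
  interpret ayd_module H M
    using assms by unfold_locales
  show ?thesis by (rule cyclic_module_iso_comparison)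
qed

end
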